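(* Let $G$ be an abelian group, $P$ a finite dimensional Poisson algebra over a field $k$, and let $G\text{-}\mathbf{gradings}(P)$ be the set of isomorphism classes of all $G$-gradings on $P$. Then the map $$\mathrm{Hom}_{\mathrm{BiAlg}}\bigl(\mathcal{P}(P),k[G]\bigr)/\!\approx\ \ \longrightarrow\ \ G\text{-}\mathbf{gradings}(P),\qquad \hat\theta\mapsto P^{(\theta)}:=\bigoplus_{\sigma\in G}P_\sigma^{(\theta)},$$ where $P_\sigma^{(\theta)}=\{x\in P\mid \bigl((\mathrm{Id}_P\otimes\theta)\circ\eta_P\bigr)(x)=x\otimes\sigma\}$ for all $\sigma\in G$, is bijective.
   Context: All vector spaces, algebras and tensor products are over an arbitrary field $k$. A Poisson algebra is a vector space $P$ which is both an associative commutative (not necessarily unital) algebra and a Lie algebra such that $[x, yz] = [x,y]z + y[x,z]$ for all $x,y,z$. Morphisms of Poisson algebras are linear maps that are both algebra and Lie algebra homomorphisms; $\mathrm{Aut}_{\mathrm{Poiss}}(P)$ is the group of automorphisms of $P$. A $G$-grading on $P$ is a vector space decomposition $P=\bigoplus_{\sigma\in G}P_\sigma$ with $P_\sigma P_\tau\subseteq P_{\sigma\tau}$ and $[P_\sigma,P_\tau]\subseteq P_{\sigma\tau}$ for all $\sigma,\tau\in G$. Two $G$-gradings $P=\bigoplus_\sigma P_\sigma=\bigoplus_\sigma P'_\sigma$ are isomorphic if there is $w\in\mathrm{Aut}_{\mathrm{Poiss}}(P)$ with $w(P_\sigma)=P'_\sigma$ for all $\sigma\in G$. $k[G]$ is the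 group algebra with its usual bialgebra structure. Let $\{e_1,\dots,e_n\}$ be a basis of $P$, with $e_ie_j=\sum_s\tau_{i,j}^se_s$ and $[e_i,e_j]=\sum_s\mu_{i,j}^se_s$. $\mathcal{P}(P)$ is the unital commutative algebra generated by $x_{si}$ ($s,i=1,\dots,n$) subject to the relations $\sum_{u=1}^n\tau_{i,j}^ux_{au}=\sum_{s,t=1}^n\tau_{s,t}^ax_{si}x_{tj}$ and $\sum_{u=1}^n\mu_{i,j}^ux_{au}=\sum_{s,t=1}^n\mu_{s,t}^ax_{si}x_{tj}$ for all $a,i,j=1,\dots,n$. It is a bialgebra with $\Delta(x_{ij})=\sum_{s=1}^nx_{is}\otimes x_{sj}$ and $\varepsilon(x_{ij})=\delta_{i,j}$. The map $\eta_P\colon P\to P\otimes\mathcal{P}(P)$ is the linear map $\eta_P(e_i)=\sum_{s=1}^ne_s\otimes x_{si}$. For a bialgebra $H$, $H^{\mathrm{o}}$ is its finite dual and $G(H^{\mathrm{o}})$ its set of group-like elements, which equals the set of unital algebra homomorphisms $H\to k$ and is a monoid under convolution; $U(G(H^{\mathrm{o}}))$ is the group of its invertible elements. Two bialgebra homomorphisms $\theta_1,\theta_2\colon\mathcal{P}(P)\to k[G]$ are called conjugate, $\theta_1\approx\theta_2$, if there is $g\in U\bigl(G(\mathcal{P}(P)^{\mathrm{o}})\bigr)$ such that $\theta_2=g\star\theta_1\star g^{-1}$ in the convolution algebra $\mathrm{Hom}_k(\mathcal{P}(P),k[G])$, where $(\theta\star\theta')(h)=\sum\theta(h_{(1)})\theta'(h_{(2)})$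 and $g,g^{-1}\colon \mathcal{P}(P)\to k$ are viewed as maps into $k[G]$ via the unit $k\to k[G]$. $\mathrm{Hom}_{\mathrm{BiAlg}}(\mathcal{P}(P),k[G])/\!\approx$ is the quotient set of the set of bialgebra homomorphisms by this equivalence relation and $\hat\theta$ denotes the class of $\theta$. In the displayed map, $P^{(\theta)}$ stands for the isomorphism class of that grading. *)

theory Defs
  imports
    Complex_Main
    "HOL-Algebra.QuotRing"
    "HOL-Algebra.Module"
    "HOL-Library.Poly_Mapping"
    "HOL-Library.FuncSet"
begin

text \<open>
  The ground field, the Poisson algebra and the grading group are types. Algebras whose carrier
  depends on parameters (presented algebras and tensor products) are records of type
  \<^typ>\<open>('k, 'a) module\<close> from HOL-Algebra, with scalars in the field type \<^typ>\<open>'k\<close>.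
\<close>

section \<open>Poisson algebras and gradings\<close>

locale poisson_algebra = vector_space scale
  for scale :: "'k::field \<Rightarrow> 'p::ab_group_add \<Rightarrow> 'p" +
  fixes pmult :: "'p \<Rightarrow> 'p \<Rightarrow> 'p" and bracket :: "'p \<Rightarrow> 'p \<Rightarrow> 'p"
  assumes pmult_add_left: "pmult (x + y) z = pmult x z + pmult y z"
    and pmult_scale_left: "pmult (scale c x) y = scale c (pmult x y)"
    and pmult_commute: "pmult x y = pmult y x"
    and pmult_assoc: "pmult (pmult x y) z = pmult x (pmult y z)"
    and bracket_add_left: "bracket (x + y) z = bracket x z + bracket y z"
    and bracket_add_right: "bracket x (y + z) = bracket x y + bracket x z"
    and bracket_scale_left: "bracket (scale c x) y = scale c (bracket x y)"
    and bracket_scale_right: "bracket x (scale c y) = scale c (bracket x y)"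
    and bracket_self: "bracket x x = 0"
    and jacobi: "bracket x (bracket y z) + bracket y (bracket z x) + bracket z (bracket x y) = 0"
    and leibniz: "bracket x (pmult y z) = pmult (bracket x y) z + pmult y (bracket x z)"

definition basis_family :: "('k::field \<Rightarrow> 'p::ab_group_add \<Rightarrow> 'p) \<Rightarrow> nat \<Rightarrow> (nat \<Rightarrow> 'p) \<Rightarrow> bool" where
  "basis_family scale n e \<longleftrightarrow>
     inj_on e {1..n} \<and> \<not> module.dependent scale (e ` {1..n}) \<and>
     module.span scale (e ` {1..n}) = UNIV"

definition poisson_aut ::
  "('k::field \<Rightarrow> 'p::ab_group_add \<Rightarrow> 'p) \<Rightarrow> ('p \<Rightarrow> 'p \<Rightarrow> 'p) \<Rightarrow> ('p \<Rightarrow> 'p \<Rightarrow> 'p) \<Rightarrow> ('p \<Rightarrow> 'p) set" where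
  "poisson_aut scale pmult bracket =
     {w. Vector_Spaces.linear scale scale w \<and> bij w \<and>
         (\<forall>x y. w (pmult x y) = pmult (w x) (w y)) \<and>
         (\<forall>x y. w (bracket x y) = bracket (w x) (w y))}"

text \<open>The abelian group \<open>G\<close> is written additively, so that its group algebra is \<open>'g \<Rightarrow>\<^sub>0 'k\<close> with the
  convolution product of \<^theory>\<open>HOL-Library.Poly_Mapping\<close>.\<close>

definition gradings ::
  "('k::field \<Rightarrow> 'p::ab_group_add \<Rightarrow> 'p) \<Rightarrow> ('p \<Rightarrow> 'p \<Rightarrow> 'p) \<Rightarrow> ('p \<Rightarrow> 'p \<Rightarrow> 'p) \<Rightarrow>
   ('g::ab_group_add \<Rightarrow> 'p set) set" where
  "gradings scale pmult bracket =
     {D. (\<forall>\<sigma>. module.subspace scale (D \<sigma>)) \<and>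
         (\<forall>x. \<exists>!f :: 'g \<Rightarrow>\<^sub>0 'p. (\<forall>\<sigma>. Poly_Mapping.lookup f \<sigma> \<in> D \<sigma>) \<and>
               x = (\<Sum>\<sigma>\<in>Poly_Mapping.keys f. Poly_Mapping.lookup f \<sigma>)) \<and>
         (\<forall>\<sigma> \<tau>. \<forall>x\<in>D \<sigma>. \<forall>y\<in>D \<tau>. pmult x y \<in> D (\<sigma> + \<tau>)) \<and>
         (\<forall>\<sigma> \<tau>. \<forall>x\<in>D \<sigma>. \<forall>y\<in>D \<tau>. bracket x y \<in> D (\<sigma> + \<tau>))}"

definition grading_iso ::
  "('k::field \<Rightarrow> 'p::ab_group_add \<Rightarrow> 'p) \<Rightarrow> ('p \<Rightarrow> 'p \<Rightarrow> 'p) \<Rightarrow> ('p \<Rightarrow> 'p \<Rightarrow> 'p) \<Rightarrow>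
   (('g::ab_group_add \<Rightarrow> 'p set) \<times> ('g \<Rightarrow> 'p set)) set" where
  "grading_iso scale pmult bracket =
     {(D, D'). D \<in> gradings scale pmult bracket \<and> D' \<in> gradings scale pmult bracket \<and>
        (\<exists>w\<in>poisson_aut scale pmult bracket. \<forall>\<sigma>. w ` D \<sigma> = D' \<sigma>)}"


section \<open>Tensor products over the ground field\<close>

definition pm_scale :: "'k::field \<Rightarrow> ('a \<Rightarrow>\<^sub>0 'k) \<Rightarrow> ('a \<Rightarrow>\<^sub>0 'k)" where
  "pm_scale c = Poly_Mapping.map ((*) c)"

text \<open>\<open>A \<otimes> B\<close> is the free vector space on \<open>carrier A \<times> carrier B\<close> modulo the subspace spanned by the
  bilinearity relations; its elements are cosets.\<close>

definition tensor_null ::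
  "('k::field, 'a, 'm) module_scheme \<Rightarrow> ('k, 'b, 'n) module_scheme \<Rightarrow> ('a \<times> 'b \<Rightarrow>\<^sub>0 'k) set" where
  "tensor_null A B = module.span pm_scale
     ({Poly_Mapping.single (a \<oplus>\<^bsub>A\<^esub> a', b) 1 - Poly_Mapping.single (a, b) 1 - Poly_Mapping.single (a', b) 1
        | a a' b. a \<in> carrier A \<and> a' \<in> carrier A \<and> b \<in> carrier B} \<union>
      {Poly_Mapping.single (a, b \<oplus>\<^bsub>B\<^esub> b') 1 - Poly_Mapping.single (a, b) 1 - Poly_Mapping.single (a, b') 1
        | a b b'. a \<in> carrier A \<and> b \<in> carrier B \<and> b' \<in> carrier B} \<union>
      {Poly_Mapping.single (c \<odot>\<^bsub>A\<^esub> a, b) 1 - Poly_Mapping.single (a, b) c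
        | c a b. a \<in> carrier A \<and> b \<in> carrier B} \<union>
      {Poly_Mapping.single (a, c \<odot>\<^bsub>B\<^esub> b) 1 - Poly_Mapping.single (a, b) c
        | c a b. a \<in> carrier A \<and> b \<in> carrier B})"

definition tensor_class ::
  "('k::field, 'a, 'm) module_scheme \<Rightarrow> ('k, 'b, 'n) module_scheme \<Rightarrow>
   ('a \<times> 'b \<Rightarrow>\<^sub>0 'k) \<Rightarrow> ('a \<times> 'b \<Rightarrow>\<^sub>0 'k) set" where
  "tensor_class A B u = (\<lambda>z. u + z) ` tensor_null A B"

definition tensor_elt ::
  "('k::field, 'a, 'm) module_scheme \<Rightarrow> ('k, 'b, 'n) module_scheme \<Rightarrow> 'a \<Rightarrow> 'b \<Rightarrow> ('a \<times> 'b \<Rightarrow>\<^sub>0 'k) set" where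
  "tensor_elt A B a b = tensor_class A B (Poly_Mapping.single (a, b) 1)"

text \<open>The bilinear extension of \<open>(a \<otimes> b) (a' \<otimes> b') = a a' \<otimes> b b'\<close> to the free vector space.\<close>

definition free_tensor_mult ::
  "('k::field, 'a, 'm) module_scheme \<Rightarrow> ('k, 'b, 'n) module_scheme \<Rightarrow>
   ('a \<times> 'b \<Rightarrow>\<^sub>0 'k) \<Rightarrow> ('a \<times> 'b \<Rightarrow>\<^sub>0 'k) \<Rightarrow> ('a \<times> 'b \<Rightarrow>\<^sub>0 'k)" where
  "free_tensor_mult A B u v =
     (\<Sum>p\<in>Poly_Mapping.keys u. \<Sum>q\<in>Poly_Mapping.keys v.
        Poly_Mapping.single (fst p \<otimes>\<^bsub>A\<^esub> fst q, snd p \<otimes>\<^bsub>B\<^esub> snd q)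
          (Poly_Mapping.lookup u p * Poly_Mapping.lookup v q))"

definition tensor ::
  "('k::field, 'a, 'm) module_scheme \<Rightarrow> ('k, 'b, 'n) module_scheme \<Rightarrow>
   ('k, ('a \<times> 'b \<Rightarrow>\<^sub>0 'k) set) module" where
  "tensor A B =
     \<lparr>carrier = tensor_class A B ` {u. Poly_Mapping.keys u \<subseteq> carrier A \<times> carrier B},
      mult = (\<lambda>X Y. \<Union>u\<in>X. \<Union>v\<in>Y. tensor_class A B (free_tensor_mult A B u v)),
      one = tensor_elt A B \<one>\<^bsub>A\<^esub> \<one>\<^bsub>B\<^esub>,
      zero = tensor_null A B,
      add = (\<lambda>X Y. \<Union>u\<in>X. \<Union>v\<in>Y. tensor_class A B (u + v)),
      smult = (\<lambda>c X. \<Union>u\<in>X. tensor_class A B (pm_scale c u))\<rparr>"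

text \<open>For bilinear \<open>\<beta>\<close>, the linear map into \<open>C\<close> with \<open>a \<otimes> b \<mapsto> \<beta> a b\<close>; the value does not depend on the
  chosen representative.\<close>

definition tensor_lift ::
  "('k::field, 'c, 'm) module_scheme \<Rightarrow> ('a \<Rightarrow> 'b \<Rightarrow> 'c) \<Rightarrow> ('a \<times> 'b \<Rightarrow>\<^sub>0 'k) set \<Rightarrow> 'c" where
  "tensor_lift C \<beta> X =
     (let u = (SOME u. u \<in> X)
      in \<Oplus>\<^bsub>C\<^esub>p\<in>Poly_Mapping.keys u. Poly_Mapping.lookup u p \<odot>\<^bsub>C\<^esub> \<beta> (fst p) (snd p))"

text \<open>The map \<open>f \<otimes> g\<close> into \<open>A \<otimes> B\<close>.\<close>

definition tensor_map ::
  "('k::field, 'c, 'm) module_scheme \<Rightarrow> ('k, 'd, 'n) module_scheme \<Rightarrow> ('a \<Rightarrow> 'c) \<Rightarrow> ('b \<Rightarrow> 'd) \<Rightarrow>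
   ('a \<times> 'b \<Rightarrow>\<^sub>0 'k) set \<Rightarrow> ('c \<times> 'd \<Rightarrow>\<^sub>0 'k) set" where
  "tensor_map A B f g = tensor_lift (tensor A B) (\<lambda>a b. tensor_elt A B (f a) (g b))"


section \<open>Algebras, bialgebras and convolution\<close>

definition field_algebra :: "('k::field, 'k) module" where
  "field_algebra =
     \<lparr>carrier = UNIV, mult = (*), one = 1, zero = 0, add = (+), smult = (*)\<rparr>"

text \<open>Homomorphisms of unital algebras, as extensional functions on the carrier.\<close>

definition alg_hom ::
  "('k, 'a, 'm) module_scheme \<Rightarrow> ('k, 'b, 'n) module_scheme \<Rightarrow> ('a \<Rightarrow> 'b) set" where
  "alg_hom A B =
     {f \<in> ring_hom A B \<inter> extensional (carrier A).
        \<forall>c. \<forall>a\<in>carrier A. f (c \<odot>\<^bsub>A\<^esub> a) = c \<odot>\<^bsub>B\<^esub> f a}"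

record (overloaded) ('k::zero, 'a) bialgebra = "('k, 'a) module" +
  comult :: "'a \<Rightarrow> ('a \<times> 'a \<Rightarrow>\<^sub>0 'k) set"
  counit :: "'a \<Rightarrow> 'k"

definition bialg_hom ::
  "('k::field, 'a, 'm) bialgebra_scheme \<Rightarrow> ('k, 'b, 'n) bialgebra_scheme \<Rightarrow> ('a \<Rightarrow> 'b) set" where
  "bialg_hom H B =
     {\<theta> \<in> alg_hom H B. \<forall>h\<in>carrier H.
        tensor_map B B \<theta> \<theta> (comult H h) = comult B (\<theta> h) \<and> counit B (\<theta> h) = counit H h}"

definition convolution ::
  "('k::field, 'a, 'm) bialgebra_scheme \<Rightarrow> ('k, 'b, 'n) module_scheme \<Rightarrow>
   ('a \<Rightarrow> 'b) \<Rightarrow> ('a \<Rightarrow> 'b) \<Rightarrow> ('a \<Rightarrow> 'b)" where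
  "convolution H A f g =
     (\<lambda>h\<in>carrier H. tensor_lift A (\<lambda>a b. f a \<otimes>\<^bsub>A\<^esub> g b) (comult H h))"

text \<open>The finite dual: linear functionals vanishing on an ideal of finite codimension.\<close>

definition finite_dual :: "('k::field, 'a, 'm) module_scheme \<Rightarrow> ('a \<Rightarrow> 'k) set" where
  "finite_dual H =
     {f \<in> extensional (carrier H).
        (\<forall>a\<in>carrier H. \<forall>b\<in>carrier H. f (a \<oplus>\<^bsub>H\<^esub> b) = f a + f b) \<and>
        (\<forall>c. \<forall>a\<in>carrier H. f (c \<odot>\<^bsub>H\<^esub> a) = c * f a) \<and>
        (\<exists>I. ideal I H \<and> (\<forall>a\<in>I. f a = 0) \<and>
          (\<exists>F. finite F \<and> F \<subseteq> carrier H \<and>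
            (\<forall>h\<in>carrier H. \<exists>c. \<exists>a\<in>I. h = (\<Oplus>\<^bsub>H\<^esub>b\<in>F. c b \<odot>\<^bsub>H\<^esub> b) \<oplus>\<^bsub>H\<^esub> a)))}"

text \<open>Comultiplication and counit of the finite dual are dual to multiplication and unit of \<open>H\<close>, i.e.
  \<open>\<Delta> f = \<Sum> f' \<otimes> f''\<close> means \<open>f (a b) = \<Sum> f' a * f'' b\<close> for all \<open>a\<close>, \<open>b\<close>, and \<open>\<epsilon> f = f 1\<close>. So the
  group-like condition \<open>\<Delta> f = f \<otimes> f\<close>, \<open>\<epsilon> f = 1\<close> says that \<open>f\<close> is multiplicative and unital.\<close>

definition group_likes :: "('k::field, 'a, 'm) module_scheme \<Rightarrow> ('a \<Rightarrow> 'k) set" where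
  "group_likes H =
     {f \<in> finite_dual H.
        (\<forall>a\<in>carrier H. \<forall>b\<in>carrier H. f (a \<otimes>\<^bsub>H\<^esub> b) = f a * f b) \<and> f \<one>\<^bsub>H\<^esub> = 1}"

definition group_like_monoid :: "('k::field, 'a, 'm) bialgebra_scheme \<Rightarrow> ('a \<Rightarrow> 'k) monoid" where
  "group_like_monoid H =
     \<lparr>carrier = group_likes H, mult = convolution H field_algebra,
      one = restrict (counit H) (carrier H)\<rparr>"

definition unit_map :: "('k, 'a, 'm) module_scheme \<Rightarrow> 'k \<Rightarrow> 'a" where
  "unit_map A c = c \<odot>\<^bsub>A\<^esub> \<one>\<^bsub>A\<^esub>"

definition conjugate ::
  "('k::field, 'a, 'm) bialgebra_scheme \<Rightarrow> ('k, 'b, 'n) bialgebra_scheme \<Rightarrow>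
   (('a \<Rightarrow> 'b) \<times> ('a \<Rightarrow> 'b)) set" where
  "conjugate H B =
     {(\<theta>\<^sub>1, \<theta>\<^sub>2). \<theta>\<^sub>1 \<in> bialg_hom H B \<and> \<theta>\<^sub>2 \<in> bialg_hom H B \<and>
        (\<exists>g\<in>Units (group_like_monoid H).
           \<theta>\<^sub>2 = convolution H B (convolution H B (unit_map B \<circ> g) \<theta>\<^sub>1)
                    (unit_map B \<circ> inv\<^bsub>group_like_monoid H\<^esub> g))}"


section \<open>The group algebra\<close>

definition group_alg :: "('k::field, 'g::ab_group_add \<Rightarrow>\<^sub>0 'k) module" where
  "group_alg =
     \<lparr>carrier = UNIV, mult = (*), one = 1, zero = 0, add = (+), smult = pm_scale\<rparr>"

definition group_elt :: "'g::ab_group_add \<Rightarrow> ('g \<Rightarrow>\<^sub>0 'k::field)" where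
  "group_elt \<sigma> = Poly_Mapping.single \<sigma> 1"

definition group_bialgebra :: "('k::field, 'g::ab_group_add \<Rightarrow>\<^sub>0 'k) bialgebra" where
  "group_bialgebra = module.extend group_alg (bialgebra.fields
     (\<lambda>u. \<Oplus>\<^bsub>tensor group_alg group_alg\<^esub>\<sigma>\<in>Poly_Mapping.keys u.
        Poly_Mapping.lookup u \<sigma> \<odot>\<^bsub>tensor group_alg group_alg\<^esub>
          tensor_elt group_alg group_alg (group_elt \<sigma>) (group_elt \<sigma>))
     (\<lambda>u. \<Sum>\<sigma>\<in>Poly_Mapping.keys u. Poly_Mapping.lookup u \<sigma>))"


section \<open>The universal bialgebra of a Poisson algebra\<close>

text \<open>Polynomials in variables indexed by pairs; a polynomial is a finitely supported function on
  monomials, a monomial a finitely supported exponent function.\<close>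

type_synonym 'k pair_poly = "(nat \<times> nat \<Rightarrow>\<^sub>0 nat) \<Rightarrow>\<^sub>0 'k"

definition poly_var :: "nat \<Rightarrow> nat \<Rightarrow> 'k::field pair_poly" where
  "poly_var s i = Poly_Mapping.single (Poly_Mapping.single (s, i) 1) 1"

definition poly_alg :: "nat \<Rightarrow> ('k::field, 'k pair_poly) module" where
  "poly_alg n =
     \<lparr>carrier = {p. \<forall>m\<in>Poly_Mapping.keys p. Poly_Mapping.keys m \<subseteq> {1..n} \<times> {1..n}},
      mult = (*), one = 1, zero = 0, add = (+), smult = pm_scale\<rparr>"

definition hom_relation :: "nat \<Rightarrow> (nat \<Rightarrow> nat \<Rightarrow> nat \<Rightarrow> 'k::field) \<Rightarrow> nat \<Rightarrow> nat \<Rightarrow> nat \<Rightarrow> 'k pair_poly" where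
  "hom_relation n \<tau> a i j =
     (\<Sum>u=1..n. pm_scale (\<tau> i j u) (poly_var a u)) -
     (\<Sum>s=1..n. \<Sum>t=1..n. pm_scale (\<tau> s t a) (poly_var s i * poly_var t j))"

definition univ_ideal ::
  "nat \<Rightarrow> (nat \<Rightarrow> nat \<Rightarrow> nat \<Rightarrow> 'k::field) \<Rightarrow> (nat \<Rightarrow> nat \<Rightarrow> nat \<Rightarrow> 'k) \<Rightarrow> 'k pair_poly set" where
  "univ_ideal n \<tau> \<mu> = genideal (poly_alg n)
     ({hom_relation n \<tau> a i j | a i j. a \<in> {1..n} \<and> i \<in> {1..n} \<and> j \<in> {1..n}} \<union>
      {hom_relation n \<mu> a i j | a i j. a \<in> {1..n} \<and> i \<in> {1..n} \<and> j \<in> {1..n}})"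

definition univ_alg ::
  "nat \<Rightarrow> (nat \<Rightarrow> nat \<Rightarrow> nat \<Rightarrow> 'k::field) \<Rightarrow> (nat \<Rightarrow> nat \<Rightarrow> nat \<Rightarrow> 'k) \<Rightarrow>
   ('k, 'k pair_poly set) module" where
  "univ_alg n \<tau> \<mu> = ring.extend (poly_alg n Quot univ_ideal n \<tau> \<mu>) (module.fields
     (\<lambda>c X. \<Union>p\<in>X. univ_ideal n \<tau> \<mu> +>\<^bsub>poly_alg n\<^esub> pm_scale c p))"

definition univ_gen ::
  "nat \<Rightarrow> (nat \<Rightarrow> nat \<Rightarrow> nat \<Rightarrow> 'k::field) \<Rightarrow> (nat \<Rightarrow> nat \<Rightarrow> nat \<Rightarrow> 'k) \<Rightarrow>
   nat \<Rightarrow> nat \<Rightarrow> 'k pair_poly set" where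
  "univ_gen n \<tau> \<mu> s i = univ_ideal n \<tau> \<mu> +>\<^bsub>poly_alg n\<^esub> poly_var s i"

text \<open>Comultiplication and counit are the unique algebra homomorphisms with the prescribed values on
  the generators.\<close>

definition univ_comult ::
  "nat \<Rightarrow> (nat \<Rightarrow> nat \<Rightarrow> nat \<Rightarrow> 'k::field) \<Rightarrow> (nat \<Rightarrow> nat \<Rightarrow> nat \<Rightarrow> 'k) \<Rightarrow>
   'k pair_poly set \<Rightarrow> ('k pair_poly set \<times> 'k pair_poly set \<Rightarrow>\<^sub>0 'k) set" where
  "univ_comult n \<tau> \<mu> =
     (let A = univ_alg n \<tau> \<mu>; x = univ_gen n \<tau> \<mu>
      in THE \<Delta>. \<Delta> \<in> alg_hom A (tensor A A) \<and>
           (\<forall>i\<in>{1..n}. \<forall>j\<in>{1..n}.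
              \<Delta> (x i j) = (\<Oplus>\<^bsub>tensor A A\<^esub>s\<in>{1..n}. tensor_elt A A (x i s) (x s j))))"

definition univ_counit ::
  "nat \<Rightarrow> (nat \<Rightarrow> nat \<Rightarrow> nat \<Rightarrow> 'k::field) \<Rightarrow> (nat \<Rightarrow> nat \<Rightarrow> nat \<Rightarrow> 'k) \<Rightarrow>
   'k pair_poly set \<Rightarrow> 'k" where
  "univ_counit n \<tau> \<mu> =
     (THE \<epsilon>. \<epsilon> \<in> alg_hom (univ_alg n \<tau> \<mu>) field_algebra \<and>
        (\<forall>i\<in>{1..n}. \<forall>j\<in>{1..n}. \<epsilon> (univ_gen n \<tau> \<mu> i j) = (if i = j then 1 else 0)))"

definition univ_bialgebra ::
  "nat \<Rightarrow> (nat \<Rightarrow> nat \<Rightarrow> nat \<Rightarrow> 'k::field) \<Rightarrow> (nat \<Rightarrow> nat \<Rightarrow> nat \<Rightarrow> 'k) \<Rightarrow>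
   ('k, 'k pair_poly set) bialgebra" where
  "univ_bialgebra n \<tau> \<mu> =
     module.extend (univ_alg n \<tau> \<mu>) (bialgebra.fields (univ_comult n \<tau> \<mu>) (univ_counit n \<tau> \<mu>))"


section \<open>The grading attached to a bialgebra homomorphism\<close>

text \<open>The vector space of a type as a record, for use as a tensor factor; the ring multiplication
  and unit that the record type provides play no role.\<close>

definition type_space :: "('k::field \<Rightarrow> 'p::ab_group_add \<Rightarrow> 'p) \<Rightarrow> ('k, 'p) module" where
  "type_space scale =
     \<lparr>carrier = UNIV, mult = undefined, one = undefined, zero = 0, add = (+), smult = scale\<rparr>"

text \<open>The linear map \<open>\<eta>\<close> with \<open>\<eta> (e i) = \<Sum>s. e s \<otimes> x s i\<close>.\<close>

definition eta ::
  "('k::field \<Rightarrow> 'p::ab_group_add \<Rightarrow> 'p) \<Rightarrow> nat \<Rightarrow> (nat \<Rightarrow> 'p) \<Rightarrow>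
   (nat \<Rightarrow> nat \<Rightarrow> nat \<Rightarrow> 'k) \<Rightarrow> (nat \<Rightarrow> nat \<Rightarrow> nat \<Rightarrow> 'k) \<Rightarrow>
   'p \<Rightarrow> ('p \<times> 'k pair_poly set \<Rightarrow>\<^sub>0 'k) set" where
  "eta scale n e \<tau> \<mu> x =
     (let V = type_space scale; A = univ_alg n \<tau> \<mu>; T = tensor V A
      in \<Oplus>\<^bsub>T\<^esub>i\<in>{1..n}. module.representation scale (e ` {1..n}) x (e i) \<odot>\<^bsub>T\<^esub>
           (\<Oplus>\<^bsub>T\<^esub>s\<in>{1..n}. tensor_elt V A (e s) (univ_gen n \<tau> \<mu> s i)))"

definition induced_grading ::
  "('k::field \<Rightarrow> 'p::ab_group_add \<Rightarrow> 'p) \<Rightarrow> nat \<Rightarrow> (nat \<Rightarrow> 'p) \<Rightarrow>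
   (nat \<Rightarrow> nat \<Rightarrow> nat \<Rightarrow> 'k) \<Rightarrow> (nat \<Rightarrow> nat \<Rightarrow> nat \<Rightarrow> 'k) \<Rightarrow>
   ('k pair_poly set \<Rightarrow> ('g::ab_group_add \<Rightarrow>\<^sub>0 'k)) \<Rightarrow> 'g \<Rightarrow> 'p set" where
  "induced_grading scale n e \<tau> \<mu> \<theta> \<sigma> =
     {x. tensor_map (type_space scale) group_alg id \<theta> (eta scale n e \<tau> \<mu> x) =
         tensor_elt (type_space scale) group_alg x (group_elt \<sigma>)}"

end

theory Submission
  imports Defs
begin

text \<open>
  In coordinates, an algebra map \<open>\<theta>\<close> from the universal algebra to a commutative algebra \<open>C\<close> is the matrix
  of a multiplicative map \<open>P \<rightarrow> P \<otimes> C\<close>. For \<open>C = k[G]\<close>, compatibility with comultiplication and counit says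
  that the \<open>\<sigma>\<close>-components of this matrix are orthogonal idempotents with sum one, i.e. the projections
  of a direct sum decomposition; multiplicativity says that the decomposition is a grading. For
  \<open>C = k\<close> the invertible matrices are the Poisson automorphisms, convolution is the matrix product, and
  conjugating \<open>\<theta>\<close> by an automorphism transports the grading along it. All identities between algebra
  maps out of the universal algebra are checked on the generators.
\<close>

text \<open>\<open>univ_comult\<close> and \<open>univ_counit\<close> are definite descriptions and
  \<open>tensor_lift\<close> evaluates a representative picked by choice, so nothing is known about
  the bialgebra until three things are in place: tensor products of algebras, the universal property
  of the presented algebra, and the fact that a product of two solution matrices is again a solution
  (\<open>satisfies_tensor\<close>). Targets have to be commutative algebras; k[G] is one because G
  is abelian. The other obstacle is to read an equation back from a tensor product, whose elements
  are cosets. This happens only where the second factor is k[G], and there the coefficient maps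
  \<open>coef\<close>, a \<otimes> b \<mapsto> b_\<sigma> a, separate points. They turn both the
  comultiplication condition and the equation defining \<open>induced_grading\<close> into
  identities between coordinates. Once conjugacy is known to be exactly the pullback of isomorphism
  of gradings along a surjective map, the statement about quotient sets is formal.\<close>

abbreviation lookup where "lookup \<equiv> Poly_Mapping.lookup"
abbreviation single where "single \<equiv> Poly_Mapping.single"
abbreviation keys where "keys \<equiv> Poly_Mapping.keys"

section \<open>Vector spaces and algebras as records\<close>

text \<open>Scalars range over a type and vectors over a carrier, as in the records of the
  definitions, so that whole types, polynomial subalgebras, quotients and tensor products are
  covered alike.\<close>

locale k_space = abelian_group C
  for C :: "('k::field, 'c, 'm) module_scheme" (structure) +
  assumes smult_closed [simp, intro]: "x \<in> carrier C \<Longrightarrow> c \<odot> x \<in> carrier C"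
    and smult_add_left: "x \<in> carrier C \<Longrightarrow> (c + d) \<odot> x = c \<odot> x \<oplus> d \<odot> x"
    and smult_add_right: "x \<in> carrier C \<Longrightarrow> y \<in> carrier C \<Longrightarrow> c \<odot> (x \<oplus> y) = c \<odot> x \<oplus> c \<odot> y"
    and smult_assoc: "x \<in> carrier C \<Longrightarrow> (c * d) \<odot> x = c \<odot> (d \<odot> x)"
    and smult_1 [simp]: "x \<in> carrier C \<Longrightarrow> 1 \<odot> x = x"
begin

lemma smult_0_left [simp]: "x \<in> carrier C \<Longrightarrow> 0 \<odot> x = \<zero>"
  using smult_add_left[of x 0 0] by (simp add: add.l_cancel_one')

lemma smult_0_right [simp]: "c \<odot> \<zero> = \<zero>"
  using smult_add_right[of \<zero> \<zero> c] by (simp add: add.l_cancel_one')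

lemma smult_finsum:
  assumes "f \<in> K \<rightarrow> carrier C"
  shows "c \<odot> finsum C f K = (\<Oplus>i\<in>K. c \<odot> f i)"
  using assms by (induction K rule: infinite_finite_induct) (auto simp: smult_add_right Pi_def)

end

locale k_algebra = cring C + k_space C
  for C :: "('k::field, 'c, 'm) module_scheme" (structure) +
  assumes smult_mult_left: "x \<in> carrier C \<Longrightarrow> y \<in> carrier C \<Longrightarrow> (c \<odot> x) \<otimes> y = c \<odot> (x \<otimes> y)"
begin

lemma smult_mult_right: "x \<in> carrier C \<Longrightarrow> y \<in> carrier C \<Longrightarrow> x \<otimes> (c \<odot> y) = c \<odot> (x \<otimes> y)"
  using smult_mult_left[of y x c] by (simp add: m_comm)

end

text \<open>Unlike \<open>alg_hom\<close>, this asks for no extensionality, so composites and maps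
  such as \<open>tensor_map\<close> or \<open>coef\<close> qualify without being restricted.\<close>

definition k_linear ::
  "('k::field, 'a, 'm) module_scheme \<Rightarrow> ('k, 'b, 'n) module_scheme \<Rightarrow> ('a \<Rightarrow> 'b) set" where
  "k_linear A B =
     {f \<in> carrier A \<rightarrow> carrier B.
        (\<forall>x\<in>carrier A. \<forall>y\<in>carrier A. f (x \<oplus>\<^bsub>A\<^esub> y) = f x \<oplus>\<^bsub>B\<^esub> f y) \<and>
        (\<forall>c. \<forall>x\<in>carrier A. f (c \<odot>\<^bsub>A\<^esub> x) = c \<odot>\<^bsub>B\<^esub> f x)}"

lemma k_linearI:
  assumes "\<And>x. x \<in> carrier A \<Longrightarrow> f x \<in> carrier B"
    and "\<And>x y. x \<in> carrier A \<Longrightarrow> y \<in> carrier A \<Longrightarrow> f (x \<oplus>\<^bsub>A\<^esub> y) = f x \<oplus>\<^bsub>B\<^esub> f y"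
    and "\<And>c x. x \<in> carrier A \<Longrightarrow> f (c \<odot>\<^bsub>A\<^esub> x) = c \<odot>\<^bsub>B\<^esub> f x"
  shows "f \<in> k_linear A B"
  using assms by (auto simp: k_linear_def)

lemma k_linear_closed: "f \<in> k_linear A B \<Longrightarrow> x \<in> carrier A \<Longrightarrow> f x \<in> carrier B"
  and k_linear_add: "f \<in> k_linear A B \<Longrightarrow> x \<in> carrier A \<Longrightarrow> y \<in> carrier A \<Longrightarrow>
    f (x \<oplus>\<^bsub>A\<^esub> y) = f x \<oplus>\<^bsub>B\<^esub> f y"
  and k_linear_smult: "f \<in> k_linear A B \<Longrightarrow> x \<in> carrier A \<Longrightarrow> f (c \<odot>\<^bsub>A\<^esub> x) = c \<odot>\<^bsub>B\<^esub> f x"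
  by (auto simp: k_linear_def)

lemma k_linear_zero:
  assumes "f \<in> k_linear A B" "k_space A" "k_space B"
  shows "f \<zero>\<^bsub>A\<^esub> = \<zero>\<^bsub>B\<^esub>"
proof -
  interpret A: k_space A by fact
  interpret B: k_space B by fact
  have "f (0 \<odot>\<^bsub>A\<^esub> \<zero>\<^bsub>A\<^esub>) = 0 \<odot>\<^bsub>B\<^esub> f \<zero>\<^bsub>A\<^esub>"
    using assms(1) by (intro k_linear_smult) auto
  then show ?thesis using k_linear_closed[OF assms(1), of "\<zero>\<^bsub>A\<^esub>"] by simp
qed

lemma k_linear_finsum:
  assumes f: "f \<in> k_linear A B" and A: "k_space A" and B: "k_space B"
    and g: "g \<in> K \<rightarrow> carrier A"
  shows "f (finsum A g K) = (\<Oplus>\<^bsub>B\<^esub>i\<in>K. f (g i))"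
proof -
  interpret A: k_space A by fact
  interpret B: k_space B by fact
  show ?thesis using g
  proof (induction K rule: infinite_finite_induct)
    case (insert a K)
    then have "finsum A g K \<in> carrier A" by (intro A.finsum_closed) auto
    then show ?case using insert f
      by (subst A.finsum_insert) (auto simp: Pi_def k_linear_closed k_linear_add)
  qed (simp_all add: k_linear_zero[OF f A B])
qed

lemma k_linear_compose:
  "f \<in> k_linear A B \<Longrightarrow> g \<in> k_linear B C \<Longrightarrow> (\<lambda>x. g (f x)) \<in> k_linear A C"
  by (auto simp: k_linear_def Pi_def)

lemma alg_hom_iff:
  "f \<in> alg_hom A B \<longleftrightarrow> f \<in> k_linear A B \<and> f \<in> extensional (carrier A) \<and> f \<one>\<^bsub>A\<^esub> = \<one>\<^bsub>B\<^esub> \<and>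
     (\<forall>x\<in>carrier A. \<forall>y\<in>carrier A. f (x \<otimes>\<^bsub>A\<^esub> y) = f x \<otimes>\<^bsub>B\<^esub> f y)"
  unfolding alg_hom_def k_linear_def ring_hom_def by auto

lemma alg_hom_linear: "f \<in> alg_hom A B \<Longrightarrow> f \<in> k_linear A B"
  and alg_hom_mult: "f \<in> alg_hom A B \<Longrightarrow> x \<in> carrier A \<Longrightarrow> y \<in> carrier A \<Longrightarrow>
    f (x \<otimes>\<^bsub>A\<^esub> y) = f x \<otimes>\<^bsub>B\<^esub> f y"
  and alg_hom_one: "f \<in> alg_hom A B \<Longrightarrow> f \<one>\<^bsub>A\<^esub> = \<one>\<^bsub>B\<^esub>"
  and alg_hom_ext: "f \<in> alg_hom A B \<Longrightarrow> f \<in> extensional (carrier A)"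
  by (auto simp: alg_hom_iff)

lemmas alg_hom_closed = k_linear_closed[OF alg_hom_linear]

text \<open>Membership in \<open>alg_hom\<close> includes extensionality. The restriction supplies
  it, and later makes agreement on the carrier an equality of functions.\<close>

lemma alg_hom_restrictI:
  assumes "k_space A" "f \<in> k_linear A B" "f \<one>\<^bsub>A\<^esub> = \<one>\<^bsub>B\<^esub>" "\<one>\<^bsub>A\<^esub> \<in> carrier A"
    and "\<And>x y. x \<in> carrier A \<Longrightarrow> y \<in> carrier A \<Longrightarrow> x \<otimes>\<^bsub>A\<^esub> y \<in> carrier A"
    and "\<And>x y. x \<in> carrier A \<Longrightarrow> y \<in> carrier A \<Longrightarrow> f (x \<otimes>\<^bsub>A\<^esub> y) = f x \<otimes>\<^bsub>B\<^esub> f y"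
  shows "restrict f (carrier A) \<in> alg_hom A B"
proof -
  interpret A: k_space A by fact
  show ?thesis using assms by (auto simp: alg_hom_iff k_linear_def)
qed

lemma alg_hom_compose:
  assumes "k_algebra A" "f \<in> alg_hom A B" "g \<in> alg_hom B C"
  shows "(\<lambda>x\<in>carrier A. g (f x)) \<in> alg_hom A C"
proof -
  interpret A: k_algebra A by fact
  show ?thesis using assms
    by (intro alg_hom_restrictI k_linear_compose[of f A B g C])
      (auto simp: alg_hom_iff A.k_space_axioms k_linear_closed)
qed

section \<open>Finitely supported functions\<close>

lemma lookup_pm_scale [simp]: "lookup (pm_scale c u) p = c * lookup u p"
  by (simp add: pm_scale_def Poly_Mapping.map.rep_eq when_def)

lemma keys_pm_scale: "keys (pm_scale c u) \<subseteq> keys u"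
  by (auto simp: in_keys_iff)

interpretation pm: vector_space "pm_scale :: 'k::field \<Rightarrow> ('a \<Rightarrow>\<^sub>0 'k) \<Rightarrow> ('a \<Rightarrow>\<^sub>0 'k)"
  by unfold_locales (auto intro!: poly_mapping_eqI simp: lookup_add algebra_simps)

lemma pm_scale_single [simp]: "pm_scale c (single p d) = single p (c * d)"
  by (rule poly_mapping_eqI) (simp add: lookup_single when_def)

lemma pm_scale_mult_left: "pm_scale c u * v = pm_scale c (u * v)"
  for u v :: "'a::comm_monoid_add \<Rightarrow>\<^sub>0 'k::field"
  by (simp add: pm_scale_def mult_map_scale_conv_mult mult.assoc)

lemma pm_scale_mult_right: "u * pm_scale c v = pm_scale c (u * v)"
  for u v :: "'a::comm_monoid_add \<Rightarrow>\<^sub>0 'k::field"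
  using pm_scale_mult_left[of c v u] by (simp add: mult.commute)

lemma pm_expand:
  assumes "finite K" "keys u \<subseteq> K"
  shows "u = (\<Sum>p\<in>K. single p (lookup u p))"
proof (rule poly_mapping_eqI)
  fix q
  show "lookup u q
      = lookup (\<Sum>p\<in>K. single p (lookup u p)) q"
    using assms by (auto simp: lookup_sum lookup_single when_def in_keys_iff)
qed

text \<open>Serves at two levels: exponent vectors with variables in a given set, and polynomials
  whose exponent vectors are of that kind, whence the nested
  \<open>keys_in (keys_in (box n))\<close>. Representatives of a tensor product are described in the
  same way.\<close>

definition keys_in :: "'a set \<Rightarrow> ('a \<Rightarrow>\<^sub>0 'b::zero) set" where
  "keys_in S = {u. keys u \<subseteq> S}"

lemma keys_in_iff: "u \<in> keys_in S \<longleftrightarrow> (\<forall>p. p \<notin> S \<longrightarrow> lookup u p = 0)"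
  by (auto simp: keys_in_def in_keys_iff)

lemma keys_in_zero [simp]: "0 \<in> keys_in S"
  and keys_in_single: "p \<in> S \<Longrightarrow> single p c \<in> keys_in S"
  by (auto simp: keys_in_iff lookup_single when_def)

lemma keys_in_add: "u \<in> keys_in S \<Longrightarrow> v \<in> keys_in S \<Longrightarrow> u + v \<in> keys_in S"
  for u v :: "'a \<Rightarrow>\<^sub>0 'b::comm_monoid_add"
  by (auto simp: keys_in_iff lookup_add)

lemma keys_in_diff: "u \<in> keys_in S \<Longrightarrow> v \<in> keys_in S \<Longrightarrow> u - v \<in> keys_in S"
  for u v :: "'a \<Rightarrow>\<^sub>0 'b::ab_group_add"
  by (auto simp: keys_in_iff lookup_minus)

lemma keys_in_scale: "u \<in> keys_in S \<Longrightarrow> pm_scale c u \<in> keys_in S"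
  by (auto simp: keys_in_iff)

lemma keys_in_sum: "(\<And>i. i \<in> K \<Longrightarrow> f i \<in> keys_in S) \<Longrightarrow> (\<Sum>i\<in>K. f i) \<in> keys_in S"
  for f :: "'i \<Rightarrow> 'a \<Rightarrow>\<^sub>0 'b::comm_monoid_add"
  by (auto simp: keys_in_iff lookup_sum)

lemma keys_in_subspace: "pm.subspace (keys_in S)"
  by (auto simp: pm.subspace_def keys_in_add keys_in_scale)

text \<open>Partial sums over finite sets of keys grow by one \<open>single\<close> at a time, and
  the full sum is \<open>u\<close>. The single terms carry arbitrary coefficients, so no case for
  scalar multiples arises.\<close>

lemma keys_in_induct [consumes 1, case_names zero single add]:
  fixes u :: "'a \<Rightarrow>\<^sub>0 'b::comm_monoid_add"
  assumes u: "u \<in> keys_in S" and zero: "P 0"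
    and single: "\<And>p c. p \<in> S \<Longrightarrow> P (single p c)"
    and add: "\<And>u v. u \<in> keys_in S \<Longrightarrow> v \<in> keys_in S \<Longrightarrow> P u \<Longrightarrow> P v \<Longrightarrow> P (u + v)"
  shows "P u"
proof -
  have "K \<subseteq> S \<Longrightarrow> P (\<Sum>p\<in>K. single p (lookup u p))" if "finite K" for K
    using that
    by (induction K) (auto intro!: zero add single keys_in_sum keys_in_single simp: subset_iff)
  moreover have "u = (\<Sum>p\<in>keys u. single p (lookup u p))"
    by (rule pm_expand) auto
  ultimately show ?thesis using u unfolding keys_in_def
    by (metis (no_types, lifting) finite_keys mem_Collect_eq)
qed

lemma finsum_eq_sum:
  fixes C :: "('c::ab_group_add, 'm) ring_scheme"
  assumes "abelian_monoid C" and "\<And>x y. x \<oplus>\<^bsub>C\<^esub> y = x + y" and "\<zero>\<^bsub>C\<^esub> = 0"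
    and "f \<in> K \<rightarrow> carrier C"
  shows "finsum C f K = sum f K"
proof -
  interpret abelian_monoid C by fact
  show ?thesis using assms(4)
    by (induction K rule: infinite_finite_induct) (auto simp: assms(2,3) Pi_def)
qed

text \<open>Only the vector space structure is meant; multiplication and unit stay undefined, as in
  \<open>type_space\<close>.\<close>

definition free_space :: "'a set \<Rightarrow> ('k::field, 'a \<Rightarrow>\<^sub>0 'k) module" where
  "free_space S = (type_space pm_scale)\<lparr>carrier := keys_in S\<rparr>"

lemma free_space_simps [simp]:
  "carrier (free_space S) = keys_in S" "add (free_space S) = (+)" "zero (free_space S) = 0"
  "smult (free_space S) = pm_scale"
  by (simp_all add: free_space_def type_space_def)

lemma type_space_simps [simp]:
  "carrier (type_space scale) = UNIV" "add (type_space scale) = (+)" "zero (type_space scale) = 0"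
  "smult (type_space scale) = scale"
  by (simp_all add: type_space_def)

lemma k_space_of_subspace:
  fixes C :: "('k::field, 'c::ab_group_add, 'm) module_scheme"
  assumes "vector_space scale" "module.subspace scale (carrier C)"
    and [simp]: "add C = (+)" "zero C = 0" "smult C = scale"
  shows "k_space C"
proof -
  interpret vector_space scale by fact
  have "\<exists>y\<in>carrier C. y + x = 0" if "x \<in> carrier C" for x
    using subspace_neg[OF assms(2) that] by (auto intro: bexI[of _ "-x"])
  then have "abelian_group C"
    using assms(2) by (intro abelian_groupI) (auto simp: subspace_add subspace_0 ac_simps)
  then show ?thesis
    using assms(2)
    by (auto intro!: k_space.intro k_space_axioms.intro
        simp: subspace_scale scale_left_distrib scale_right_distrib)
qed

lemma k_space_free: "k_space (free_space S)"
  by (rule k_space_of_subspace[OF pm.vector_space_axioms]) (auto simp: keys_in_subspace)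

lemma k_space_type: "vector_space scale \<Longrightarrow> k_space (type_space scale)"
  by (rule k_space_of_subspace) (auto simp: module.subspace_UNIV module_iff_vector_space)

text \<open>The common shape of \<open>tensor_lift\<close> on a representative and of
  comultiplication and counit of the group bialgebra.\<close>

definition lin_ext :: "('k::field, 'c, 'm) module_scheme \<Rightarrow> ('a \<Rightarrow> 'c) \<Rightarrow> ('a \<Rightarrow>\<^sub>0 'k) \<Rightarrow> 'c" where
  "lin_ext C h u = (\<Oplus>\<^bsub>C\<^esub>p\<in>keys u. lookup u p \<odot>\<^bsub>C\<^esub> h p)"

context k_space
begin

text \<open>Allows several arguments to be summed over one index set, the union of their
  supports.\<close>

lemma lin_ext_superset:
  assumes "finite K" "keys u \<subseteq> K" "h \<in> K \<rightarrow> carrier C"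
  shows "lin_ext C h u = (\<Oplus>p\<in>K. lookup u p \<odot> h p)"
  unfolding lin_ext_def using assms
  by (intro add.finprod_mono_neutral_cong_left) (auto simp: in_keys_iff Pi_def)

lemma lin_ext_linear:
  fixes h :: "'a \<Rightarrow> 'c"
  assumes h: "h \<in> S \<rightarrow> carrier C"
  shows "lin_ext C h \<in> k_linear (free_space S) C"
proof (rule k_linearI; unfold free_space_simps)
  fix u :: "'a \<Rightarrow>\<^sub>0 'k" assume u: "u \<in> keys_in S"
  show "lin_ext C h u \<in> carrier C"
    unfolding lin_ext_def using u h by (intro finsum_closed) (auto simp: keys_in_def)
  show "lin_ext C h (pm_scale c u) = c \<odot> lin_ext C h u" for c
    using u h keys_pm_scale[of c u]
    by (subst (1 2) lin_ext_superset[where K = "keys u"])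
      (auto simp: keys_in_def smult_finsum smult_assoc Pi_def subset_iff intro!: finsum_cong')
  fix v :: "'a \<Rightarrow>\<^sub>0 'k" assume v: "v \<in> keys_in S"
  let ?K = "keys u \<union> keys v"
  have hK: "h \<in> ?K \<rightarrow> carrier C" using u v h by (auto simp: keys_in_def)
  have "lin_ext C h (u + v) = (\<Oplus>p\<in>?K. lookup (u + v) p \<odot> h p)"
    using keys_add[of u v] hK by (intro lin_ext_superset) auto
  also have "\<dots> = (\<Oplus>p\<in>?K. lookup u p \<odot> h p \<oplus> lookup v p \<odot> h p)"
    using hK by (intro finsum_cong') (auto simp: lookup_add smult_add_left Pi_def)
  also have "\<dots> = (\<Oplus>p\<in>?K. lookup u p \<odot> h p) \<oplus> (\<Oplus>p\<in>?K. lookup v p \<odot> h p)"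
    using hK by (intro finsum_addf) auto
  also have "\<dots> = lin_ext C h u \<oplus> lin_ext C h v"
    using hK by (subst (1 2) lin_ext_superset[where K = ?K]) auto
  finally show "lin_ext C h (u + v) = lin_ext C h u \<oplus> lin_ext C h v" .
qed

lemma lin_ext_single: "h p \<in> carrier C \<Longrightarrow> lin_ext C h (single p c) = c \<odot> h p"
  by (subst lin_ext_superset[where K = "{p}"]) (auto simp: finsum_insert)

lemma lin_ext_zero [simp]: "lin_ext C h 0 = \<zero>"
  by (simp add: lin_ext_def)

lemma free_linear_unique:
  assumes "f \<in> k_linear (free_space S) C" "g \<in> k_linear (free_space S) C"
    and "\<And>p. p \<in> S \<Longrightarrow> f (single p 1) = g (single p 1)"
    and "u \<in> keys_in S"
  shows "f u = g u"
  using assms(4)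
proof (induction u rule: keys_in_induct)
  case zero
  show ?case using k_linear_zero[OF assms(1) k_space_free] k_linear_zero[OF assms(2) k_space_free]
    by (simp add: k_space_axioms)
next
  case (single p c)
  have "single p c = c \<odot>\<^bsub>free_space S\<^esub> single p 1" by simp
  then show ?case using assms(1-3) single
    by (metis free_space_simps(1) k_linear_smult keys_in_single)
next
  case (add u v)
  then show ?case
    using k_linear_add[OF assms(1), of u v] k_linear_add[OF assms(2), of u v] by simp
qed

end

text \<open>A multiplicative map on an additively closed set of exponents stays multiplicative after
  linear extension. Exponents are monomials for polynomial rings and group elements for group
  algebras. Membership of the product in \<open>keys_in S\<close> is carried along because the
  induction step applies additivity of \<open>lin_ext\<close> to sums of products.\<close>

lemma (in k_algebra) lin_ext_mult:
  fixes h :: "'b::comm_monoid_add \<Rightarrow> 'c"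
  assumes h: "h \<in> S \<rightarrow> carrier C"
    and S: "\<And>p q. p \<in> S \<Longrightarrow> q \<in> S \<Longrightarrow> p + q \<in> S"
    and hm: "\<And>p q. p \<in> S \<Longrightarrow> q \<in> S \<Longrightarrow> h (p + q) = h p \<otimes> h q"
    and u: "u \<in> keys_in S" and v: "v \<in> keys_in S"
  shows "lin_ext C h (u * v) = lin_ext C h u \<otimes> lin_ext C h v \<and> u * v \<in> keys_in S"
proof -
  note L = lin_ext_linear[OF h]
  have cl [simp]: "w \<in> keys_in S \<Longrightarrow> lin_ext C h w \<in> carrier C" for w
    using k_linear_closed[OF L] by simp
  have ad: "w \<in> keys_in S \<Longrightarrow> w' \<in> keys_in S \<Longrightarrow> lin_ext C h (w + w') = lin_ext C h w \<oplus> lin_ext C h w'"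
    for w w' using k_linear_add[OF L, of w w'] by simp
  have hc [simp]: "p \<in> S \<Longrightarrow> h p \<in> carrier C" for p using h by auto
  from u show ?thesis
  proof (induction u rule: keys_in_induct)
    case zero
    then show ?case using v by simp
  next
    case (single p c)
    from v show ?case
    proof (induction v rule: keys_in_induct)
      case zero
      then show ?case using single by (simp add: keys_in_single)
    next
      case (single q d)
      then show ?case using \<open>p \<in> S\<close>
        by (simp add: mult_single lin_ext_single keys_in_single S hm smult_mult_left smult_mult_right
            smult_assoc[symmetric] mult.commute)
    next
      case (add v v')
      then show ?case using \<open>p \<in> S\<close> by (simp add: distrib_left ad keys_in_add r_distr keys_in_single)
    qed
  next
    case (add u u')
    then show ?case using v by (simp add: distrib_right ad keys_in_add l_distr)
  qed
qed


section \<open>Tensor products\<close>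

lemma k_linear_diff:
  assumes f: "f \<in> k_linear (free_space S) C" and C: "k_space C"
    and uv: "u \<in> keys_in S" "v \<in> keys_in S"
  shows "f (u - v) = f u \<ominus>\<^bsub>C\<^esub> f v"
proof -
  interpret k_space C by fact
  have cl: "w \<in> keys_in S \<Longrightarrow> f w \<in> carrier C" for w
    using k_linear_closed[OF f] by simp
  have "f u = f (u - v) \<oplus>\<^bsub>C\<^esub> f v"
    using k_linear_add[OF f, of "u - v" v] uv by (simp add: keys_in_diff)
  then show ?thesis
    using uv by (simp add: a_minus_def a_assoc r_neg cl keys_in_diff)
qed

text \<open>The shape in which a bilinear extension sends the two additive families of relations in
  \<open>tensor_null\<close> to zero.\<close>

lemma (in k_space) add_minus_minus:
  "x \<in> carrier C \<Longrightarrow> y \<in> carrier C \<Longrightarrow> (x \<oplus> y) \<ominus> x \<ominus> y = \<zero>"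
  using r_neg[of "x \<oplus> y"] by (simp add: a_minus_def a_assoc minus_add)

lemma (in k_space) minus_eq_zero_iff:
  "x \<in> carrier C \<Longrightarrow> y \<in> carrier C \<Longrightarrow> x \<ominus> y = \<zero> \<longleftrightarrow> x = y"
  using minus_equality[of x "\<ominus> y"] by (auto simp: a_minus_def r_neg)

definition k_bilinear ::
  "('k::field, 'a, 'm) module_scheme \<Rightarrow> ('k, 'b, 'n) module_scheme \<Rightarrow> ('k, 'c, 'o) module_scheme \<Rightarrow>
   ('a \<Rightarrow> 'b \<Rightarrow> 'c) set" where
  "k_bilinear A B C =
     {\<beta>. (\<forall>b\<in>carrier B. (\<lambda>a. \<beta> a b) \<in> k_linear A C) \<and> (\<forall>a\<in>carrier A. \<beta> a \<in> k_linear B C)}"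

lemma k_bilinearI:
  assumes "\<And>b. b \<in> carrier B \<Longrightarrow> (\<lambda>a. \<beta> a b) \<in> k_linear A C"
    and "\<And>a. a \<in> carrier A \<Longrightarrow> \<beta> a \<in> k_linear B C"
  shows "\<beta> \<in> k_bilinear A B C"
  using assms by (auto simp: k_bilinear_def)

lemma k_bilinear_left: "\<beta> \<in> k_bilinear A B C \<Longrightarrow> b \<in> carrier B \<Longrightarrow> (\<lambda>a. \<beta> a b) \<in> k_linear A C"
  and k_bilinear_right: "\<beta> \<in> k_bilinear A B C \<Longrightarrow> a \<in> carrier A \<Longrightarrow> \<beta> a \<in> k_linear B C"
  and k_bilinear_closed: "\<beta> \<in> k_bilinear A B C \<Longrightarrow> a \<in> carrier A \<Longrightarrow> b \<in> carrier B \<Longrightarrow> \<beta> a b \<in> carrier C"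
  by (auto simp: k_bilinear_def k_linear_def)

section \<open>The tensor product of two vector spaces and its universal property\<close>

locale k_tensor = A: k_space A + B: k_space B
  for A :: "('k::field, 'a, 'm) module_scheme" and B :: "('k, 'b, 'n) module_scheme"
begin

abbreviation "N \<equiv> tensor_null A B"
abbreviation "F \<equiv> keys_in (carrier A \<times> carrier B) :: ('a \<times> 'b \<Rightarrow>\<^sub>0 'k) set"
abbreviation "cls \<equiv> tensor_class A B"
abbreviation "T \<equiv> tensor A B"

lemma null_minimal:
  assumes "pm.subspace X"
    and "\<And>a a' b. a \<in> carrier A \<Longrightarrow> a' \<in> carrier A \<Longrightarrow> b \<in> carrier B \<Longrightarrow>
      single (a \<oplus>\<^bsub>A\<^esub> a', b) 1 - single (a, b) 1 - single (a', b) 1 \<in> X"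
    and "\<And>a b b'. a \<in> carrier A \<Longrightarrow> b \<in> carrier B \<Longrightarrow> b' \<in> carrier B \<Longrightarrow>
      single (a, b \<oplus>\<^bsub>B\<^esub> b') 1 - single (a, b) 1 - single (a, b') 1 \<in> X"
    and "\<And>c a b. a \<in> carrier A \<Longrightarrow> b \<in> carrier B \<Longrightarrow>
      single (c \<odot>\<^bsub>A\<^esub> a, b) 1 - single (a, b) c \<in> X"
    and "\<And>c a b. a \<in> carrier A \<Longrightarrow> b \<in> carrier B \<Longrightarrow>
      single (a, c \<odot>\<^bsub>B\<^esub> b) 1 - single (a, b) c \<in> X"
  shows "N \<subseteq> X"
  unfolding tensor_null_def using assms by (intro pm.span_minimal) auto

lemma null_subspace: "pm.subspace N"
  unfolding tensor_null_def by (rule pm.subspace_span)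

lemmas null_closed = pm.subspace_0[OF null_subspace] pm.subspace_add[OF null_subspace]
  pm.subspace_diff[OF null_subspace] pm.subspace_scale[OF null_subspace]
  pm.subspace_neg[OF null_subspace]

lemma null_rels:
  "a \<in> carrier A \<Longrightarrow> a' \<in> carrier A \<Longrightarrow> b \<in> carrier B \<Longrightarrow>
    single (a \<oplus>\<^bsub>A\<^esub> a', b) 1 - single (a, b) 1 - single (a', b) 1 \<in> N"
  "a \<in> carrier A \<Longrightarrow> b \<in> carrier B \<Longrightarrow> b' \<in> carrier B \<Longrightarrow>
    single (a, b \<oplus>\<^bsub>B\<^esub> b') 1 - single (a, b) 1 - single (a, b') 1 \<in> N"
  "a \<in> carrier A \<Longrightarrow> b \<in> carrier B \<Longrightarrow>
    single (c \<odot>\<^bsub>A\<^esub> a, b) 1 - single (a, b) c \<in> N"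
  "a \<in> carrier A \<Longrightarrow> b \<in> carrier B \<Longrightarrow>
    single (a, c \<odot>\<^bsub>B\<^esub> b) 1 - single (a, b) c \<in> N"
  unfolding tensor_null_def by (rule pm.span_base, blast)+

lemma null_subset: "N \<subseteq> F"
  by (rule null_minimal[OF keys_in_subspace]) (auto intro!: keys_in_diff keys_in_single)

lemma cls_eq_iff: "cls u = cls v \<longleftrightarrow> u - v \<in> N"
proof
  assume "cls u = cls v"
  then have "u + 0 \<in> cls v" unfolding tensor_class_def using null_closed(1) by blast
  then show "u - v \<in> N" by (auto simp: tensor_class_def)
next
  assume uv: "u - v \<in> N"
  have "cls u \<subseteq> cls v" if "u - v \<in> N" for u v
  proof
    fix x assume "x \<in> cls u"
    then obtain z where "z \<in> N" "x = v + ((u - v) + z)" by (auto simp: tensor_class_def)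
    with that show "x \<in> cls v" unfolding tensor_class_def by (blast intro: null_closed)
  qed
  from this[OF uv] this[of v u] show "cls u = cls v"
    using null_closed(5)[OF uv] by simp
qed

lemma cls_self: "u \<in> cls u"
  unfolding tensor_class_def using null_closed(1) by force

lemma cls_memD: "v \<in> cls u \<Longrightarrow> cls v = cls u"
  by (subst cls_eq_iff) (auto simp: tensor_class_def)

lemma cls_mem_F: "v \<in> cls u \<Longrightarrow> u \<in> F \<Longrightarrow> v \<in> F"
  using null_subset by (auto simp: tensor_class_def intro!: keys_in_add)

lemma carrier_tensor: "carrier T = cls ` F"
  by (simp add: tensor_def keys_in_def)

lemma zero_tensor: "\<zero>\<^bsub>T\<^esub> = cls 0"
  by (simp add: tensor_def tensor_class_def)

text \<open>\<open>tensor\<close> defines the sum of two cosets as a union over all pairs of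
  representatives. Every member of that union is the same coset, so the union collapses. Scalar
  multiples and products are handled in the same way.\<close>

lemma cls_add: "cls u \<oplus>\<^bsub>T\<^esub> cls v = cls (u + v)"
proof -
  have "cls (u' + v') = cls (u + v)" if "u' \<in> cls u" "v' \<in> cls v" for u' v'
  proof -
    have "u' - u \<in> N" "v' - v \<in> N" using that by (simp_all add: cls_memD flip: cls_eq_iff)
    then have "(u' - u) + (v' - v) \<in> N" by (rule null_closed)
    then show ?thesis by (simp add: cls_eq_iff algebra_simps)
  qed
  then have "(\<Union>u'\<in>cls u. \<Union>v'\<in>cls v. cls (u' + v')) = cls (u + v)"
    using cls_self by blast
  then show ?thesis by (simp add: tensor_def)
qed

lemma cls_smult: "c \<odot>\<^bsub>T\<^esub> cls u = cls (pm_scale c u)"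
proof -
  have "cls (pm_scale c u') = cls (pm_scale c u)" if "u' \<in> cls u" for u'
  proof -
    have "u' - u \<in> N" using that by (simp add: cls_memD flip: cls_eq_iff)
    then have "pm_scale c (u' - u) \<in> N" by (rule null_closed)
    then show ?thesis by (simp add: cls_eq_iff pm.scale_right_diff_distrib)
  qed
  then have "(\<Union>u'\<in>cls u. cls (pm_scale c u')) = cls (pm_scale c u)"
    using cls_self by blast
  then show ?thesis by (simp add: tensor_def)
qed

lemma k_space_tensor: "k_space T"
proof (intro k_space.intro k_space_axioms.intro abelian_groupI)
  show "\<exists>y\<in>carrier T. y \<oplus>\<^bsub>T\<^esub> x = \<zero>\<^bsub>T\<^esub>" if x: "x \<in> carrier T" for x
  proof -
    obtain u where "u \<in> F" "x = cls u" using x by (auto simp: carrier_tensor)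
    then show ?thesis using keys_in_diff[of 0 _ u]
      by (intro bexI[of _ "cls (- u)"]) (auto simp: cls_add zero_tensor carrier_tensor)
  qed
qed (auto simp: carrier_tensor cls_add cls_smult zero_tensor keys_in_add keys_in_scale
    algebra_simps pm.scale_right_distrib pm.scale_left_distrib)

sublocale T: k_space "tensor A B"
  by (rule k_space_tensor)

lemma cls_linear: "cls \<in> k_linear (free_space (carrier A \<times> carrier B)) T"
  by (rule k_linearI) (auto simp: carrier_tensor cls_add cls_smult)

lemma cls_closed: "u \<in> F \<Longrightarrow> cls u \<in> carrier T"
  by (auto simp: carrier_tensor)

lemma cls_sum:
  assumes "\<And>i. i \<in> K \<Longrightarrow> f i \<in> F"
  shows "cls (\<Sum>i\<in>K. f i) = (\<Oplus>\<^bsub>T\<^esub>i\<in>K. cls (f i))"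
proof -
  interpret FS: k_space "free_space (carrier A \<times> carrier B) :: ('k, 'a \<times> 'b \<Rightarrow>\<^sub>0 'k) module"
    by (rule k_space_free)
  have "finsum (free_space (carrier A \<times> carrier B)) f K = sum f K"
    using assms by (intro finsum_eq_sum) (auto intro: FS.abelian_monoid_axioms)
  then show ?thesis
    using k_linear_finsum[OF cls_linear k_space_free k_space_tensor, of f K] assms by auto
qed

lemma elt_closed: "a \<in> carrier A \<Longrightarrow> b \<in> carrier B \<Longrightarrow> tensor_elt A B a b \<in> carrier T"
  by (simp add: tensor_elt_def cls_closed keys_in_single)

lemma elt_bilinear: "tensor_elt A B \<in> k_bilinear A B T"
proof (intro k_bilinearI k_linearI)
  fix a a' b c assume a: "a \<in> carrier A" "a' \<in> carrier A" and b: "b \<in> carrier B"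
  show "tensor_elt A B (a \<oplus>\<^bsub>A\<^esub> a') b = tensor_elt A B a b \<oplus>\<^bsub>T\<^esub> tensor_elt A B a' b"
    using null_rels(1)[OF a b]
    by (simp add: tensor_elt_def cls_add cls_eq_iff diff_diff_eq)
  show "tensor_elt A B (c \<odot>\<^bsub>A\<^esub> a) b = c \<odot>\<^bsub>T\<^esub> tensor_elt A B a b"
    using null_rels(3)[OF a(1) b] by (simp add: tensor_elt_def cls_smult cls_eq_iff)
next
  fix a b b' c assume a: "a \<in> carrier A" and b: "b \<in> carrier B" "b' \<in> carrier B"
  show "tensor_elt A B a (b \<oplus>\<^bsub>B\<^esub> b') = tensor_elt A B a b \<oplus>\<^bsub>T\<^esub> tensor_elt A B a b'"
    using null_rels(2)[OF a b]
    by (simp add: tensor_elt_def cls_add cls_eq_iff diff_diff_eq)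
  show "tensor_elt A B a (c \<odot>\<^bsub>B\<^esub> b) = c \<odot>\<^bsub>T\<^esub> tensor_elt A B a b"
    using null_rels(4)[OF a b(1)] by (simp add: tensor_elt_def cls_smult cls_eq_iff)
qed (auto intro: elt_closed)

text \<open>\<open>tensor_lift\<close> evaluates a representative chosen by \<open>SOME\<close>. The
  bilinear extension vanishes on the four families of relations, hence on all of \<open>N\<close>,
  so every representative gives the same value.\<close>

lemma tensor_lift_cls:
  assumes C: "k_space C" and \<beta>: "\<beta> \<in> k_bilinear A B C" and u: "u \<in> F"
  shows "tensor_lift C \<beta> (cls u) = lin_ext C (\<lambda>p. \<beta> (fst p) (snd p)) u"
proof -
  interpret C: k_space C by fact
  let ?L = "lin_ext C (\<lambda>p. \<beta> (fst p) (snd p))"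
  have L: "?L \<in> k_linear (free_space (carrier A \<times> carrier B)) C"
    using k_bilinear_closed[OF \<beta>] by (intro C.lin_ext_linear) auto
  have Lc: "v \<in> F \<Longrightarrow> ?L v \<in> carrier C" for v
    using k_linear_closed[OF L] by simp
  have Ld: "v \<in> F \<Longrightarrow> w \<in> F \<Longrightarrow> ?L (v - w) = ?L v \<ominus>\<^bsub>C\<^esub> ?L w" for v w
    using k_linear_diff[OF L C] by simp
  have Ls: "a \<in> carrier A \<Longrightarrow> b \<in> carrier B \<Longrightarrow>
      ?L (single (a, b) c) = c \<odot>\<^bsub>C\<^esub> \<beta> a b" for a b c
    by (simp add: C.lin_ext_single k_bilinear_closed[OF \<beta>])
  note \<beta>c = k_bilinear_closed[OF \<beta>]
  have "N \<subseteq> {v \<in> F. ?L v = \<zero>\<^bsub>C\<^esub>}"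
  proof (rule null_minimal)
    show "pm.subspace {v \<in> F. ?L v = \<zero>\<^bsub>C\<^esub>}"
      using k_linear_add[OF L, simplified] k_linear_smult[OF L, simplified]
      by (simp add: pm.subspace_def keys_in_add keys_in_scale)
  next
    fix a a' b assume "a \<in> carrier A" "a' \<in> carrier A" "b \<in> carrier B"
    then show "single (a \<oplus>\<^bsub>A\<^esub> a', b) 1 - single (a, b) 1 -
        single (a', b) 1 \<in> {v \<in> F. ?L v = \<zero>\<^bsub>C\<^esub>}"
      using k_linear_add[OF k_bilinear_left[OF \<beta>], of b a a']
      by (simp add: keys_in_diff keys_in_single Ld Ls \<beta>c C.add_minus_minus)
  next
    fix a b b' assume "a \<in> carrier A" "b \<in> carrier B" "b' \<in> carrier B"
    then show "single (a, b \<oplus>\<^bsub>B\<^esub> b') 1 - single (a, b) 1 -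
        single (a, b') 1 \<in> {v \<in> F. ?L v = \<zero>\<^bsub>C\<^esub>}"
      using k_linear_add[OF k_bilinear_right[OF \<beta>], of a b b']
      by (simp add: keys_in_diff keys_in_single Ld Ls \<beta>c C.add_minus_minus)
  next
    fix c a b assume ab: "a \<in> carrier A" "b \<in> carrier B"
    show "single (c \<odot>\<^bsub>A\<^esub> a, b) 1 - single (a, b) c \<in> {v \<in> F. ?L v = \<zero>\<^bsub>C\<^esub>}"
      using ab k_linear_smult[OF k_bilinear_left[OF \<beta>], of b a c]
      by (simp add: keys_in_diff keys_in_single Ld Ls \<beta>c C.minus_eq_zero_iff)
    show "single (a, c \<odot>\<^bsub>B\<^esub> b) 1 - single (a, b) c \<in> {v \<in> F. ?L v = \<zero>\<^bsub>C\<^esub>}"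
      using ab k_linear_smult[OF k_bilinear_right[OF \<beta>], of a b c]
      by (simp add: keys_in_diff keys_in_single Ld Ls \<beta>c C.minus_eq_zero_iff)
  qed
  moreover define u' where "u' = (SOME u'. u' \<in> cls u)"
  have u': "u' \<in> cls u" unfolding u'_def by (rule someI[of _ u]) (rule cls_self)
  then have "cls u' = cls u" by (rule cls_memD)
  then have "u' - u \<in> N" by (simp only: cls_eq_iff)
  ultimately have "?L (u' - u) = \<zero>\<^bsub>C\<^esub>" by blast
  moreover have u'F: "u' \<in> F" using u' u cls_mem_F by blast
  ultimately have "?L u' = ?L u"
    using u by (simp add: Ld Lc C.minus_eq_zero_iff)
  then show ?thesis by (simp add: tensor_lift_def u'_def[symmetric] lin_ext_def)
qed

lemma tensor_lift_linear:
  assumes C: "k_space C" and \<beta>: "\<beta> \<in> k_bilinear A B C"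
  shows "tensor_lift C \<beta> \<in> k_linear T C"
proof -
  interpret C: k_space C by fact
  have L: "lin_ext C (\<lambda>p. \<beta> (fst p) (snd p)) \<in> k_linear (free_space (carrier A \<times> carrier B)) C"
    using k_bilinear_closed[OF \<beta>] by (intro C.lin_ext_linear) auto
  have *: "\<exists>u. u \<in> F \<and> X = cls u" if "X \<in> carrier T" for X
    using that by (auto simp: carrier_tensor)
  show ?thesis
  proof (rule k_linearI)
    fix X c assume "X \<in> carrier T"
    then obtain u where u: "u \<in> F" "X = cls u" using * by blast
    show "tensor_lift C \<beta> X \<in> carrier C" using u k_linear_closed[OF L, of u]
      by (simp add: tensor_lift_cls[OF C \<beta>])
    show "tensor_lift C \<beta> (c \<odot>\<^bsub>T\<^esub> X) = c \<odot>\<^bsub>C\<^esub> tensor_lift C \<beta> X"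
      using u k_linear_smult[OF L, of u c]
      by (simp add: tensor_lift_cls[OF C \<beta>] cls_smult keys_in_scale)
    fix Y assume "Y \<in> carrier T"
    then obtain v where v: "v \<in> F" "Y = cls v" using * by blast
    show "tensor_lift C \<beta> (X \<oplus>\<^bsub>T\<^esub> Y) = tensor_lift C \<beta> X \<oplus>\<^bsub>C\<^esub> tensor_lift C \<beta> Y"
      using u v k_linear_add[OF L, of u v]
      by (simp add: tensor_lift_cls[OF C \<beta>] cls_add keys_in_add)
  qed
qed

lemma tensor_lift_elt:
  assumes C: "k_space C" and \<beta>: "\<beta> \<in> k_bilinear A B C" and ab: "a \<in> carrier A" "b \<in> carrier B"
  shows "tensor_lift C \<beta> (tensor_elt A B a b) = \<beta> a b"
proof -
  interpret C: k_space C by fact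
  have "tensor_lift C \<beta> (tensor_elt A B a b) =
      lin_ext C (\<lambda>p. \<beta> (fst p) (snd p)) (single (a, b) 1)"
    unfolding tensor_elt_def
    apply (rule tensor_lift_cls[OF C \<beta>])
    apply (rule keys_in_single)
    using ab by blast
  also have "\<dots> = 1 \<odot>\<^bsub>C\<^esub> \<beta> a b"
    using k_bilinear_closed[OF \<beta> ab] by (subst C.lin_ext_single) auto
  also have "\<dots> = \<beta> a b" using k_bilinear_closed[OF \<beta> ab] by (rule C.smult_1)
  finally show ?thesis .
qed

text \<open>A scalar is absorbed by the left factor, c (a \<otimes> b) = (c a) \<otimes> b, and zero
  is 0 \<otimes> 0, so finite sums of elementary tensors already exhaust the tensor product.\<close>

lemma tensor_induct [consumes 1, case_names elt add]:
  assumes X: "X \<in> carrier T"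
    and elt: "\<And>a b. a \<in> carrier A \<Longrightarrow> b \<in> carrier B \<Longrightarrow> P (tensor_elt A B a b)"
    and add: "\<And>X Y. X \<in> carrier T \<Longrightarrow> Y \<in> carrier T \<Longrightarrow> P X \<Longrightarrow> P Y \<Longrightarrow> P (X \<oplus>\<^bsub>T\<^esub> Y)"
  shows "P X"
proof -
  obtain u where u: "u \<in> F" and "X = cls u" using X by (auto simp: carrier_tensor)
  moreover from u have "P (cls u)"
  proof (induction u rule: keys_in_induct)
    case zero
    have "tensor_elt A B \<zero>\<^bsub>A\<^esub> \<zero>\<^bsub>B\<^esub> = cls 0"
      using k_linear_zero[OF k_bilinear_left[OF elt_bilinear] A.k_space_axioms k_space_tensor,
        of "\<zero>\<^bsub>B\<^esub>"] zero_tensor by simp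
    then show ?case using elt[of "\<zero>\<^bsub>A\<^esub>" "\<zero>\<^bsub>B\<^esub>"] by simp
  next
    case (single p c)
    obtain a b where [simp]: "p = (a, b)" by (cases p)
    have "tensor_elt A B (c \<odot>\<^bsub>A\<^esub> a) b = cls (single p c)"
      using single k_linear_smult[OF k_bilinear_left[OF elt_bilinear], of b a c]
      by (simp add: tensor_elt_def cls_smult)
    then show ?case using single elt[of "c \<odot>\<^bsub>A\<^esub> a" b] by simp
  next
    case (add u v)
    then show ?case using assms(3)[of "cls u" "cls v"] by (simp add: cls_add cls_closed)
  qed
  ultimately show ?thesis by simp
qed

lemma tensor_linear_unique:
  assumes "f \<in> k_linear T C" "g \<in> k_linear T C"
    and "\<And>a b. a \<in> carrier A \<Longrightarrow> b \<in> carrier B \<Longrightarrow> f (tensor_elt A B a b) = g (tensor_elt A B a b)"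
    and "X \<in> carrier T"
  shows "f X = g X"
  using assms(4)
proof (induction X rule: tensor_induct)
  case (elt a b)
  then show ?case by (rule assms(3))
next
  case (add X Y)
  then show ?case using k_linear_add[OF assms(1)] k_linear_add[OF assms(2)] by simp
qed

end

lemma tensor_map_bilinear:
  assumes "f \<in> k_linear A C" "g \<in> k_linear B D" "k_space A" "k_space B" "k_space C" "k_space D"
  shows "(\<lambda>a b. tensor_elt C D (f a) (g b)) \<in> k_bilinear A B (tensor C D)"
proof -
  interpret CD: k_tensor C D using assms by (simp add: k_tensor_def)
  show ?thesis
    using k_linear_compose[OF assms(1) k_bilinear_left[OF CD.elt_bilinear]]
      k_linear_compose[OF assms(2) k_bilinear_right[OF CD.elt_bilinear]]
      k_linear_closed[OF assms(1)] k_linear_closed[OF assms(2)]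
    by (intro k_bilinearI) auto
qed

lemma tensor_map_linear:
  assumes "f \<in> k_linear A C" "g \<in> k_linear B D" "k_space A" "k_space B" "k_space C" "k_space D"
  shows "tensor_map C D f g \<in> k_linear (tensor A B) (tensor C D)"
    and "a \<in> carrier A \<Longrightarrow> b \<in> carrier B \<Longrightarrow>
      tensor_map C D f g (tensor_elt A B a b) = tensor_elt C D (f a) (g b)"
proof -
  interpret CD: k_tensor C D using assms by (simp add: k_tensor_def)
  interpret AB: k_tensor A B using assms by (simp add: k_tensor_def)
  show "tensor_map C D f g \<in> k_linear (tensor A B) (tensor C D)"
    unfolding tensor_map_def
    by (intro AB.tensor_lift_linear tensor_map_bilinear assms CD.k_space_tensor)
  show "a \<in> carrier A \<Longrightarrow> b \<in> carrier B \<Longrightarrow>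
      tensor_map C D f g (tensor_elt A B a b) = tensor_elt C D (f a) (g b)"
    unfolding tensor_map_def
    by (intro AB.tensor_lift_elt tensor_map_bilinear assms CD.k_space_tensor)
qed


section \<open>The algebra structure on a tensor product of commutative algebras\<close>

locale k_tensor_alg = A: k_algebra A + B: k_algebra B
  for A :: "('k::field, 'a, 'm) module_scheme" and B :: "('k, 'b, 'n) module_scheme"
begin

sublocale k_tensor A B ..

abbreviation "fm \<equiv> free_tensor_mult A B"

lemma fm_superset:
  assumes "finite K" "keys u \<subseteq> K" "finite L" "keys v \<subseteq> L"
  shows "fm u v = (\<Sum>p\<in>K. \<Sum>q\<in>L. single (fst p \<otimes>\<^bsub>A\<^esub> fst q, snd p \<otimes>\<^bsub>B\<^esub> snd q)
    (lookup u p * lookup v q))"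
proof -
  have "(\<Sum>q\<in>keys v. single (fst p \<otimes>\<^bsub>A\<^esub> fst q, snd p \<otimes>\<^bsub>B\<^esub> snd q)
      (lookup u p * lookup v q)) =
    (\<Sum>q\<in>L. single (fst p \<otimes>\<^bsub>A\<^esub> fst q, snd p \<otimes>\<^bsub>B\<^esub> snd q)
      (lookup u p * lookup v q))" for p
    using assms by (intro sum.mono_neutral_left) (auto simp: in_keys_iff)
  then show ?thesis unfolding free_tensor_mult_def
    using assms by (simp, intro sum.mono_neutral_left) (auto simp: in_keys_iff)
qed

lemma fm_add_left: "fm (u + u') v = fm u v + fm u' v"
proof -
  let ?K = "keys u \<union> keys u'" and ?L = "keys v"
  have "keys (u + u') \<subseteq> ?K" by (rule keys_add)
  then show ?thesis
    by (subst (1 2 3) fm_superset[where K = ?K and L = ?L])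
      (auto simp: lookup_add distrib_right single_add sum.distrib)
qed

lemma fm_add_right: "fm u (v + v') = fm u v + fm u v'"
proof -
  let ?K = "keys v \<union> keys v'" and ?L = "keys u"
  have "keys (v + v') \<subseteq> ?K" by (rule keys_add)
  then show ?thesis
    by (subst (1 2 3) fm_superset[where K = ?L and L = ?K])
      (auto simp: lookup_add distrib_left single_add sum.distrib)
qed

lemma fm_zero [simp]: "fm 0 v = 0" "fm u 0 = 0"
  by (simp_all add: free_tensor_mult_def)

lemma fm_diff_left: "fm (u - u') v = fm u v - fm u' v"
  using fm_add_left[of "u - u'" u' v] by simp

lemma fm_single: "fm (single p c) (single q d) =
    single (fst p \<otimes>\<^bsub>A\<^esub> fst q, snd p \<otimes>\<^bsub>B\<^esub> snd q) (c * d)"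
  by (subst fm_superset[where K = "{p}" and L = "{q}"]) auto

lemma fm_scale_left: "fm (pm_scale c u) v = pm_scale c (fm u v)"
  using keys_pm_scale[of c u]
  by (subst (1 2) fm_superset[where K = "keys u" and L = "keys v"])
    (auto simp: pm.scale_sum_right mult.assoc)

lemma fm_sum_left: "fm (\<Sum>i\<in>K. f i) v = (\<Sum>i\<in>K. fm (f i) v)"
  by (induction K rule: infinite_finite_induct) (auto simp: fm_add_left)

lemma fm_sum_right: "fm u (\<Sum>i\<in>K. f i) = (\<Sum>i\<in>K. fm u (f i))"
  by (induction K rule: infinite_finite_induct) (auto simp: fm_add_right)

lemma fm_closed: "u \<in> F \<Longrightarrow> v \<in> F \<Longrightarrow> fm u v \<in> F"
  unfolding free_tensor_mult_def
  by (intro keys_in_sum keys_in_single) (fastforce simp: keys_in_def)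

lemma fm_comm: "u \<in> F \<Longrightarrow> v \<in> F \<Longrightarrow> fm u v = fm v u"
proof (induction u rule: keys_in_induct)
  case (single p c)
  from single(2,1) show ?case
    by (induction v rule: keys_in_induct)
      (auto simp: fm_single fm_add_left fm_add_right A.m_comm B.m_comm mult.commute)
qed (auto simp: fm_add_left fm_add_right)

lemma fm_assoc: "u \<in> F \<Longrightarrow> v \<in> F \<Longrightarrow> w \<in> F \<Longrightarrow> fm (fm u v) w = fm u (fm v w)"
proof (induction u rule: keys_in_induct)
  case (single p c)
  from single(2,1,3) show ?case
  proof (induction v rule: keys_in_induct)
    case (single q d)
    from single(3,1,2) show ?case
      by (induction w rule: keys_in_induct)
        (auto simp: fm_single fm_add_left fm_add_right A.m_assoc B.m_assoc mult.assoc)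
  qed (auto simp: fm_add_left fm_add_right)
qed (auto simp: fm_add_left fm_add_right)

lemma fm_one: "u \<in> F \<Longrightarrow> fm (single (\<one>\<^bsub>A\<^esub>, \<one>\<^bsub>B\<^esub>) 1) u = u"
  by (induction u rule: keys_in_induct) (auto simp: fm_single fm_add_right)

text \<open>\<open>N\<close> behaves as an ideal: a bilinearity relation multiplied by
  \<open>single (a', b') d\<close> is d times the relation of the same kind between products, and
  general \<open>v\<close> are sums of such terms. The other side follows from
  commutativity.\<close>

lemma fm_null:
  assumes "u \<in> N" "v \<in> F"
  shows "fm u v \<in> N"
proof -
  have "N \<subseteq> {u. fm u v \<in> N}" using assms(2)
  proof (induction v rule: keys_in_induct)
    case zero
    then show ?case using null_closed by simp
  next
    case (single q d)
    obtain a' b' where q: "q = (a', b')" by (cases q)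
    then have ab': "a' \<in> carrier A" "b' \<in> carrier B" using single by auto
    have sc: "single p d = pm_scale d (single p 1)"
      "single p (c * d) = pm_scale d (single p c)" for p :: "'a \<times> 'b" and c
      by (simp_all add: mult.commute)
    show ?case
    proof (rule null_minimal, unfold mem_Collect_eq q)
      show "pm.subspace {u. fm u (single (a', b') d) \<in> N}"
        by (auto simp: pm.subspace_def null_closed fm_add_left fm_scale_left)
    next
      fix a a2 b assume "a \<in> carrier A" "a2 \<in> carrier A" "b \<in> carrier B"
      then show "fm (single (a \<oplus>\<^bsub>A\<^esub> a2, b) 1 - single (a, b) 1 -
          single (a2, b) 1) (single (a', b') d) \<in> N"
        using null_closed(4)[OF null_rels(1)[of "a \<otimes>\<^bsub>A\<^esub> a'" "a2 \<otimes>\<^bsub>A\<^esub> a'" "b \<otimes>\<^bsub>B\<^esub> b'"], of d] ab'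
        by (simp add: fm_diff_left fm_single A.l_distr pm.scale_right_diff_distrib)
    next
      fix a b b2 assume "a \<in> carrier A" "b \<in> carrier B" "b2 \<in> carrier B"
      then show "fm (single (a, b \<oplus>\<^bsub>B\<^esub> b2) 1 - single (a, b) 1 -
          single (a, b2) 1) (single (a', b') d) \<in> N"
        using null_closed(4)[OF null_rels(2)[of "a \<otimes>\<^bsub>A\<^esub> a'" "b \<otimes>\<^bsub>B\<^esub> b'" "b2 \<otimes>\<^bsub>B\<^esub> b'"], of d] ab'
        by (simp add: fm_diff_left fm_single B.l_distr pm.scale_right_diff_distrib)
    next
      fix c a b assume "a \<in> carrier A" "b \<in> carrier B"
      then show "fm (single (c \<odot>\<^bsub>A\<^esub> a, b) 1 - single (a, b) c)
          (single (a', b') d) \<in> N"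
        "fm (single (a, c \<odot>\<^bsub>B\<^esub> b) 1 - single (a, b) c)
          (single (a', b') d) \<in> N"
        using null_closed(4)[OF null_rels(3)[of "a \<otimes>\<^bsub>A\<^esub> a'" "b \<otimes>\<^bsub>B\<^esub> b'" c], of d]
          null_closed(4)[OF null_rels(4)[of "a \<otimes>\<^bsub>A\<^esub> a'" "b \<otimes>\<^bsub>B\<^esub> b'" c], of d] ab'
        by (simp_all add: fm_diff_left fm_single A.smult_mult_left B.smult_mult_left
            pm.scale_right_diff_distrib mult.commute)
    qed
  next
    case (add v v')
    then show ?case by (auto simp: fm_add_right null_closed subset_iff)
  qed
  then show ?thesis using assms(1) by blast
qed

lemma cls_mult:
  assumes u: "u \<in> F" and v: "v \<in> F"
  shows "cls u \<otimes>\<^bsub>T\<^esub> cls v = cls (fm u v)"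
proof -
  have "cls (fm u' v') = cls (fm u v)" if u': "u' \<in> cls u" and v': "v' \<in> cls v" for u' v'
  proof -
    have F: "u' \<in> F" "v' \<in> F" using cls_mem_F u' v' u v by blast+
    have "u' - u \<in> N" "v' - v \<in> N" using cls_memD[OF u'] cls_memD[OF v'] by (simp_all only: cls_eq_iff)
    \<comment> \<open>u' v' - u v is split as (u' - u) v' + (v' - v) u. The factors of the second
      summand are swapped so that the element of \<open>N\<close> stands on the left in both, as
      \<open>fm_null\<close> demands.\<close>
    then have "fm (u' - u) v' + fm (v' - v) u \<in> N" using F u by (intro null_closed(2) fm_null)
    also have "fm (u' - u) v' + fm (v' - v) u = fm u' v' - fm u v"
      using F u v by (simp add: fm_diff_left fm_comm[of u])
    finally show ?thesis by (simp add: cls_eq_iff)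
  qed
  then have "(\<Union>u'\<in>cls u. \<Union>v'\<in>cls v. cls (fm u' v')) = cls (fm u v)"
    using cls_self by blast
  then show ?thesis by (simp add: tensor_def)
qed

lemma one_tensor: "\<one>\<^bsub>T\<^esub> = tensor_elt A B \<one>\<^bsub>A\<^esub> \<one>\<^bsub>B\<^esub>"
  by (simp add: tensor_def)

lemma elt_mult:
  "a \<in> carrier A \<Longrightarrow> b \<in> carrier B \<Longrightarrow> a' \<in> carrier A \<Longrightarrow> b' \<in> carrier B \<Longrightarrow>
    tensor_elt A B a b \<otimes>\<^bsub>T\<^esub> tensor_elt A B a' b' = tensor_elt A B (a \<otimes>\<^bsub>A\<^esub> a') (b \<otimes>\<^bsub>B\<^esub> b')"
  by (simp add: tensor_elt_def cls_mult keys_in_single fm_single)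

lemma k_algebra_tensor: "k_algebra T"
proof (intro k_algebra.intro cringI comm_monoidI k_algebra_axioms.intro)
  have 1: "single (\<one>\<^bsub>A\<^esub>, \<one>\<^bsub>B\<^esub>) 1 \<in> F" by (simp add: keys_in_single)
  then show "\<one>\<^bsub>T\<^esub> \<in> carrier T" by (simp add: one_tensor tensor_elt_def cls_closed)
  have ex: "\<exists>u. u \<in> F \<and> x = cls u" if "x \<in> carrier T" for x
    using that by (auto simp: carrier_tensor)
  show "abelian_group T" by (rule T.abelian_group_axioms)
  show "k_space T" by (rule k_space_tensor)
  fix x y c assume "x \<in> carrier T" "y \<in> carrier T"
  then obtain u v where uv: "u \<in> F" "v \<in> F" and xy: "x = cls u" "y = cls v" using ex by blast
  show "\<one>\<^bsub>T\<^esub> \<otimes>\<^bsub>T\<^esub> x = x"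
    using uv xy 1 by (simp add: one_tensor tensor_elt_def cls_mult fm_one)
  show "x \<otimes>\<^bsub>T\<^esub> y \<in> carrier T" using uv xy by (simp add: cls_mult fm_closed cls_closed)
  show "x \<otimes>\<^bsub>T\<^esub> y = y \<otimes>\<^bsub>T\<^esub> x" using uv xy fm_comm[of u v] by (simp add: cls_mult)
  show "c \<odot>\<^bsub>T\<^esub> x \<otimes>\<^bsub>T\<^esub> y = c \<odot>\<^bsub>T\<^esub> (x \<otimes>\<^bsub>T\<^esub> y)"
    using uv xy by (simp add: cls_mult cls_smult fm_scale_left keys_in_scale)
  fix z assume "z \<in> carrier T"
  then obtain w where w: "w \<in> F" "z = cls w" using ex by blast
  show "x \<otimes>\<^bsub>T\<^esub> y \<otimes>\<^bsub>T\<^esub> z = x \<otimes>\<^bsub>T\<^esub> (y \<otimes>\<^bsub>T\<^esub> z)"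
    using uv xy w by (simp add: cls_mult fm_closed fm_assoc)
  show "(x \<oplus>\<^bsub>T\<^esub> y) \<otimes>\<^bsub>T\<^esub> z = x \<otimes>\<^bsub>T\<^esub> z \<oplus>\<^bsub>T\<^esub> y \<otimes>\<^bsub>T\<^esub> z"
    using uv xy w by (simp add: cls_mult cls_add fm_closed fm_add_left keys_in_add)
qed

lemma mult_bilinear:
  assumes f: "f \<in> k_linear A C" and g: "g \<in> k_linear B C" and C: "k_algebra C"
  shows "(\<lambda>a b. f a \<otimes>\<^bsub>C\<^esub> g b) \<in> k_bilinear A B C"
proof -
  interpret C: k_algebra C by fact
  show ?thesis
    by (intro k_bilinearI k_linearI)
      (simp_all add: k_linear_closed[OF f] k_linear_closed[OF g] k_linear_add[OF f]
        k_linear_add[OF g] k_linear_smult[OF f] k_linear_smult[OF g] C.l_distr C.r_distr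
        C.smult_mult_left C.smult_mult_right)
qed

text \<open>Both sides of multiplicativity are additive in each argument, so two nested inductions
  reduce it to elementary tensors.\<close>

lemma tensor_alg_homI:
  assumes C: "k_algebra C" and L: "L \<in> k_linear T C"
    and one: "L (tensor_elt A B \<one>\<^bsub>A\<^esub> \<one>\<^bsub>B\<^esub>) = \<one>\<^bsub>C\<^esub>"
    and mult: "\<And>a b a' b'. a \<in> carrier A \<Longrightarrow> b \<in> carrier B \<Longrightarrow> a' \<in> carrier A \<Longrightarrow> b' \<in> carrier B \<Longrightarrow>
      L (tensor_elt A B (a \<otimes>\<^bsub>A\<^esub> a') (b \<otimes>\<^bsub>B\<^esub> b')) =
        L (tensor_elt A B a b) \<otimes>\<^bsub>C\<^esub> L (tensor_elt A B a' b')"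
  shows "restrict L (carrier T) \<in> alg_hom T C"
proof -
  interpret C: k_algebra C by fact
  interpret T: k_algebra T by (rule k_algebra_tensor)
  note Lc = k_linear_closed[OF L]
  have "L (X \<otimes>\<^bsub>T\<^esub> Y) = L X \<otimes>\<^bsub>C\<^esub> L Y" if "X \<in> carrier T" "Y \<in> carrier T" for X Y
    using that
  proof (induction X rule: tensor_induct)
    case (elt a b)
    note ab = elt(1,2)
    from elt(3) show ?case
    proof (induction Y rule: tensor_induct)
      case (elt a' b')
      then show ?case using ab by (simp add: elt_mult mult)
    next
      case (add X Y)
      then show ?case using ab elt_closed[OF ab]
        by (simp add: T.r_distr k_linear_add[OF L] Lc C.r_distr)
    qed
  next
    case (add X X')
    then show ?case
      by (simp add: T.l_distr k_linear_add[OF L] Lc C.l_distr)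
  qed
  then show ?thesis
    using one by (intro alg_hom_restrictI[OF T.k_space_axioms L]) (simp_all add: one_tensor elt_closed)
qed

text \<open>Commutativity of \<open>C\<close> is what reorders f(a) f(a') g(b) g(b') into a product
  of the two values f(a) g(b) and f(a') g(b').\<close>

lemma tensor_lift_alg_hom:
  assumes f: "f \<in> alg_hom A C" and g: "g \<in> alg_hom B C" and C: "k_algebra C"
  shows "restrict (tensor_lift C (\<lambda>a b. f a \<otimes>\<^bsub>C\<^esub> g b)) (carrier T) \<in> alg_hom T C"
proof -
  interpret C: k_algebra C by fact
  note fl = alg_hom_linear[OF f] and gl = alg_hom_linear[OF g]
  note bl = mult_bilinear[OF fl gl C]
  show ?thesis
    by (rule tensor_alg_homI[OF C tensor_lift_linear[OF C.k_space_axioms bl]])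
      (simp_all add: tensor_lift_elt[OF C.k_space_axioms bl] k_linear_closed[OF fl]
        k_linear_closed[OF gl] alg_hom_mult[OF f] alg_hom_mult[OF g] alg_hom_one[OF f]
        alg_hom_one[OF g] C.m_ac)
qed

end

lemma tensor_map_alg_hom:
  assumes f: "f \<in> alg_hom A C" and g: "g \<in> alg_hom B D"
    and alg: "k_algebra A" "k_algebra B" "k_algebra C" "k_algebra D"
  shows "restrict (tensor_map C D f g) (carrier (tensor A B)) \<in> alg_hom (tensor A B) (tensor C D)"
proof -
  interpret AB: k_tensor_alg A B using alg by (simp add: k_tensor_alg_def)
  interpret CD: k_tensor_alg C D using alg by (simp add: k_tensor_alg_def)
  note fl = alg_hom_linear[OF f] and gl = alg_hom_linear[OF g]
  have sp: "k_space A" "k_space B" "k_space C" "k_space D" using alg by (simp_all add: k_algebra_def)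
  show ?thesis
    by (rule AB.tensor_alg_homI[OF CD.k_algebra_tensor tensor_map_linear(1)[OF fl gl sp]])
      (simp_all add: CD.one_tensor CD.elt_mult tensor_map_linear(2)[OF fl gl sp] k_linear_closed[OF fl]
        k_linear_closed[OF gl] alg_hom_mult[OF f] alg_hom_mult[OF g] alg_hom_one[OF f] alg_hom_one[OF g])
qed


section \<open>Polynomials and the universal algebra\<close>

text \<open>Keeps index intervals in the form \<open>{1..n}\<close> under simplification.\<close>

declare One_nat_def [simp del]

text \<open>One source for the ground field, the group algebra and the polynomial algebra, whose
  operations are those of a ring type.\<close>

lemma k_algebra_of_subring:
  fixes C :: "('k::field, 'c::comm_ring_1, 'm) module_scheme"
  assumes vs: "vector_space scale" "module.subspace scale (carrier C)"
    and [simp]: "add C = (+)" "zero C = 0" "smult C = scale" "mult C = (*)" "one C = 1"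
    and one: "1 \<in> carrier C"
    and mult: "\<And>x y. x \<in> carrier C \<Longrightarrow> y \<in> carrier C \<Longrightarrow> x * y \<in> carrier C"
    and scale: "\<And>c x y. scale c x * y = scale c (x * y)"
  shows "k_algebra C"
proof -
  interpret k_space C by (rule k_space_of_subspace[OF vs]) auto
  show ?thesis
    by (intro k_algebra.intro cringI comm_monoidI k_algebra_axioms.intro k_space_axioms abelian_group_axioms)
      (auto simp: one mult scale distrib_right mult.assoc intro: mult.commute)
qed

lemma field_algebra_simps [simp]:
  "carrier field_algebra = UNIV" "add field_algebra = (+)" "zero field_algebra = 0"
  "mult field_algebra = (*)" "one field_algebra = 1" "smult field_algebra = (*)"
  by (simp_all add: field_algebra_def)

lemma group_alg_simps [simp]:
  "carrier group_alg = UNIV" "add group_alg = (+)" "zero group_alg = 0"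
  "mult group_alg = (*)" "one group_alg = 1" "smult group_alg = pm_scale"
  by (simp_all add: group_alg_def)

lemma k_algebra_field: "k_algebra (field_algebra :: ('k::field, 'k) module)"
proof -
  interpret vector_space "(*) :: 'k \<Rightarrow> 'k \<Rightarrow> 'k" by unfold_locales (auto simp: algebra_simps)
  show ?thesis by (rule k_algebra_of_subring[OF vector_space_axioms]) auto
qed

lemma k_algebra_group_alg: "k_algebra (group_alg :: ('k::field, 'g::ab_group_add \<Rightarrow>\<^sub>0 'k) module)"
  by (rule k_algebra_of_subring[OF pm.vector_space_axioms]) (auto simp: pm_scale_mult_left)

abbreviation box :: "nat \<Rightarrow> (nat \<times> nat) set" where "box n \<equiv> {1..n} \<times> {1..n}"

lemma poly_alg_simps [simp]:
  "carrier (poly_alg n) = keys_in (keys_in (box n))" "add (poly_alg n) = (+)" "zero (poly_alg n) = 0"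
  "mult (poly_alg n) = (*)" "one (poly_alg n) = 1" "smult (poly_alg n) = pm_scale"
  by (auto simp: poly_alg_def keys_in_def)

lemma poly_one_closed: "1 \<in> keys_in (keys_in S)" for S :: "'v set"
  by (auto simp: keys_in_def)

lemma poly_mult_closed:
  fixes p q :: "('v \<Rightarrow>\<^sub>0 nat) \<Rightarrow>\<^sub>0 'k::field"
  assumes "p \<in> keys_in (keys_in S)" "q \<in> keys_in (keys_in S)"
  shows "p * q \<in> keys_in (keys_in S)"
  using keys_mult[of p q] assms by (fastforce simp: keys_in_def dest: keys_add[THEN subsetD])

lemma poly_var_closed: "s \<in> {1..n} \<Longrightarrow> i \<in> {1..n} \<Longrightarrow> poly_var s i \<in> keys_in (keys_in (box n))"
  unfolding poly_var_def by (intro keys_in_single) auto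

lemma k_algebra_poly: "k_algebra (poly_alg n)"
  by (rule k_algebra_of_subring[OF pm.vector_space_axioms])
    (auto simp: keys_in_subspace poly_one_closed poly_mult_closed pm_scale_mult_left)

lemma poly_linear_iff: "f \<in> k_linear (poly_alg n) C \<longleftrightarrow> f \<in> k_linear (free_space (keys_in (box n))) C"
  by (simp add: k_linear_def)

lemma poly_sum:
  assumes f: "f \<in> k_linear (poly_alg n) C" and C: "k_space C"
    and g: "\<And>i. i \<in> K \<Longrightarrow> g i \<in> keys_in (keys_in (box n))"
  shows "f (\<Sum>i\<in>K. g i) = (\<Oplus>\<^bsub>C\<^esub>i\<in>K. f (g i))"
proof -
  interpret P: k_algebra "poly_alg n" by (rule k_algebra_poly)
  have "finsum (poly_alg n) g K = sum g K"
    using g by (intro finsum_eq_sum) (auto intro: P.abelian_monoid_axioms)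
  then show ?thesis
    using k_linear_finsum[OF f P.k_space_axioms C, of g K] g by auto
qed

lemma hom_relation_closed:
  assumes "a \<in> {1..n}" "i \<in> {1..n}" "j \<in> {1..n}"
  shows "hom_relation n \<tau> a i j \<in> carrier (poly_alg n)"
  unfolding hom_relation_def poly_alg_simps using assms
  by (intro keys_in_diff keys_in_sum keys_in_scale poly_mult_closed poly_var_closed) auto

text \<open>The relations of the universal algebra, read in \<open>C\<close> at the matrix
  \<open>x\<close>. Equivalently, the linear map e_i \<mapsto> \<Sum> e_s \<otimes> x_si into P
  \<otimes> C respects the operation with structure constants \<open>\<tau>\<close>.\<close>

definition satisfies :: "('k::field, 'c, 'm) module_scheme \<Rightarrow> nat \<Rightarrow> (nat \<Rightarrow> nat \<Rightarrow> nat \<Rightarrow> 'k) \<Rightarrow>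
    (nat \<Rightarrow> nat \<Rightarrow> 'c) \<Rightarrow> bool" where
  "satisfies C n \<tau> x \<longleftrightarrow> (\<forall>a\<in>{1..n}. \<forall>i\<in>{1..n}. \<forall>j\<in>{1..n}.
     (\<Oplus>\<^bsub>C\<^esub>u\<in>{1..n}. \<tau> i j u \<odot>\<^bsub>C\<^esub> x a u) =
     (\<Oplus>\<^bsub>C\<^esub>s\<in>{1..n}. \<Oplus>\<^bsub>C\<^esub>t\<in>{1..n}. \<tau> s t a \<odot>\<^bsub>C\<^esub> (x s i \<otimes>\<^bsub>C\<^esub> x t j)))"

text \<open>A homomorphism passes through the sums of the relation; the work is to convert sums in
  the polynomial type into \<open>finsum\<close> of the target record.\<close>

lemma hom_relation_kernel:
  assumes \<phi>: "\<phi> \<in> alg_hom (poly_alg n) C" and C: "k_algebra C"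
    and aij: "a \<in> {1..n}" "i \<in> {1..n}" "j \<in> {1..n}"
  shows "\<phi> (hom_relation n \<tau> a i j) = \<zero>\<^bsub>C\<^esub> \<longleftrightarrow>
    (\<Oplus>\<^bsub>C\<^esub>u\<in>{1..n}. \<tau> i j u \<odot>\<^bsub>C\<^esub> \<phi> (poly_var a u)) =
    (\<Oplus>\<^bsub>C\<^esub>s\<in>{1..n}. \<Oplus>\<^bsub>C\<^esub>t\<in>{1..n}. \<tau> s t a \<odot>\<^bsub>C\<^esub> (\<phi> (poly_var s i) \<otimes>\<^bsub>C\<^esub> \<phi> (poly_var t j)))"
proof -
  interpret C: k_algebra C by fact
  note l = alg_hom_linear[OF \<phi>]
  have v: "s \<in> {1..n} \<Longrightarrow> i \<in> {1..n} \<Longrightarrow> \<phi> (poly_var s i) \<in> carrier C" for s i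
    using k_linear_closed[OF l, of "poly_var s i"] poly_var_closed[of s n i] by simp
  let ?p = "\<Sum>u=1..n. pm_scale (\<tau> i j u) (poly_var a u)"
  let ?q = "\<Sum>s=1..n. \<Sum>t=1..n. pm_scale (\<tau> s t a) (poly_var s i * poly_var t j)"
  let ?L = "\<Oplus>\<^bsub>C\<^esub>u\<in>{1..n}. \<tau> i j u \<odot>\<^bsub>C\<^esub> \<phi> (poly_var a u)"
  let ?I = "\<lambda>s. \<Oplus>\<^bsub>C\<^esub>t\<in>{1..n}. \<tau> s t a \<odot>\<^bsub>C\<^esub> (\<phi> (poly_var s i) \<otimes>\<^bsub>C\<^esub> \<phi> (poly_var t j))"
  let ?S = "\<Oplus>\<^bsub>C\<^esub>s\<in>{1..n}. ?I s"
  let ?r = "\<lambda>s. \<Sum>t=1..n. pm_scale (\<tau> s t a) (poly_var s i * poly_var t j)"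
  have p: "?p \<in> keys_in (keys_in (box n))" and q: "?q \<in> keys_in (keys_in (box n))"
    using aij by (intro keys_in_sum keys_in_scale poly_mult_closed poly_var_closed; simp)+
  have "\<phi> ?p = (\<Oplus>\<^bsub>C\<^esub>u\<in>{1..n}. \<phi> (pm_scale (\<tau> i j u) (poly_var a u)))"
    using aij by (intro poly_sum[OF l C.k_space_axioms] keys_in_scale poly_var_closed)
  also have "\<dots> = ?L"
    using aij v k_linear_smult[OF l] by (intro C.finsum_cong') (auto simp: poly_var_closed)
  finally have 1: "\<phi> ?p = ?L" .
  have "\<phi> ?q = (\<Oplus>\<^bsub>C\<^esub>s\<in>{1..n}. \<phi> (?r s))"
    using aij by (intro poly_sum[OF l C.k_space_axioms] keys_in_sum keys_in_scale poly_mult_closed poly_var_closed)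
  also have "\<dots> = ?S"
  proof (rule C.finsum_cong'[OF refl])
    show "?I \<in> {1..n} \<rightarrow> carrier C"
      using aij v by (auto intro!: C.finsum_closed)
    fix s assume s: "s \<in> {1..n}"
    have "\<phi> (?r s) =
        (\<Oplus>\<^bsub>C\<^esub>t\<in>{1..n}. \<phi> (pm_scale (\<tau> s t a) (poly_var s i * poly_var t j)))"
      using aij s by (intro poly_sum[OF l C.k_space_axioms] keys_in_scale poly_mult_closed poly_var_closed)
    also have "\<dots> = ?I s"
      using aij s v k_linear_smult[OF l] alg_hom_mult[OF \<phi>]
      by (intro C.finsum_cong') (auto simp: poly_var_closed poly_mult_closed)
    finally show "\<phi> (?r s) =
        ?I s" .
  qed
  finally have 2: "\<phi> ?q = ?S" .
  have "\<phi> (hom_relation n \<tau> a i j) = \<phi> ?p \<ominus>\<^bsub>C\<^esub> \<phi> ?q"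
    unfolding hom_relation_def using l p q
    by (intro k_linear_diff[of _ "keys_in (box n)"]) (auto simp: poly_linear_iff C.k_space_axioms)
  moreover have "\<phi> ?p \<in> carrier C" "\<phi> ?q \<in> carrier C"
    using k_linear_closed[OF l] p q by simp_all
  ultimately show ?thesis unfolding 1[symmetric] 2[symmetric] by (simp add: C.minus_eq_zero_iff)
qed

text \<open>The product runs over the whole box and not over the support of \<open>m\<close>:
  exponents then add factor by factor, and absent variables contribute a zeroth power.\<close>

definition mon_eval :: "('k::field, 'c, 'm) module_scheme \<Rightarrow> nat \<Rightarrow> (nat \<times> nat \<Rightarrow> 'c) \<Rightarrow> (nat \<times> nat \<Rightarrow>\<^sub>0 nat) \<Rightarrow> 'c" where
  "mon_eval C n c m = (\<Otimes>\<^bsub>C\<^esub>v\<in>box n. c v [^]\<^bsub>C\<^esub> lookup m v)"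

text \<open>Evaluation at \<open>c\<close>: it is multiplicative on monomials, and
  \<open>lin_ext_mult\<close> carries this over to polynomials.\<close>

lemma poly_eval_exists:
  fixes C :: "('a::field, 'c, 'm) module_scheme"
  assumes C: "k_algebra C" and c: "\<And>v. v \<in> box n \<Longrightarrow> c v \<in> carrier C"
  obtains \<phi> where "\<phi> \<in> alg_hom (poly_alg n) C"
    and "\<And>s i. s \<in> {1..n} \<Longrightarrow> i \<in> {1..n} \<Longrightarrow> \<phi> (poly_var s i) = c (s, i)"
proof -
  interpret C: k_algebra C by fact
  interpret P: k_algebra "poly_alg n" by (rule k_algebra_poly)
  let ?m = "mon_eval C n c"
  have mc: "?m m \<in> carrier C" for m
    unfolding mon_eval_def using c by (intro C.finprod_closed) auto
  have madd: "?m (m + m') = ?m m \<otimes>\<^bsub>C\<^esub> ?m m'" for m m'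
  proof -
    have "?m (m + m') = (\<Otimes>\<^bsub>C\<^esub>v\<in>box n. c v [^]\<^bsub>C\<^esub> lookup m v \<otimes>\<^bsub>C\<^esub> c v [^]\<^bsub>C\<^esub> lookup m' v)"
      unfolding mon_eval_def using c by (intro C.finprod_cong') (auto simp: lookup_add C.nat_pow_mult)
    then show ?thesis unfolding mon_eval_def using c by (subst C.finprod_multf[symmetric]) auto
  qed
  have m0: "?m 0 = \<one>\<^bsub>C\<^esub>" by (simp add: mon_eval_def)
  have mvar: "?m (single (s, i) 1) = c (s, i)" if "s \<in> {1..n}" "i \<in> {1..n}" for s i
  proof -
    have "?m (single (s, i) 1) = (\<Otimes>\<^bsub>C\<^esub>v\<in>box n. if v = (s, i) then c v else \<one>\<^bsub>C\<^esub>)"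
      unfolding mon_eval_def using c by (intro C.finprod_cong') (auto simp: lookup_single when_def One_nat_def)
    also have "\<dots> = c (s, i)"
      using that c C.finprod_singleton_swap[of "(s, i)" "box n" c] by simp
    finally show ?thesis .
  qed
  have L: "lin_ext C ?m \<in> k_linear (poly_alg n) C"
    unfolding poly_linear_iff by (intro C.lin_ext_linear) (auto simp: mc)
  have "restrict (lin_ext C ?m) (carrier (poly_alg n)) \<in> alg_hom (poly_alg n) C"
  proof (rule alg_hom_restrictI[OF P.k_space_axioms L])
    show "lin_ext C ?m \<one>\<^bsub>poly_alg n\<^esub> = \<one>\<^bsub>C\<^esub>"
      using C.lin_ext_single[of ?m 0 1] by (simp add: mc m0 flip: single_one)
    fix p q :: "'a pair_poly" assume "p \<in> carrier (poly_alg n)" "q \<in> carrier (poly_alg n)"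
    then show "lin_ext C ?m (p \<otimes>\<^bsub>poly_alg n\<^esub> q) = lin_ext C ?m p \<otimes>\<^bsub>C\<^esub> lin_ext C ?m q"
      using C.lin_ext_mult[of ?m "keys_in (box n)" p q] by (simp add: mc madd keys_in_add)
  qed (auto simp: poly_one_closed poly_mult_closed)
  moreover have "lin_ext C ?m (poly_var s i) = c (s, i)" if "s \<in> {1..n}" "i \<in> {1..n}" for s i
    unfolding poly_var_def using c that
    by (subst C.lin_ext_single) (simp_all only: mc mvar C.smult_1 mem_Times_iff fst_conv snd_conv)
  ultimately show ?thesis
    using that[of "restrict (lin_ext C ?m) (carrier (poly_alg n))"] by (auto simp: poly_var_closed)
qed

text \<open>Agreement passes from variables to powers of one variable, from there to monomials, and
  by linearity to polynomials.\<close>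

lemma poly_hom_unique:
  fixes C :: "('a::field, 'c, 'm) module_scheme"
  assumes C: "k_algebra C" and f: "f \<in> alg_hom (poly_alg n) C" and g: "g \<in> alg_hom (poly_alg n) C"
    and fg: "\<And>s i. s \<in> {1..n} \<Longrightarrow> i \<in> {1..n} \<Longrightarrow> f (poly_var s i) = g (poly_var s i)"
    and p: "p \<in> carrier (poly_alg n)"
  shows "f p = g p"
proof -
  interpret C: k_algebra C by fact
  have cl: "single m (1 :: 'a) \<in> carrier (poly_alg n)" if "m \<in> keys_in (box n)" for m
    using that by (simp add: keys_in_single)
  have mm: "single (m + m') (1 :: 'a) = single m 1 \<otimes>\<^bsub>poly_alg n\<^esub> single m' 1"
    for m m' by (simp add: mult_single)
  have "f (single m 1) = g (single m 1)" if "m \<in> keys_in (box n)" for m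
    using that
  proof (induction m rule: keys_in_induct)
    case zero
    then show ?case using alg_hom_one[OF f] alg_hom_one[OF g] by simp
  next
    case (single v k)
    show ?case
    proof (induction k)
      case 0
      then show ?case using alg_hom_one[OF f] alg_hom_one[OF g] by simp
    next
      case (Suc k)
      obtain s i where v: "v = (s, i)" by (cases v)
      have "single v (Suc k) = single v 1 + single v k"
        by (simp flip: single_add Suc_eq_plus1_left)
      moreover have "f (single (single v 1) 1) = g (single (single v 1) 1)"
        using fg[of s i] single v by (simp add: poly_var_def)
      ultimately show ?case using Suc single
        by (simp only: mm alg_hom_mult[OF f] alg_hom_mult[OF g] cl keys_in_single)
    qed
  next
    case (add m m')
    then show ?case by (simp only: mm alg_hom_mult[OF f] alg_hom_mult[OF g] cl)
  qed
  then show ?thesis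
    using p by (simp add: C.free_linear_unique[OF alg_hom_linear[OF f, unfolded poly_linear_iff]
      alg_hom_linear[OF g, unfolded poly_linear_iff]])
qed

section \<open>The presented algebra as a quotient and its universal property\<close>

locale univ_algebra =
  fixes n :: nat and \<tau> \<mu> :: "nat \<Rightarrow> nat \<Rightarrow> nat \<Rightarrow> 'k::field"
begin

abbreviation "P \<equiv> poly_alg n :: ('k, 'k pair_poly) module"
abbreviation "I \<equiv> univ_ideal n \<tau> \<mu>"
abbreviation "H \<equiv> univ_alg n \<tau> \<mu>"
abbreviation "x \<equiv> univ_gen n \<tau> \<mu>"

definition proj :: "'k pair_poly \<Rightarrow> 'k pair_poly set" where "proj p = I +>\<^bsub>P\<^esub> p"

definition rels :: "'k pair_poly set" where
  "rels = {hom_relation n \<tau> a i j | a i j. a \<in> {1..n} \<and> i \<in> {1..n} \<and> j \<in> {1..n}} \<union>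
      {hom_relation n \<mu> a i j | a i j. a \<in> {1..n} \<and> i \<in> {1..n} \<and> j \<in> {1..n}}"

sublocale P: k_algebra P by (rule k_algebra_poly)

lemma rels_subset: "rels \<subseteq> carrier P"
  unfolding rels_def using hom_relation_closed by blast

lemma I_def: "I = genideal P rels"
  by (simp add: univ_ideal_def rels_def)

sublocale I: ideal I P
  unfolding I_def by (rule P.genideal_ideal[OF rels_subset])

lemma rels_I: "rels \<subseteq> I"
  unfolding I_def by (rule P.genideal_self[OF rels_subset])

lemma univ_alg_simps:
  "carrier H = carrier (P Quot I)" "mult H = mult (P Quot I)" "one H = one (P Quot I)"
  "zero H = zero (P Quot I)" "add H = add (P Quot I)"
  "smult H = (\<lambda>c X. \<Union>p\<in>X. proj (pm_scale c p))"
  by (simp_all add: univ_alg_def ring.defs module.defs FactRing_def proj_def)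

lemma carrier_univ: "carrier H = proj ` carrier P"
  by (auto simp: univ_alg_simps FactRing_def A_RCOSETS_def' proj_def)

lemma proj_ops:
  assumes "p \<in> carrier P" "q \<in> carrier P"
  shows "proj p \<otimes>\<^bsub>H\<^esub> proj q = proj (p * q)" "proj p \<oplus>\<^bsub>H\<^esub> proj q = proj (p + q)"
  using assms I.rcoset_mult_add[of p q] I.a_rcos_sum[of p q]
  by (simp_all add: univ_alg_simps FactRing_def proj_def)

lemma one_univ: "\<one>\<^bsub>H\<^esub> = proj 1"
  by (simp add: univ_alg_simps FactRing_def proj_def)

lemma proj_image: "proj p = (\<lambda>h. h + p) ` I"
  by (auto simp: proj_def a_r_coset_def r_coset_def)

text \<open>A ring ideal is closed under scalars because c p = (c 1) p.\<close>

lemma I_scale: "p \<in> I \<Longrightarrow> pm_scale c p \<in> I"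
proof -
  assume p: "p \<in> I"
  have "pm_scale c 1 \<in> carrier P" using P.smult_closed[of 1 c] P.one_closed by simp
  then have "pm_scale c 1 \<otimes>\<^bsub>P\<^esub> p \<in> I" using p by (rule I.I_l_closed[rotated])
  then show ?thesis by (simp add: pm_scale_mult_left)
qed

lemma I_subspace: "pm.subspace I"
  using I.a_closed I.zero_closed I_scale by (auto simp: pm.subspace_def)

lemma proj_eq_iff: "proj p = proj q \<longleftrightarrow> p - q \<in> I"
proof
  assume "proj p = proj q"
  then have "0 + p \<in> proj q" unfolding proj_image using pm.subspace_0[OF I_subspace] by blast
  then show "p - q \<in> I" by (auto simp: proj_image)
next
  have "proj p \<subseteq> proj q" if pq: "p - q \<in> I" for p q
  proof
    fix z assume "z \<in> proj p"
    then obtain h where "h \<in> I" "z = (h + (p - q)) + q" by (auto simp: proj_image)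
    then show "z \<in> proj q" unfolding proj_image using pm.subspace_add[OF I_subspace _ pq] by blast
  qed
  moreover assume "p - q \<in> I"
  moreover from this have "q - p \<in> I" using pm.subspace_neg[OF I_subspace, of "p - q"] by simp
  ultimately show "proj p = proj q" by blast
qed

lemma proj_self: "p \<in> proj p"
  unfolding proj_image using pm.subspace_0[OF I_subspace] by force

lemma proj_memD: "q \<in> proj p \<Longrightarrow> proj q = proj p"
  by (subst proj_eq_iff) (auto simp: proj_image)

lemma proj_smult: "c \<odot>\<^bsub>H\<^esub> proj p = proj (pm_scale c p)"
proof -
  have "proj (pm_scale c q) = proj (pm_scale c p)" if "q \<in> proj p" for q
    using I_scale[of "q - p" c] proj_memD[OF that]
    by (simp add: proj_eq_iff pm.scale_right_diff_distrib)
  then have "(\<Union>q\<in>proj p. proj (pm_scale c q)) = proj (pm_scale c p)"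
    using proj_self by blast
  then show ?thesis by (simp add: univ_alg_simps)
qed

lemma k_algebra_univ: "k_algebra H"
proof -
  have ex: "\<exists>p. p \<in> keys_in (keys_in (box n)) \<and> X = proj p" if "X \<in> carrier H" for X
    using that by (auto simp: carrier_univ)
  have pc: "p \<in> keys_in (keys_in (box n)) \<Longrightarrow> proj p \<in> carrier H" for p by (auto simp: carrier_univ)
  have zero: "\<zero>\<^bsub>H\<^esub> = proj 0"
    by (simp add: univ_alg_simps FactRing_def proj_image)
  note ops = pc zero one_univ proj_ops[simplified] proj_smult keys_in_add keys_in_scale poly_mult_closed
    poly_one_closed
  have grp: "abelian_group H"
  proof (rule abelian_groupI)
    fix X assume "X \<in> carrier H"
    then obtain p where p: "p \<in> keys_in (keys_in (box n))" "X = proj p" using ex by blast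
    have "proj (- p) \<oplus>\<^bsub>H\<^esub> X = \<zero>\<^bsub>H\<^esub>" "proj (- p) \<in> carrier H"
      using p keys_in_diff[of 0 _ p] by (simp_all add: ops)
    then show "\<exists>y\<in>carrier H. y \<oplus>\<^bsub>H\<^esub> X = \<zero>\<^bsub>H\<^esub>" by blast
  qed (auto dest!: ex simp: ops ac_simps)
  show ?thesis
    by (intro k_algebra.intro cringI comm_monoidI k_space.intro k_algebra_axioms.intro
        k_space_axioms.intro grp)
      (auto dest!: ex simp: ops ac_simps ring_distribs pm.scale_left_distrib pm.scale_right_distrib
        pm_scale_mult_left pm_scale_mult_right)
qed

lemma proj_alg_hom: "restrict proj (carrier P) \<in> alg_hom P H"
  by (intro alg_hom_restrictI k_linearI P.k_space_axioms)
    (auto simp: carrier_univ proj_ops[simplified] proj_smult one_univ poly_one_closed poly_mult_closed)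

lemma univ_gen_proj: "x s i = proj (poly_var s i)"
  by (simp add: univ_gen_def proj_def)

lemma univ_gen_closed: "s \<in> {1..n} \<Longrightarrow> i \<in> {1..n} \<Longrightarrow> x s i \<in> carrier H"
  by (auto simp: carrier_univ univ_gen_proj poly_var_closed)

lemma proj_comp_alg_hom:
  assumes "f \<in> alg_hom H C"
  shows "(\<lambda>p\<in>carrier P. f (restrict proj (carrier P) p)) \<in> alg_hom P C"
  using alg_hom_compose[OF P.k_algebra_axioms proj_alg_hom assms] .

lemma univ_hom_unique:
  assumes C: "k_algebra C" and f: "f \<in> alg_hom H C" and g: "g \<in> alg_hom H C"
    and fg: "\<And>s i. s \<in> {1..n} \<Longrightarrow> i \<in> {1..n} \<Longrightarrow> f (x s i) = g (x s i)"
  shows "f = g"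
proof (rule extensionalityI[OF alg_hom_ext[OF f] alg_hom_ext[OF g]])
  fix X assume "X \<in> carrier H"
  then obtain p where p: "p \<in> carrier P" "X = proj p" by (auto simp: carrier_univ)
  then show "f X = g X"
    using poly_hom_unique[OF C proj_comp_alg_hom[OF f] proj_comp_alg_hom[OF g] _ p(1)] fg
    by (simp add: poly_var_closed univ_gen_proj)
qed

text \<open>Composed with the projection, \<open>f\<close> becomes a homomorphism on polynomials
  that kills every relation; \<open>hom_relation_kernel\<close> rewrites each killed relation as the
  asserted identity.\<close>

lemma hom_satisfies:
  assumes C: "k_algebra C" and f: "f \<in> alg_hom H C"
  shows "satisfies C n \<tau> (\<lambda>s i. f (x s i))" "satisfies C n \<mu> (\<lambda>s i. f (x s i))"
proof -
  interpret C: k_algebra C by fact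
  interpret H: k_algebra H by (rule k_algebra_univ)
  let ?\<phi> = "\<lambda>p\<in>carrier P. f (restrict proj (carrier P) p)"
  have var: "?\<phi> (poly_var s i) = f (x s i)" if "s \<in> {1..n}" "i \<in> {1..n}" for s i
    using that by (simp add: poly_var_closed univ_gen_proj)
  have ker: "?\<phi> r = \<zero>\<^bsub>C\<^esub>" if "r \<in> rels" for r
  proof -
    have "r \<in> carrier P" "proj r = proj 0" using that rels_subset rels_I by (auto simp: proj_eq_iff)
    moreover have "proj 0 = \<zero>\<^bsub>H\<^esub>" by (simp add: univ_alg_simps FactRing_def proj_image)
    ultimately show ?thesis
      using k_linear_zero[OF alg_hom_linear[OF f] H.k_space_axioms C.k_space_axioms] by simp
  qed
  have fc: "s \<in> {1..n} \<Longrightarrow> i \<in> {1..n} \<Longrightarrow> f (x s i) \<in> carrier C" for s i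
    using alg_hom_closed[OF f univ_gen_closed] .
  have *: "(\<Oplus>\<^bsub>C\<^esub>u\<in>{1..n}. \<nu> i j u \<odot>\<^bsub>C\<^esub> f (x a u)) =
      (\<Oplus>\<^bsub>C\<^esub>s\<in>{1..n}. \<Oplus>\<^bsub>C\<^esub>t\<in>{1..n}. \<nu> s t a \<odot>\<^bsub>C\<^esub> (f (x s i) \<otimes>\<^bsub>C\<^esub> f (x t j)))"
    if aij: "a \<in> {1..n}" "i \<in> {1..n}" "j \<in> {1..n}" and r: "hom_relation n \<nu> a i j \<in> rels" for \<nu> a i j
  proof -
    have "(\<Oplus>\<^bsub>C\<^esub>u\<in>{1..n}. \<nu> i j u \<odot>\<^bsub>C\<^esub> f (x a u)) =
        (\<Oplus>\<^bsub>C\<^esub>u\<in>{1..n}. \<nu> i j u \<odot>\<^bsub>C\<^esub> ?\<phi> (poly_var a u))"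
      by (intro C.finsum_cong' refl funcsetI) (simp_all only: var aij C.smult_closed fc)
    also have "\<dots> = (\<Oplus>\<^bsub>C\<^esub>s\<in>{1..n}. \<Oplus>\<^bsub>C\<^esub>t\<in>{1..n}. \<nu> s t a \<odot>\<^bsub>C\<^esub> (?\<phi> (poly_var s i) \<otimes>\<^bsub>C\<^esub> ?\<phi> (poly_var t j)))"
      by (rule iffD1[OF hom_relation_kernel[OF proj_comp_alg_hom[OF f] C aij] ker[OF r]])
    also have "\<dots> = (\<Oplus>\<^bsub>C\<^esub>s\<in>{1..n}. \<Oplus>\<^bsub>C\<^esub>t\<in>{1..n}. \<nu> s t a \<odot>\<^bsub>C\<^esub> (f (x s i) \<otimes>\<^bsub>C\<^esub> f (x t j)))"
      by (intro C.finsum_cong' refl funcsetI C.finsum_closed)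
        (simp_all only: var aij C.smult_closed C.m_closed fc)
    finally show ?thesis .
  qed
  show "satisfies C n \<tau> (\<lambda>s i. f (x s i))"
    unfolding satisfies_def by (intro ballI *) (unfold rels_def, blast+)
  show "satisfies C n \<mu> (\<lambda>s i. f (x s i))"
    unfolding satisfies_def by (intro ballI *) (unfold rels_def, blast+)
qed

text \<open>Evaluation at \<open>c\<close> kills the relations, so its kernel is an ideal containing
  \<open>I\<close>, and evaluation descends to the quotient.\<close>

lemma univ_hom_exists:
  assumes C: "k_algebra C" and c: "\<And>s i. s \<in> {1..n} \<Longrightarrow> i \<in> {1..n} \<Longrightarrow> c s i \<in> carrier C"
    and sat: "satisfies C n \<tau> c" "satisfies C n \<mu> c"
  obtains f where "f \<in> alg_hom H C" "\<And>s i. s \<in> {1..n} \<Longrightarrow> i \<in> {1..n} \<Longrightarrow> f (x s i) = c s i"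
proof -
  interpret C: k_algebra C by fact
  interpret H: k_algebra H by (rule k_algebra_univ)
  obtain \<phi> where \<phi>: "\<phi> \<in> alg_hom P C"
    and var: "\<And>s i. s \<in> {1..n} \<Longrightarrow> i \<in> {1..n} \<Longrightarrow> \<phi> (poly_var s i) = c s i"
    by (rule poly_eval_exists[OF C, of n "\<lambda>(s, i). c s i"]) (use c in auto)
  have rel: "\<phi> (hom_relation n \<nu> a i j) = \<zero>\<^bsub>C\<^esub>"
    if aij: "a \<in> {1..n}" "i \<in> {1..n}" "j \<in> {1..n}" and s: "satisfies C n \<nu> c" for \<nu> a i j
  proof -
    have "(\<Oplus>\<^bsub>C\<^esub>u\<in>{1..n}. \<nu> i j u \<odot>\<^bsub>C\<^esub> \<phi> (poly_var a u)) =
        (\<Oplus>\<^bsub>C\<^esub>u\<in>{1..n}. \<nu> i j u \<odot>\<^bsub>C\<^esub> c a u)"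
      by (intro C.finsum_cong' refl funcsetI) (simp_all only: var aij C.smult_closed c)
    also have "\<dots> = (\<Oplus>\<^bsub>C\<^esub>s\<in>{1..n}. \<Oplus>\<^bsub>C\<^esub>t\<in>{1..n}. \<nu> s t a \<odot>\<^bsub>C\<^esub> (c s i \<otimes>\<^bsub>C\<^esub> c t j))"
      using s aij by (auto simp: satisfies_def)
    also have "\<dots> = (\<Oplus>\<^bsub>C\<^esub>s\<in>{1..n}. \<Oplus>\<^bsub>C\<^esub>t\<in>{1..n}. \<nu> s t a \<odot>\<^bsub>C\<^esub> (\<phi> (poly_var s i) \<otimes>\<^bsub>C\<^esub> \<phi> (poly_var t j)))"
      by (intro C.finsum_cong' refl funcsetI C.finsum_closed)
        (simp_all only: var aij C.smult_closed C.m_closed c)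
    finally show ?thesis using hom_relation_kernel[OF \<phi> C aij] by blast
  qed
  have "ring_hom_ring P C \<phi>"
    using \<phi> by (intro ring_hom_ringI2 P.ring_axioms C.ring_axioms) (simp add: alg_hom_def)
  then have "ideal (a_kernel P C \<phi>) P" by (rule ring_hom_ring.kernel_is_ideal)
  moreover have "rels \<subseteq> a_kernel P C \<phi>"
  proof
    fix r assume r: "r \<in> rels"
    moreover from this have "r \<in> carrier P" using rels_subset by blast
    moreover have "\<phi> r = \<zero>\<^bsub>C\<^esub>" using r rel sat unfolding rels_def by blast
    ultimately show "r \<in> a_kernel P C \<phi>" unfolding a_kernel_def' by blast
  qed
  ultimately have ker: "I \<subseteq> a_kernel P C \<phi>"
    unfolding I_def by (rule P.genideal_minimal)
  \<comment> \<open>The value on a coset is taken at an arbitrary representative; two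
    representatives differ by an element of \<open>I\<close>, hence of the kernel.\<close>
  define f where "f X = \<phi> (SOME p. p \<in> X)" for X
  have f: "f (proj p) = \<phi> p" if p: "p \<in> carrier P" for p
  proof -
    define q where "q = (SOME q. q \<in> proj p)"
    have q: "q \<in> proj p" unfolding q_def by (rule someI[of _ p]) (rule proj_self)
    then obtain h where h: "h \<in> I" "q = h + p" by (auto simp: proj_image)
    then have "\<phi> h = \<zero>\<^bsub>C\<^esub>" "h \<in> carrier P" using ker by (auto simp: a_kernel_def')
    then have "\<phi> q = \<phi> p"
      using h p k_linear_add[OF alg_hom_linear[OF \<phi>], of h p] alg_hom_closed[OF \<phi>, of p] by simp
    then show ?thesis by (simp add: f_def q_def[symmetric])
  qed
  have ex: "\<exists>p. p \<in> carrier P \<and> X = proj p" if "X \<in> carrier H" for X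
    using that by (auto simp: carrier_univ)
  note \<phi>l = alg_hom_linear[OF \<phi>]
  have "restrict f (carrier H) \<in> alg_hom H C"
  proof (intro alg_hom_restrictI k_linearI H.k_space_axioms)
    fix X d assume "X \<in> carrier H"
    then obtain p where p: "p \<in> carrier P" "X = proj p" using ex by blast
    then show "f X \<in> carrier C" using f[OF p(1)] k_linear_closed[OF \<phi>l p(1)] by simp
    have "pm_scale d p \<in> carrier P" using p by (simp add: keys_in_scale)
    then show "f (d \<odot>\<^bsub>H\<^esub> X) = d \<odot>\<^bsub>C\<^esub> f X"
      using p f[of p] f[of "pm_scale d p"] k_linear_smult[OF \<phi>l p(1), of d] by (simp add: proj_smult)
    fix Y assume "Y \<in> carrier H"
    then obtain q where q: "q \<in> carrier P" "Y = proj q" using ex by blast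
    have "p + q \<in> carrier P" "p * q \<in> carrier P" using p q P.a_closed[of p q] P.m_closed[of p q] by simp_all
    then show "f (X \<oplus>\<^bsub>H\<^esub> Y) = f X \<oplus>\<^bsub>C\<^esub> f Y" "f (X \<otimes>\<^bsub>H\<^esub> Y) = f X \<otimes>\<^bsub>C\<^esub> f Y"
      using p q f[of p] f[of q] f[of "p + q"] f[of "p * q"] k_linear_add[OF \<phi>l p(1) q(1)]
        alg_hom_mult[OF \<phi> p(1) q(1)] proj_ops[OF p(1) q(1)] by simp_all
  qed (use f[of 1] alg_hom_one[OF \<phi>] H.one_closed H.m_closed in \<open>simp_all add: one_univ poly_one_closed\<close>)
  moreover have "f (x s i) = c s i" if "s \<in> {1..n}" "i \<in> {1..n}" for s i
    using that f[of "poly_var s i"] by (simp add: univ_gen_proj var poly_var_closed)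
  ultimately show ?thesis using that[of "restrict f (carrier H)"] by (simp add: univ_gen_closed)
qed

end


section \<open>The bialgebra structure\<close>

context k_tensor
begin

text \<open>Summands may be exchanged modulo \<open>N\<close> while the sum itself stays in the free
  vector space, where interchanging sums is ordinary arithmetic.\<close>

lemma cls_sum_cong:
  assumes "\<And>i. i \<in> K \<Longrightarrow> f i \<in> F" "\<And>i. i \<in> K \<Longrightarrow> g i \<in> F" "\<And>i. i \<in> K \<Longrightarrow> cls (f i) = cls (g i)"
  shows "cls (\<Sum>i\<in>K. f i) = cls (\<Sum>i\<in>K. g i)"
  using assms by (simp add: cls_eq_iff sum_subtractf[symmetric] pm.subspace_sum[OF null_subspace])

text \<open>Linearity in the second slot at the level of representatives: the scalars of a linear
  combination become the coefficients of single terms.\<close>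

lemma cls_single_right:
  assumes a: "a \<in> carrier A" and b: "\<And>i. i \<in> K \<Longrightarrow> b i \<in> carrier B"
  shows "cls (single (a, \<Oplus>\<^bsub>B\<^esub>i\<in>K. d i \<odot>\<^bsub>B\<^esub> b i) 1) = cls (\<Sum>i\<in>K. single (a, b i) (d i))"
proof -
  note l = k_bilinear_right[OF elt_bilinear a]
  have "tensor_elt A B a (\<Oplus>\<^bsub>B\<^esub>i\<in>K. d i \<odot>\<^bsub>B\<^esub> b i) = (\<Oplus>\<^bsub>T\<^esub>i\<in>K. tensor_elt A B a (d i \<odot>\<^bsub>B\<^esub> b i))"
    using b by (intro k_linear_finsum[OF l B.k_space_axioms k_space_tensor]) auto
  also have "\<dots> = (\<Oplus>\<^bsub>T\<^esub>i\<in>K. cls (single (a, b i) (d i)))"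
  proof (rule T.finsum_cong'[OF refl])
    show "(\<lambda>i. cls (single (a, b i) (d i))) \<in> K \<rightarrow> carrier T"
      using a b by (auto intro!: cls_closed keys_in_single)
    show "tensor_elt A B a (d i \<odot>\<^bsub>B\<^esub> b i) = cls (single (a, b i) (d i))" if "i \<in> K" for i
      using k_linear_smult[OF l b[OF that], of "d i"] by (simp add: tensor_elt_def cls_smult)
  qed
  also have "\<dots> = cls (\<Sum>i\<in>K. single (a, b i) (d i))"
    using a b by (intro cls_sum[symmetric] keys_in_single) auto
  finally show ?thesis by (simp add: tensor_elt_def)
qed

lemma cls_single_left:
  assumes b: "b \<in> carrier B" and a: "\<And>i. i \<in> K \<Longrightarrow> a i \<in> carrier A"
  shows "cls (single (\<Oplus>\<^bsub>A\<^esub>i\<in>K. d i \<odot>\<^bsub>A\<^esub> a i, b) 1) = cls (\<Sum>i\<in>K. single (a i, b) (d i))"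
proof -
  note l = k_bilinear_left[OF elt_bilinear b]
  have "tensor_elt A B (\<Oplus>\<^bsub>A\<^esub>i\<in>K. d i \<odot>\<^bsub>A\<^esub> a i) b = (\<Oplus>\<^bsub>T\<^esub>i\<in>K. tensor_elt A B (d i \<odot>\<^bsub>A\<^esub> a i) b)"
    using a by (intro k_linear_finsum[OF l A.k_space_axioms k_space_tensor]) auto
  also have "\<dots> = (\<Oplus>\<^bsub>T\<^esub>i\<in>K. cls (single (a i, b) (d i)))"
  proof (rule T.finsum_cong'[OF refl])
    show "(\<lambda>i. cls (single (a i, b) (d i))) \<in> K \<rightarrow> carrier T"
      using a b by (auto intro!: cls_closed keys_in_single)
    show "tensor_elt A B (d i \<odot>\<^bsub>A\<^esub> a i) b = cls (single (a i, b) (d i))" if "i \<in> K" for i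
      using k_linear_smult[OF l a[OF that], of "d i"] by (simp add: tensor_elt_def cls_smult)
  qed
  also have "\<dots> = cls (\<Sum>i\<in>K. single (a i, b) (d i))"
    using a b by (intro cls_sum[symmetric] keys_in_single) auto
  finally show ?thesis by (simp add: tensor_elt_def)
qed

end

lemma (in k_space) finsum_double:
  assumes "finite K" "finite L" "\<And>p q. p \<in> K \<Longrightarrow> q \<in> L \<Longrightarrow> f p q \<in> carrier C"
  shows "(\<Oplus>p\<in>K. \<Oplus>q\<in>L. f p q) = (\<Oplus>z\<in>K \<times> L. f (fst z) (snd z))"
  using assms(1,3)
proof (induction K)
  case (insert p K)
  have "insert p K \<times> L = (\<lambda>q. (p, q)) ` L \<union> K \<times> L" by auto
  then have "(\<Oplus>z\<in>insert p K \<times> L. f (fst z) (snd z)) =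
      (\<Oplus>z\<in>(\<lambda>q. (p, q)) ` L. f (fst z) (snd z)) \<oplus> (\<Oplus>z\<in>K \<times> L. f (fst z) (snd z))"
    using insert assms(2) by (simp only:, intro finsum_Un_disjoint) auto
  also have "(\<Oplus>z\<in>(\<lambda>q. (p, q)) ` L. f (fst z) (snd z)) = (\<Oplus>q\<in>L. f p q)"
    using insert by (subst finsum_reindex) (auto simp: inj_on_def)
  finally show ?case using insert by (subst finsum_insert) (auto intro!: finsum_closed)
qed simp

context k_tensor_alg
begin

text \<open>If \<open>y\<close> and \<open>z\<close> are matrices of multiplicative coactions, their
  product is the matrix of the composite coaction and so solves the same relations. Applied to the
  generators, this is why the comultiplication exists. The computation takes place on
  representatives: the relation for \<open>z\<close> in the right factor, an interchange of sums,
  then the relation for \<open>y\<close> in the left factor.\<close>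

lemma satisfies_tensor:
  assumes y: "\<And>s i. s \<in> {1..n} \<Longrightarrow> i \<in> {1..n} \<Longrightarrow> y s i \<in> carrier A" and sy: "satisfies A n \<nu> y"
    and z: "\<And>s i. s \<in> {1..n} \<Longrightarrow> i \<in> {1..n} \<Longrightarrow> z s i \<in> carrier B" and sz: "satisfies B n \<nu> z"
  shows "satisfies T n \<nu> (\<lambda>i j. \<Oplus>\<^bsub>T\<^esub>s\<in>{1..n}. tensor_elt A B (y i s) (z s j))"
  unfolding satisfies_def
proof (intro ballI)
  fix a i j assume a: "a \<in> {1..n}" and i: "i \<in> {1..n}" and j: "j \<in> {1..n}"
  let ?J = "{1..n}"
  let ?s = "\<lambda>a b c. single (a, b) c :: 'a \<times> 'b \<Rightarrow>\<^sub>0 'k"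
  let ?t = "\<lambda>i j. \<Oplus>\<^bsub>T\<^esub>s\<in>?J. tensor_elt A B (y i s) (z s j)"
  let ?Z = "\<lambda>w. z (fst w) i \<otimes>\<^bsub>B\<^esub> z (snd w) j"
  let ?Y = "\<lambda>v w. y (fst v) (fst w) \<otimes>\<^bsub>A\<^esub> y (snd v) (snd w)"
  let ?N = "\<lambda>v. \<nu> (fst v) (snd v)"
  let ?p = "\<lambda>s t. \<nu> s t a \<odot>\<^bsub>T\<^esub> (?t s i \<otimes>\<^bsub>T\<^esub> ?t t j)"
  define r where "r i j = (\<Sum>s\<in>?J. ?s (y i s) (z s j) 1)" for i j
  have r: "r i j \<in> F" if "i \<in> ?J" "j \<in> ?J" for i j
    unfolding r_def using that y z by (intro keys_in_sum keys_in_single) auto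
  have c: "?t i j = cls (r i j)" if "i \<in> ?J" "j \<in> ?J" for i j
    unfolding r_def tensor_elt_def using that y z by (intro cls_sum[symmetric] keys_in_single) auto
  have "(\<Oplus>\<^bsub>T\<^esub>u\<in>?J. \<nu> i j u \<odot>\<^bsub>T\<^esub> ?t a u) =
      (\<Oplus>\<^bsub>T\<^esub>u\<in>?J. cls (pm_scale (\<nu> i j u) (r a u)))"
    using a c r by (intro T.finsum_cong') (auto simp: cls_smult intro!: cls_closed keys_in_scale)
  also have "\<dots> = cls (\<Sum>u\<in>?J. pm_scale (\<nu> i j u) (r a u))"
    using a r by (intro cls_sum[symmetric] keys_in_scale) auto
  also have "(\<Sum>u\<in>?J. pm_scale (\<nu> i j u) (r a u)) = (\<Sum>s\<in>?J. \<Sum>u\<in>?J. ?s (y a s) (z s u) (\<nu> i j u))"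
    unfolding r_def by (subst sum.swap) (simp add: pm.scale_sum_right)
  \<comment> \<open>The scalars move into the right factor, where they form the left side of the
    relation for \<open>z\<close> in row \<open>s\<close> and columns \<open>i\<close>,
    \<open>j\<close>.\<close>
  also have "cls \<dots> = cls (\<Sum>s\<in>?J. ?s (y a s) (\<Oplus>\<^bsub>B\<^esub>u\<in>?J. \<nu> i j u \<odot>\<^bsub>B\<^esub> z s u) 1)"
    using a y z by (intro cls_sum_cong cls_single_right[symmetric] keys_in_sum keys_in_single)
      (auto intro!: B.finsum_closed)
  also have "(\<Sum>s\<in>?J. ?s (y a s) (\<Oplus>\<^bsub>B\<^esub>u\<in>?J. \<nu> i j u \<odot>\<^bsub>B\<^esub> z s u) 1) =
      (\<Sum>s\<in>?J. ?s (y a s) (\<Oplus>\<^bsub>B\<^esub>w\<in>?J \<times> ?J. ?N w s \<odot>\<^bsub>B\<^esub> ?Z w) 1)"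
  proof (rule sum.cong[OF refl])
    fix s assume s: "s \<in> ?J"
    have "(\<Oplus>\<^bsub>B\<^esub>u\<in>?J. \<nu> i j u \<odot>\<^bsub>B\<^esub> z s u) = (\<Oplus>\<^bsub>B\<^esub>p\<in>?J. \<Oplus>\<^bsub>B\<^esub>q\<in>?J. \<nu> p q s \<odot>\<^bsub>B\<^esub> (z p i \<otimes>\<^bsub>B\<^esub> z q j))"
      using sz s i j by (simp only: satisfies_def)
    also have "\<dots> = (\<Oplus>\<^bsub>B\<^esub>w\<in>?J \<times> ?J. ?N w s \<odot>\<^bsub>B\<^esub> ?Z w)"
      using z i j by (intro B.finsum_double) auto
    finally show "?s (y a s) (\<Oplus>\<^bsub>B\<^esub>u\<in>?J. \<nu> i j u \<odot>\<^bsub>B\<^esub> z s u) 1 =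
      ?s (y a s) (\<Oplus>\<^bsub>B\<^esub>w\<in>?J \<times> ?J. ?N w s \<odot>\<^bsub>B\<^esub> ?Z w) 1" by simp
  qed
  also have "cls \<dots> = cls (\<Sum>s\<in>?J. \<Sum>w\<in>?J \<times> ?J. ?s (y a s) (?Z w) (?N w s))"
    using a i j y z by (intro cls_sum_cong cls_single_right keys_in_sum keys_in_single)
      (auto intro!: B.finsum_closed)
  also have "(\<Sum>s\<in>?J. \<Sum>w\<in>?J \<times> ?J. ?s (y a s) (?Z w) (?N w s)) =
      (\<Sum>w\<in>?J \<times> ?J. \<Sum>s\<in>?J. ?s (y a s) (?Z w) (?N w s))"
    by (rule sum.swap)
  \<comment> \<open>Now the scalars move into the left factor: for a fixed pair \<open>w\<close> the
    sum over \<open>s\<close> is the left side of the relation for \<open>y\<close> in row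
    \<open>a\<close> and columns \<open>w\<close>.\<close>
  also have "cls \<dots> = cls (\<Sum>w\<in>?J \<times> ?J. ?s (\<Oplus>\<^bsub>A\<^esub>s\<in>?J. ?N w s \<odot>\<^bsub>A\<^esub> y a s) (?Z w) 1)"
    using a i j y z by (intro cls_sum_cong cls_single_left[symmetric] keys_in_sum keys_in_single)
      (auto intro!: A.finsum_closed)
  also have "(\<Sum>w\<in>?J \<times> ?J. ?s (\<Oplus>\<^bsub>A\<^esub>s\<in>?J. ?N w s \<odot>\<^bsub>A\<^esub> y a s) (?Z w) 1) =
      (\<Sum>w\<in>?J \<times> ?J. ?s (\<Oplus>\<^bsub>A\<^esub>v\<in>?J \<times> ?J. ?N v a \<odot>\<^bsub>A\<^esub> (?Y v w)) (?Z w) 1)"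
  proof (rule sum.cong[OF refl])
    fix w assume w: "w \<in> ?J \<times> ?J"
    have "(\<Oplus>\<^bsub>A\<^esub>s\<in>?J. ?N w s \<odot>\<^bsub>A\<^esub> y a s) =
        (\<Oplus>\<^bsub>A\<^esub>k\<in>?J. \<Oplus>\<^bsub>A\<^esub>l\<in>?J. \<nu> k l a \<odot>\<^bsub>A\<^esub> (y k (fst w) \<otimes>\<^bsub>A\<^esub> y l (snd w)))"
      using sy a w by (simp only: satisfies_def mem_Times_iff)
    also have "\<dots> = (\<Oplus>\<^bsub>A\<^esub>v\<in>?J \<times> ?J. ?N v a \<odot>\<^bsub>A\<^esub> (?Y v w))"
      using y w by (intro A.finsum_double) auto
    finally show "?s (\<Oplus>\<^bsub>A\<^esub>s\<in>?J. ?N w s \<odot>\<^bsub>A\<^esub> y a s) (?Z w) 1 =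
        ?s (\<Oplus>\<^bsub>A\<^esub>v\<in>?J \<times> ?J. ?N v a \<odot>\<^bsub>A\<^esub> (?Y v w)) (?Z w) 1" by simp
  qed
  also have "cls \<dots> = cls (\<Sum>w\<in>?J \<times> ?J. \<Sum>v\<in>?J \<times> ?J. ?s (?Y v w) (?Z w) (?N v a))"
    using a i j y z by (intro cls_sum_cong cls_single_left keys_in_sum keys_in_single)
      (auto intro!: A.finsum_closed)
  \<comment> \<open>For a fixed pair \<open>v\<close> the sum over \<open>w\<close> factors into the
    product of two entries of the matrix product.\<close>
  also have "(\<Sum>w\<in>?J \<times> ?J. \<Sum>v\<in>?J \<times> ?J. ?s (?Y v w) (?Z w) (?N v a)) =
      (\<Sum>v\<in>?J \<times> ?J. pm_scale (?N v a) (fm (r (fst v) i) (r (snd v) j)))"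
    unfolding r_def fm_sum_left unfolding fm_sum_right fm_single
    by (subst sum.swap) (simp add: pm.scale_sum_right sum.cartesian_product case_prod_unfold)
  also have "\<dots> = (\<Sum>s\<in>?J. \<Sum>t\<in>?J. pm_scale (\<nu> s t a) (fm (r s i) (r t j)))"
    by (simp add: sum.cartesian_product case_prod_unfold)
  also have "cls \<dots> = (\<Oplus>\<^bsub>T\<^esub>s\<in>?J. \<Oplus>\<^bsub>T\<^esub>t\<in>?J. cls (pm_scale (\<nu> s t a) (fm (r s i) (r t j))))"
  proof -
    have in_F: "pm_scale (\<nu> s t a) (fm (r s i) (r t j)) \<in> F" if "s \<in> ?J" "t \<in> ?J" for s t
      using that i j by (intro keys_in_scale fm_closed r)
    have "cls (\<Sum>s\<in>?J. \<Sum>t\<in>?J. pm_scale (\<nu> s t a) (fm (r s i) (r t j))) =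
        (\<Oplus>\<^bsub>T\<^esub>s\<in>?J. cls (\<Sum>t\<in>?J. pm_scale (\<nu> s t a) (fm (r s i) (r t j))))"
      by (intro cls_sum keys_in_sum in_F)
    also have "\<dots> = (\<Oplus>\<^bsub>T\<^esub>s\<in>?J. \<Oplus>\<^bsub>T\<^esub>t\<in>?J. cls (pm_scale (\<nu> s t a) (fm (r s i) (r t j))))"
      by (intro T.finsum_cong' refl funcsetI T.finsum_closed cls_closed cls_sum in_F)
    finally show ?thesis .
  qed
  also have "\<dots> = (\<Oplus>\<^bsub>T\<^esub>s\<in>?J. \<Oplus>\<^bsub>T\<^esub>t\<in>?J. ?p s t)"
  proof (intro T.finsum_cong' refl funcsetI)
    fix s t assume s: "s \<in> ?J" and t: "t \<in> ?J"
    show eq: "cls (pm_scale (\<nu> s t a) (fm (r s i) (r t j))) = ?p s t"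
      unfolding c[OF s i] c[OF t j] using r s t i j by (simp only: cls_mult cls_smult)
    show "?p s t \<in> carrier T"
      unfolding eq[symmetric] using r s t i j by (intro cls_closed keys_in_scale fm_closed) auto
  next
    fix s assume s: "s \<in> ?J"
    show "(\<Oplus>\<^bsub>T\<^esub>t\<in>?J. ?p s t) \<in> carrier T"
    proof (intro T.finsum_closed funcsetI)
      fix t assume t: "t \<in> ?J"
      show "?p s t \<in> carrier T"
        unfolding c[OF s i] c[OF t j] using r s t i j
        by (simp only: cls_mult cls_smult cls_closed keys_in_scale fm_closed)
    qed
  qed
  finally show "(\<Oplus>\<^bsub>T\<^esub>u\<in>?J. \<nu> i j u \<odot>\<^bsub>T\<^esub> ?t a u) =
    (\<Oplus>\<^bsub>T\<^esub>s\<in>?J. \<Oplus>\<^bsub>T\<^esub>t\<in>?J. ?p s t)" .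
qed

end

lemma finsum_type:
  fixes C :: "('k::field, 'c::ab_group_add, 'm) module_scheme"
  assumes "k_space C" "carrier C = UNIV" "add C = (+)" "zero C = 0"
  shows "finsum C f K = sum f K"
  using assms by (intro finsum_eq_sum) (auto simp: k_space_def abelian_group_def)

text \<open>For passing along record extensions: a bialgebra record agrees with its underlying
  algebra in these six fields.\<close>

lemma k_algebra_cong:
  assumes A: "k_algebra A"
    and [simp]: "carrier B = carrier A" "mult B = mult A" "one B = one A" "zero B = zero A"
      "add B = add A" "smult B = smult A"
  shows "k_algebra B"
proof -
  interpret A: k_algebra A by fact
  show ?thesis
    by (intro k_algebra.intro cringI comm_monoidI k_space.intro k_algebra_axioms.intro
        k_space_axioms.intro abelian_groupI bexI[of _ "\<ominus>\<^bsub>A\<^esub> x" for x])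
      (auto simp: A.m_assoc A.a_assoc A.l_distr A.smult_add_left A.smult_add_right A.smult_assoc
        A.smult_mult_left intro: A.a_comm A.m_comm A.l_neg)
qed

lemma finsum_field [simp]: "finsum (field_algebra :: ('k::field, 'k) module) f K = sum f K"
  using k_algebra_field by (intro finsum_type) (auto simp: k_algebra_def)

lemma finsum_group_alg [simp]:
  "finsum (group_alg :: ('k::field, 'g::ab_group_add \<Rightarrow>\<^sub>0 'k) module) f K = sum f K"
  using k_algebra_group_alg by (intro finsum_type) (auto simp: k_algebra_def)

context univ_algebra
begin

sublocale H: k_algebra H by (rule k_algebra_univ)
sublocale HH: k_tensor_alg H H ..

text \<open>The identity of \<open>H\<close>, restricted to the carrier, is an algebra homomorphism,
  so \<open>hom_satisfies\<close> applies to it.\<close>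

lemma gen_satisfies: "satisfies H n \<tau> x" "satisfies H n \<mu> x"
proof -
  have "restrict (\<lambda>h. h) (carrier H) \<in> alg_hom H H"
    by (intro alg_hom_restrictI H.k_space_axioms k_linearI) auto
  note * = hom_satisfies[OF k_algebra_univ this]
  have "satisfies H n \<nu> x" if "satisfies H n \<nu> (\<lambda>s i. restrict (\<lambda>h. h) (carrier H) (x s i))" for \<nu>
    using that unfolding satisfies_def
    by (simp add: univ_gen_closed cong: H.finsum_cong)
  then show "satisfies H n \<tau> x" "satisfies H n \<mu> x" using * by blast+
qed

lemma comult_gen_closed:
  "i \<in> {1..n} \<Longrightarrow> j \<in> {1..n} \<Longrightarrow> (\<Oplus>\<^bsub>tensor H H\<^esub>s\<in>{1..n}. tensor_elt H H (x i s) (x s j)) \<in> carrier (tensor H H)"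
  by (intro HH.T.finsum_closed funcsetI HH.elt_closed univ_gen_closed)

text \<open>Since \<open>univ_comult\<close> is a definite description, its properties become
  available only through unique existence: existence by \<open>satisfies_tensor\<close> and the
  universal property, uniqueness on the generators.\<close>

lemma comult_unique:
  "\<exists>!\<Delta>. \<Delta> \<in> alg_hom H (tensor H H) \<and> (\<forall>i\<in>{1..n}. \<forall>j\<in>{1..n}.
    \<Delta> (x i j) = (\<Oplus>\<^bsub>tensor H H\<^esub>s\<in>{1..n}. tensor_elt H H (x i s) (x s j)))"
proof (rule ex_ex1I)
  let ?c = "\<lambda>i j. \<Oplus>\<^bsub>tensor H H\<^esub>s\<in>{1..n}. tensor_elt H H (x i s) (x s j)"
  have "satisfies (tensor H H) n \<tau> ?c" "satisfies (tensor H H) n \<mu> ?c"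
    by (intro HH.satisfies_tensor univ_gen_closed gen_satisfies; assumption)+
  then obtain \<Delta> where "\<Delta> \<in> alg_hom H (tensor H H)"
    "\<And>i j. i \<in> {1..n} \<Longrightarrow> j \<in> {1..n} \<Longrightarrow> \<Delta> (x i j) = ?c i j"
    using univ_hom_exists[of "tensor H H" ?c] HH.k_algebra_tensor comult_gen_closed by blast
  then show "\<exists>\<Delta>. \<Delta> \<in> alg_hom H (tensor H H) \<and> (\<forall>i\<in>{1..n}. \<forall>j\<in>{1..n}. \<Delta> (x i j) = ?c i j)"
    by blast
  fix f g assume "f \<in> alg_hom H (tensor H H) \<and> (\<forall>i\<in>{1..n}. \<forall>j\<in>{1..n}. f (x i j) = ?c i j)"
    and "g \<in> alg_hom H (tensor H H) \<and> (\<forall>i\<in>{1..n}. \<forall>j\<in>{1..n}. g (x i j) = ?c i j)"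
  then show "f = g" by (intro univ_hom_unique[OF HH.k_algebra_tensor]) simp_all
qed

lemma comult_alg_hom: "univ_comult n \<tau> \<mu> \<in> alg_hom H (tensor H H)"
  and comult_gen: "i \<in> {1..n} \<Longrightarrow> j \<in> {1..n} \<Longrightarrow>
    univ_comult n \<tau> \<mu> (x i j) = (\<Oplus>\<^bsub>tensor H H\<^esub>s\<in>{1..n}. tensor_elt H H (x i s) (x s j))"
  using theI'[OF comult_unique] unfolding univ_comult_def Let_def by blast+

text \<open>The identity matrix belongs to the identity map of P, which respects any operation; this
  yields the counit.\<close>

lemma satisfies_delta: "satisfies (field_algebra :: ('k, 'k) module) n \<nu> (\<lambda>i j. if i = j then 1 else 0)"
proof -
  have "(\<Sum>s=1..n. \<Sum>t=1..n. \<nu> s t a * ((if s = i then 1 else 0) * (if t = j then 1 else 0))) = \<nu> i j a"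
    if "i \<in> {1..n}" "j \<in> {1..n}" for a i j
    using that by (simp add: if_distrib[of "\<lambda>y. _ * y"] sum.delta cong: if_cong)
  then show ?thesis by (auto simp: satisfies_def if_distrib[of "\<lambda>y. _ * y"] cong: if_cong)
qed

lemma counit_unique:
  "\<exists>!\<epsilon>. \<epsilon> \<in> alg_hom H field_algebra \<and>
    (\<forall>i\<in>{1..n}. \<forall>j\<in>{1..n}. \<epsilon> (x i j) = (if i = j then 1 else 0))"
proof (rule ex_ex1I)
  obtain \<epsilon> where "\<epsilon> \<in> alg_hom H (field_algebra :: ('k, 'k) module)"
    "\<And>i j. i \<in> {1..n} \<Longrightarrow> j \<in> {1..n} \<Longrightarrow> \<epsilon> (x i j) = (if i = j then 1 else 0)"
    by (rule univ_hom_exists[OF k_algebra_field _ satisfies_delta satisfies_delta]) auto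
  then show "\<exists>\<epsilon>. \<epsilon> \<in> alg_hom H field_algebra \<and>
    (\<forall>i\<in>{1..n}. \<forall>j\<in>{1..n}. \<epsilon> (x i j) = (if i = j then 1 else 0))" by blast
qed (auto intro!: univ_hom_unique[OF k_algebra_field])

lemma counit_alg_hom: "univ_counit n \<tau> \<mu> \<in> alg_hom H field_algebra"
  and counit_gen: "i \<in> {1..n} \<Longrightarrow> j \<in> {1..n} \<Longrightarrow> univ_counit n \<tau> \<mu> (x i j) = (if i = j then 1 else 0)"
  using theI'[OF counit_unique] unfolding univ_counit_def by blast+

abbreviation "comultH \<equiv> univ_comult n \<tau> \<mu>"
abbreviation "counitH \<equiv> univ_counit n \<tau> \<mu>"
abbreviation "Hb \<equiv> univ_bialgebra n \<tau> \<mu>"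

lemma Hb_simps [simp]:
  "carrier Hb = carrier H" "mult Hb = mult H" "one Hb = one H" "zero Hb = zero H" "add Hb = add H"
  "smult Hb = smult H" "comult Hb = comultH" "counit Hb = counitH"
  by (simp_all add: univ_bialgebra_def module.defs bialgebra.defs)

sublocale Hb: k_algebra Hb
  by (rule k_algebra_cong[OF k_algebra_univ]) simp_all

lemma alg_hom_Hb: "alg_hom Hb C = alg_hom H C"
  by (auto simp: alg_hom_def ring_hom_def)

section \<open>Convolution of algebra maps and group-like elements\<close>

lemma convolution_alt:
  "convolution Hb C f g = (\<lambda>h\<in>carrier H. tensor_lift C (\<lambda>a b. f a \<otimes>\<^bsub>C\<^esub> g b) (comultH h))"
  by (simp add: convolution_def)

text \<open>Convolution is comultiplication followed by a \<otimes> b \<mapsto> f(a) g(b), and the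
  latter is multiplicative because \<open>C\<close> is commutative.\<close>

lemma convolution_alg_hom:
  assumes C: "k_algebra C" and f: "f \<in> alg_hom H C" and g: "g \<in> alg_hom H C"
  shows "convolution Hb C f g \<in> alg_hom H C"
proof -
  have "(\<lambda>h\<in>carrier H. restrict (tensor_lift C (\<lambda>a b. f a \<otimes>\<^bsub>C\<^esub> g b)) (carrier (tensor H H)) (comultH h))
      \<in> alg_hom H C"
    by (rule alg_hom_compose[OF k_algebra_univ comult_alg_hom HH.tensor_lift_alg_hom[OF f g C]])
  also have "(\<lambda>h\<in>carrier H. restrict (tensor_lift C (\<lambda>a b. f a \<otimes>\<^bsub>C\<^esub> g b)) (carrier (tensor H H)) (comultH h))
      = convolution Hb C f g"
    unfolding convolution_alt using alg_hom_closed[OF comult_alg_hom] by (auto intro!: restrict_ext)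
  finally show ?thesis .
qed

text \<open>Stated for linear maps, so that it also covers \<open>unit_map kG \<circ> g\<close>,
  which need not be extensional.\<close>

lemma convolution_gen:
  assumes C: "k_algebra C" and f: "f \<in> k_linear H C" and g: "g \<in> k_linear H C"
    and ij: "i \<in> {1..n}" "j \<in> {1..n}"
  shows "convolution Hb C f g (x i j) = (\<Oplus>\<^bsub>C\<^esub>s\<in>{1..n}. f (x i s) \<otimes>\<^bsub>C\<^esub> g (x s j))"
proof -
  interpret C: k_algebra C by fact
  let ?L = "tensor_lift C (\<lambda>a b. f a \<otimes>\<^bsub>C\<^esub> g b)"
  note bl = HH.mult_bilinear[OF f g C]
  have "convolution Hb C f g (x i j) = ?L (\<Oplus>\<^bsub>tensor H H\<^esub>s\<in>{1..n}. tensor_elt H H (x i s) (x s j))"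
    using ij by (simp only: convolution_alt restrict_apply' univ_gen_closed comult_gen)
  also have "\<dots> = (\<Oplus>\<^bsub>C\<^esub>s\<in>{1..n}. ?L (tensor_elt H H (x i s) (x s j)))"
    using ij by (intro k_linear_finsum[OF HH.tensor_lift_linear[OF C.k_space_axioms bl] HH.k_space_tensor
      C.k_space_axioms] funcsetI HH.elt_closed univ_gen_closed)
  also have "\<dots> = (\<Oplus>\<^bsub>C\<^esub>s\<in>{1..n}. f (x i s) \<otimes>\<^bsub>C\<^esub> g (x s j))"
    using ij by (intro C.finsum_cong' refl funcsetI)
      (simp_all only: HH.tensor_lift_elt[OF C.k_space_axioms bl] univ_gen_closed C.m_closed
        k_linear_closed[OF f] k_linear_closed[OF g])
  finally show ?thesis .
qed

text \<open>Lets \<open>unit_map kG \<circ> g\<close> be replaced by its restriction to the carrier,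
  to which \<open>convolution_alg_hom\<close> applies.\<close>

lemma convolution_cong:
  assumes C: "k_algebra C" and f: "f \<in> k_linear H C" "f' \<in> k_linear H C"
    and g: "g \<in> k_linear H C" "g' \<in> k_linear H C"
    and eq: "\<And>h. h \<in> carrier H \<Longrightarrow> f h = f' h" "\<And>h. h \<in> carrier H \<Longrightarrow> g h = g' h"
  shows "convolution Hb C f g = convolution Hb C f' g'"
  unfolding convolution_alt
proof (rule restrict_ext)
  interpret C: k_algebra C by fact
  note bl = HH.mult_bilinear[OF f(1) g(1) C] and bl' = HH.mult_bilinear[OF f(2) g(2) C]
  fix h assume "h \<in> carrier H"
  then have "comultH h \<in> carrier (tensor H H)" by (rule alg_hom_closed[OF comult_alg_hom])
  then show "tensor_lift C (\<lambda>a b. f a \<otimes>\<^bsub>C\<^esub> g b) (comultH h) =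
      tensor_lift C (\<lambda>a b. f' a \<otimes>\<^bsub>C\<^esub> g' b) (comultH h)"
    by (rule HH.tensor_linear_unique[OF HH.tensor_lift_linear[OF C.k_space_axioms bl]
      HH.tensor_lift_linear[OF C.k_space_axioms bl'], rotated])
      (simp add: HH.tensor_lift_elt[OF C.k_space_axioms bl]
        HH.tensor_lift_elt[OF C.k_space_axioms bl'] eq)
qed

text \<open>An algebra map to the field lies in the finite dual because its kernel is an ideal of
  codimension at most one: h - f(h) 1 lies in the kernel, so the unit alone spans a
  complement.\<close>

lemma group_likes_eq: "group_likes Hb = alg_hom H field_algebra"
proof
  show "group_likes Hb \<subseteq> alg_hom H field_algebra"
    by (auto simp: group_likes_def finite_dual_def alg_hom_iff k_linear_def)
  show "alg_hom H field_algebra \<subseteq> group_likes Hb"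
  proof
    fix f :: "'k pair_poly set \<Rightarrow> 'k" assume f: "f \<in> alg_hom H field_algebra"
    note fl = alg_hom_linear[OF f]
    have f_add: "f (a \<oplus>\<^bsub>H\<^esub> b) = f a + f b" if "a \<in> carrier H" "b \<in> carrier H" for a b
      using k_linear_add[OF fl that] by simp
    have f_smult: "f (c \<odot>\<^bsub>H\<^esub> a) = c * f a" if "a \<in> carrier H" for a c
      using k_linear_smult[OF fl that] by simp
    interpret Kf: k_algebra "field_algebra :: ('k, 'k) module" by (rule k_algebra_field)
    let ?I = "{a \<in> carrier H. f a = 0}"
    have "ring_hom_ring Hb field_algebra f"
      using f unfolding alg_hom_Hb[symmetric]
      by (intro ring_hom_ringI2 Hb.ring_axioms Kf.ring_axioms) (simp add: alg_hom_def)
    then have "ideal (a_kernel Hb field_algebra f) Hb" by (rule ring_hom_ring.kernel_is_ideal)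
    then have I: "ideal ?I Hb" by (simp add: a_kernel_def')
    have "\<exists>c. \<exists>a\<in>?I. h = (\<Oplus>\<^bsub>Hb\<^esub>b\<in>{\<one>\<^bsub>H\<^esub>}. c b \<odot>\<^bsub>H\<^esub> b) \<oplus>\<^bsub>H\<^esub> a" if h: "h \<in> carrier H" for h
    proof (intro exI bexI)
      let ?a = "h \<oplus>\<^bsub>H\<^esub> (- f h) \<odot>\<^bsub>H\<^esub> \<one>\<^bsub>H\<^esub>"
      have fs: "(\<Oplus>\<^bsub>Hb\<^esub>b\<in>{\<one>\<^bsub>H\<^esub>}. f h \<odot>\<^bsub>H\<^esub> b) = f h \<odot>\<^bsub>H\<^esub> \<one>\<^bsub>H\<^esub>"
        using Hb.finsum_insert[of "{}" "\<one>\<^bsub>H\<^esub>" "\<lambda>b. f h \<odot>\<^bsub>H\<^esub> b"] by simp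
      have "f h \<odot>\<^bsub>H\<^esub> \<one>\<^bsub>H\<^esub> \<oplus>\<^bsub>H\<^esub> (- f h) \<odot>\<^bsub>H\<^esub> \<one>\<^bsub>H\<^esub> = \<zero>\<^bsub>H\<^esub>"
        by (simp flip: H.smult_add_left)
      then show "h = (\<Oplus>\<^bsub>Hb\<^esub>b\<in>{\<one>\<^bsub>H\<^esub>}. (\<lambda>_. f h) b \<odot>\<^bsub>H\<^esub> b) \<oplus>\<^bsub>H\<^esub> ?a"
        using h by (simp add: fs H.a_lcomm[of _ h])
      show "?a \<in> ?I" using h alg_hom_one[OF f] by (simp add: f_add f_smult)
    qed
    then have "f \<in> finite_dual Hb"
      unfolding finite_dual_def mem_Collect_eq Hb_simps using alg_hom_ext[OF f] I
      by (intro conjI exI[of _ ?I] exI[of _ "{\<one>\<^bsub>H\<^esub>}"]) (simp_all add: f_add f_smult)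
    then show "f \<in> group_likes Hb"
      using alg_hom_one[OF f] alg_hom_mult[OF f] by (simp add: group_likes_def)
  qed
qed

end


section \<open>Bialgebra homomorphisms to the group algebra\<close>

abbreviation kG :: "('k::field, 'g::ab_group_add \<Rightarrow>\<^sub>0 'k) bialgebra" where
  "kG \<equiv> group_bialgebra"

lemma kG_simps [simp]:
  "carrier kG = UNIV" "add kG = (+)" "zero kG = 0" "mult kG = (*)" "one kG = 1" "smult kG = pm_scale"
  "comult kG = lin_ext (tensor group_alg group_alg) (\<lambda>\<sigma>. tensor_elt group_alg group_alg (group_elt \<sigma>) (group_elt \<sigma>))"
  "counit kG = lin_ext field_algebra (\<lambda>_. 1)"
  by (auto simp: group_bialgebra_def module.defs bialgebra.defs lin_ext_def fun_eq_iff)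

lemma k_algebra_kG: "k_algebra kG"
  by (rule k_algebra_cong[OF k_algebra_group_alg]) simp_all

lemma finsum_kG [simp]: "finsum (kG :: ('k::field, 'g::ab_group_add \<Rightarrow>\<^sub>0 'k) bialgebra) f K = sum f K"
  using k_algebra_kG by (intro finsum_type) (auto simp: k_algebra_def)

text \<open>\<open>kG\<close> and \<open>group_alg\<close> are records of different types with the
  same algebra fields, and a tensor product reads only those.\<close>

lemma tensor_kG:
  fixes B :: "('k::field, 'g::ab_group_add \<Rightarrow>\<^sub>0 'k) bialgebra"
  assumes "B = kG"
  shows "tensor_elt B B = tensor_elt group_alg group_alg" "tensor B B = tensor group_alg group_alg"
proof -
  have c: "tensor_class B B = tensor_class group_alg group_alg"
    by (simp add: assms fun_eq_iff tensor_class_def tensor_null_def)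
  then show e: "tensor_elt B B = tensor_elt group_alg group_alg"
    by (simp add: assms fun_eq_iff tensor_elt_def)
  show "tensor B B = tensor group_alg group_alg"
    unfolding tensor_def c e by (simp add: assms tensor_null_def free_tensor_mult_def)
qed

lemma alg_hom_kG: "alg_hom A kG = alg_hom A group_alg"
  by (auto simp: alg_hom_def ring_hom_def)

text \<open>The map a \<otimes> b \<mapsto> b_\<sigma> a, that is, the \<sigma>-coordinate of A
  \<otimes> k[G] viewed as a direct sum of copies of A indexed by G.\<close>

definition coef :: "('k::field, 'a, 'm) module_scheme \<Rightarrow> 'g::ab_group_add \<Rightarrow> ('a \<times> ('g \<Rightarrow>\<^sub>0 'k) \<Rightarrow>\<^sub>0 'k) set \<Rightarrow> 'a" where
  "coef A \<sigma> = tensor_lift A (\<lambda>a b. lookup b \<sigma> \<odot>\<^bsub>A\<^esub> a)"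

lemma k_tensor_group_alg: "k_space A \<Longrightarrow> k_tensor A group_alg"
  using k_algebra_group_alg by (auto simp: k_tensor_def k_algebra_def)

lemma coef_bilinear:
  assumes "k_space A"
  shows "(\<lambda>a b. lookup b \<sigma> \<odot>\<^bsub>A\<^esub> a) \<in> k_bilinear A group_alg A"
proof -
  interpret A: k_space A by fact
  show ?thesis
    by (intro k_bilinearI k_linearI)
      (auto simp: A.smult_add_right A.smult_add_left lookup_add A.smult_assoc[symmetric] mult.commute)
qed

lemma coef_linear: "k_space A \<Longrightarrow> coef A \<sigma> \<in> k_linear (tensor A group_alg) A"
  unfolding coef_def by (intro k_tensor.tensor_lift_linear k_tensor_group_alg coef_bilinear)

lemma coef_elt:
  "k_space A \<Longrightarrow> a \<in> carrier A \<Longrightarrow> coef A \<sigma> (tensor_elt A group_alg a b) = lookup b \<sigma> \<odot>\<^bsub>A\<^esub> a"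
  unfolding coef_def
  by (subst k_tensor.tensor_lift_elt[OF k_tensor_group_alg _ coef_bilinear]) auto

text \<open>Every element is the sum of its coefficients tensored with the corresponding group
  elements, over any sufficiently large finite set. Elements with equal coefficients thus have the
  same expansion.\<close>

lemma tensor_group_alg_eqI:
  fixes A :: "('k::field, 'a, 'm) module_scheme"
    and X :: "('a \<times> ('g::ab_group_add \<Rightarrow>\<^sub>0 'k) \<Rightarrow>\<^sub>0 'k) set"
  assumes A: "k_space A" and X: "X \<in> carrier (tensor A group_alg)" and Y: "Y \<in> carrier (tensor A group_alg)"
    and eq: "\<And>\<sigma>. coef A \<sigma> X = coef A \<sigma> Y"
  shows "X = Y"
proof -
  interpret A: k_space A by fact
  interpret B: k_algebra "group_alg :: ('k, 'g \<Rightarrow>\<^sub>0 'k) module" by (rule k_algebra_group_alg)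
  interpret AB: k_tensor A "group_alg :: ('k, 'g \<Rightarrow>\<^sub>0 'k) module" by (rule k_tensor_group_alg[OF A])
  let ?T = "tensor A (group_alg :: ('k, 'g \<Rightarrow>\<^sub>0 'k) module)"
  let ?R = "\<lambda>K X. \<Oplus>\<^bsub>?T\<^esub>\<sigma>\<in>K. tensor_elt A group_alg (coef A \<sigma> X) (group_elt \<sigma>)"
  note cc = k_linear_closed[OF coef_linear[OF A]]
  \<comment> \<open>The expansion is required over every finite superset of \<open>K\<close>, so
    that two elements can be expanded over a common index set, both in the sum case of the induction
    and for \<open>X\<close> and \<open>Y\<close> at the end.\<close>
  define Q where "Q K X \<longleftrightarrow> (\<forall>L. finite L \<longrightarrow> K \<subseteq> L \<longrightarrow> X = ?R L X)" for K X
  have Q_D: "X = ?R L X" if "Q K X" "finite L" "K \<subseteq> L" for K L X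
    using that(1)[unfolded Q_def, rule_format, OF that(2,3)] .
  have ex: "\<exists>K. finite K \<and> Q K X" if "X \<in> carrier ?T" for X
    using that
  proof (induction X rule: AB.tensor_induct)
    case (elt a b)
    have R: "tensor_elt A group_alg a b = ?R L (tensor_elt A group_alg a b)"
      if L: "finite L" "keys b \<subseteq> L" for L
    proof -
      have "?R L (tensor_elt A group_alg a b) =
          (\<Oplus>\<^bsub>?T\<^esub>\<sigma>\<in>L. tensor_elt A group_alg a (single \<sigma> (lookup b \<sigma>)))"
      proof (intro AB.T.finsum_cong' refl funcsetI AB.elt_closed elt)
        fix \<sigma>
        have "tensor_elt A group_alg (lookup b \<sigma> \<odot>\<^bsub>A\<^esub> a) (group_elt \<sigma>) =
            lookup b \<sigma> \<odot>\<^bsub>?T\<^esub> tensor_elt A group_alg a (group_elt \<sigma>)"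
          by (rule k_linear_smult[OF k_bilinear_left[OF AB.elt_bilinear] elt(1)]) simp
        also have "\<dots> = tensor_elt A group_alg a (lookup b \<sigma> \<odot>\<^bsub>group_alg\<^esub> group_elt \<sigma>)"
          by (rule k_linear_smult[OF k_bilinear_right[OF AB.elt_bilinear elt(1)], symmetric]) simp
        finally show "tensor_elt A group_alg (coef A \<sigma> (tensor_elt A group_alg a b)) (group_elt \<sigma>) =
            tensor_elt A group_alg a (single \<sigma> (lookup b \<sigma>))"
          using elt by (simp add: coef_elt[OF A] group_elt_def)
      qed simp
      also have "\<dots> = tensor_elt A group_alg a (\<Oplus>\<^bsub>group_alg\<^esub>\<sigma>\<in>L. single \<sigma> (lookup b \<sigma>))"
        by (rule k_linear_finsum[OF k_bilinear_right[OF AB.elt_bilinear elt(1)] B.k_space_axioms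
          AB.k_space_tensor, symmetric]) simp
      also have "\<dots> = tensor_elt A group_alg a b"
        using pm_expand[OF L] by simp
      finally show ?thesis by simp
    qed
    show ?case unfolding Q_def
    proof (intro exI conjI allI impI)
      show "finite (keys b)" by (rule finite_keys)
      fix L assume "finite L" "keys b \<subseteq> L"
      then show "tensor_elt A group_alg a b = ?R L (tensor_elt A group_alg a b)" by (rule R)
    qed
  next
    case (add X Y)
    obtain K L where K: "finite K" "Q K X" and L: "finite L" "Q L Y" using add(3,4) by blast
    have R: "X \<oplus>\<^bsub>?T\<^esub> Y = ?R M (X \<oplus>\<^bsub>?T\<^esub> Y)" if M: "finite M" "K \<union> L \<subseteq> M" for M
    proof -
      have "?R M (X \<oplus>\<^bsub>?T\<^esub> Y) = (\<Oplus>\<^bsub>?T\<^esub>\<sigma>\<in>M. tensor_elt A group_alg (coef A \<sigma> X) (group_elt \<sigma>) \<oplus>\<^bsub>?T\<^esub>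
          tensor_elt A group_alg (coef A \<sigma> Y) (group_elt \<sigma>))"
        using add(1,2) cc
        by (intro AB.T.finsum_cong' refl funcsetI AB.T.a_closed AB.elt_closed)
          (auto simp: k_linear_add[OF coef_linear[OF A]] k_linear_add[OF k_bilinear_left[OF AB.elt_bilinear]])
      also have "\<dots> = ?R M X \<oplus>\<^bsub>?T\<^esub> ?R M Y"
        using add(1,2) cc by (intro AB.T.finsum_addf funcsetI AB.elt_closed) auto
      also have "\<dots> = X \<oplus>\<^bsub>?T\<^esub> Y" using Q_D[OF K(2), of M] Q_D[OF L(2), of M] M by simp
      finally show ?thesis by simp
    qed
    show ?case unfolding Q_def
    proof (intro exI conjI allI impI)
      show "finite (K \<union> L)" using K(1) L(1) by simp
      fix M assume "finite M" "K \<union> L \<subseteq> M"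
      then show "X \<oplus>\<^bsub>?T\<^esub> Y = ?R M (X \<oplus>\<^bsub>?T\<^esub> Y)" by (rule R)
    qed
  qed
  obtain K L where K: "finite K" "Q K X" and L: "finite L" "Q L Y" using ex[OF X] ex[OF Y] by blast
  have "X = ?R (K \<union> L) X" by (rule Q_D[OF K(2)]) (use K(1) L(1) in auto)
  also have "\<dots> = ?R (K \<union> L) Y" by (simp add: eq)
  also have "\<dots> = Y" by (rule Q_D[OF L(2), symmetric]) (use K(1) L(1) in auto)
  finally show ?thesis .
qed

lemma k_tensor_alg_group_alg:
  "k_tensor_alg (group_alg :: (('k::field, 'g::ab_group_add \<Rightarrow>\<^sub>0 'k) module)) (group_alg :: (('k, 'g \<Rightarrow>\<^sub>0 'k) module))"
  using k_algebra_group_alg by (auto simp: k_tensor_alg_def)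

text \<open>The product of group elements adds their indices, and \<sigma> \<mapsto> \<sigma>
  \<otimes> \<sigma> respects it, so \<open>lin_ext_mult\<close> applies with all of G as the set of
  exponents.\<close>

lemma comult_kG_alg_hom:
  "comult kG \<in> alg_hom (group_alg :: ('k::field, 'g::ab_group_add \<Rightarrow>\<^sub>0 'k) module) (tensor group_alg group_alg)"
proof -
  interpret B: k_algebra "group_alg :: ('k::field, 'g::ab_group_add \<Rightarrow>\<^sub>0 'k) module" by (rule k_algebra_group_alg)
  interpret BB: k_tensor_alg "group_alg :: ('k::field, 'g::ab_group_add \<Rightarrow>\<^sub>0 'k) module"
    "group_alg :: ('k, 'g \<Rightarrow>\<^sub>0 'k) module"
    by (rule k_tensor_alg_group_alg)
  interpret TT: k_algebra "tensor (group_alg :: ('k::field, 'g::ab_group_add \<Rightarrow>\<^sub>0 'k) module)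
    (group_alg :: ('k, 'g \<Rightarrow>\<^sub>0 'k) module)"
    by (rule BB.k_algebra_tensor)
  let ?T = "tensor (group_alg :: ('k::field, 'g::ab_group_add \<Rightarrow>\<^sub>0 'k) module)
    (group_alg :: ('k, 'g \<Rightarrow>\<^sub>0 'k) module)"
  let ?h = "\<lambda>\<sigma> :: 'g. tensor_elt group_alg group_alg (group_elt \<sigma> :: 'g \<Rightarrow>\<^sub>0 'k) (group_elt \<sigma>)"
  have hc: "?h \<sigma> \<in> carrier ?T" for \<sigma> by (intro BB.elt_closed) auto
  have hm: "?h (\<sigma> + \<rho>) = ?h \<sigma> \<otimes>\<^bsub>?T\<^esub> ?h \<rho>" for \<sigma> \<rho>
    by (subst BB.elt_mult) (auto simp: group_elt_def mult_single)
  have L: "lin_ext ?T ?h \<in> k_linear group_alg ?T"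
    using BB.T.lin_ext_linear[of ?h UNIV] hc by (simp add: k_linear_def keys_in_def)
  have "restrict (lin_ext ?T ?h) (carrier group_alg) \<in> alg_hom group_alg ?T"
  proof (rule alg_hom_restrictI[OF B.k_space_axioms L])
    show "lin_ext ?T ?h \<one>\<^bsub>group_alg\<^esub> = \<one>\<^bsub>?T\<^esub>"
      using BB.T.lin_ext_single[of ?h 0 1, OF hc] BB.T.smult_1[OF hc[of 0]]
      by (simp add: BB.one_tensor group_elt_def)
    show "lin_ext ?T ?h (u \<otimes>\<^bsub>group_alg\<^esub> v) = lin_ext ?T ?h u \<otimes>\<^bsub>?T\<^esub> lin_ext ?T ?h v" for u v
      using TT.lin_ext_mult[of ?h UNIV u v] hc hm by (simp add: keys_in_def)
  qed auto
  then show ?thesis by (simp add: restrict_def)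
qed

lemma counit_kG_alg_hom:
  "counit kG \<in> alg_hom (group_alg :: ('k::field, 'g::ab_group_add \<Rightarrow>\<^sub>0 'k) module) field_algebra"
proof -
  interpret B: k_algebra "group_alg :: ('k::field, 'g::ab_group_add \<Rightarrow>\<^sub>0 'k) module" by (rule k_algebra_group_alg)
  interpret K: k_algebra "field_algebra :: ('k::field, 'k) module" by (rule k_algebra_field)
  let ?l = "lin_ext field_algebra (\<lambda>_. 1) :: ('g \<Rightarrow>\<^sub>0 'k) \<Rightarrow> 'k"
  have L: "?l \<in> k_linear group_alg field_algebra"
    using K.lin_ext_linear[of "\<lambda>_ :: 'g. 1" UNIV] by (simp add: k_linear_def keys_in_def)
  have "restrict ?l (carrier group_alg) \<in> alg_hom group_alg field_algebra"
  proof (rule alg_hom_restrictI[OF B.k_space_axioms L])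
    show "?l \<one>\<^bsub>group_alg\<^esub> = \<one>\<^bsub>field_algebra\<^esub>"
      using K.lin_ext_single[of "\<lambda>_ :: 'g. 1" 0 1] by simp
    show "?l (u \<otimes>\<^bsub>group_alg\<^esub> v) = ?l u \<otimes>\<^bsub>field_algebra\<^esub> ?l v" for u v
      using K.lin_ext_mult[of "\<lambda>_ :: 'g. 1" UNIV u v] by (simp add: keys_in_def)
  qed auto
  then show ?thesis by (simp add: restrict_def)
qed

lemma counit_kG_linear:
  fixes u v :: "'g::ab_group_add \<Rightarrow>\<^sub>0 'k::field" and \<sigma> :: 'g
  shows "counit kG (u + v) = counit kG u + counit kG v" "counit kG (pm_scale c u) = c * counit kG u"
    "counit kG (single \<sigma> c) = c" "counit kG (0 :: 'g \<Rightarrow>\<^sub>0 'k) = 0"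
proof -
  interpret K: k_algebra "field_algebra :: ('k::field, 'k) module" by (rule k_algebra_field)
  note l = alg_hom_linear[OF counit_kG_alg_hom]
  show "counit kG (u + v) = counit kG u + counit kG v" "counit kG (pm_scale c u) = c * counit kG u"
    using k_linear_add[OF l, of u v] k_linear_smult[OF l, of u c] by simp_all
  show "counit kG (single \<sigma> c) = c" by (simp add: K.lin_ext_single)
  show "counit kG (0 :: 'g \<Rightarrow>\<^sub>0 'k) = 0" by (simp add: lin_ext_def)
qed

lemma counit_kG_sum: "counit kG (\<Sum>i\<in>K. f i) = (\<Sum>i\<in>K. counit kG (f i))"
  by (induction K rule: infinite_finite_induct) (simp_all add: counit_kG_linear del: kG_simps)

lemma counit_kG_superset:
  "finite K \<Longrightarrow> keys u \<subseteq> K \<Longrightarrow> counit kG u = (\<Sum>\<sigma>\<in>K. lookup u \<sigma>)"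
  by (subst pm_expand) (auto simp: counit_kG_sum counit_kG_linear simp del: kG_simps)

text \<open>In \<Delta> u = \<Sum> u_\<sigma> \<sigma> \<otimes> \<sigma> only the term with
  \<sigma> = \<rho> has \<rho> as its second factor. Both sides are linear in \<open>u\<close>, so
  single group elements suffice for the check.\<close>

lemma coef_comult_kG:
  fixes u :: "'g::ab_group_add \<Rightarrow>\<^sub>0 'k::field"
  shows "coef group_alg \<rho> (comult kG u) = single \<rho> (lookup u \<rho>)"
proof -
  interpret B: k_algebra "group_alg :: ('k::field, 'g::ab_group_add \<Rightarrow>\<^sub>0 'k) module" by (rule k_algebra_group_alg)
  interpret BB: k_tensor_alg "group_alg :: ('k::field, 'g::ab_group_add \<Rightarrow>\<^sub>0 'k) module"
    "group_alg :: ('k, 'g \<Rightarrow>\<^sub>0 'k) module"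
    by (rule k_tensor_alg_group_alg)
  let ?f = "\<lambda>u :: 'g \<Rightarrow>\<^sub>0 'k. coef group_alg \<rho> (comult kG u)"
  let ?g = "\<lambda>u :: 'g \<Rightarrow>\<^sub>0 'k. single \<rho> (lookup u \<rho>)"
  have "?f \<in> k_linear group_alg group_alg"
    by (rule k_linear_compose[OF alg_hom_linear[OF comult_kG_alg_hom] coef_linear[OF B.k_space_axioms]])
  then have f: "?f \<in> k_linear (free_space UNIV) group_alg" by (simp add: k_linear_def)
  have g: "?g \<in> k_linear (free_space UNIV) group_alg"
    by (auto simp: k_linear_def lookup_add single_add)
  have e: "?f (single \<sigma> 1) = ?g (single \<sigma> 1)" for \<sigma>
    by (cases "\<sigma> = \<rho>") (auto simp: BB.T.lin_ext_single BB.elt_closed coef_elt[OF B.k_space_axioms] group_elt_def lookup_single)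
  show ?thesis
    by (rule B.free_linear_unique[OF f g e]) (simp_all add: keys_in_def)
qed

section \<open>Compatibility with comultiplication and counit as matrix identities\<close>

context univ_algebra
begin

lemma tensor_map_comult_gen:
  fixes \<theta> :: "'k pair_poly set \<Rightarrow> ('g::ab_group_add \<Rightarrow>\<^sub>0 'k)"
  assumes \<theta>: "\<theta> \<in> k_linear H group_alg" and ij: "i \<in> {1..n}" "j \<in> {1..n}"
  shows "coef group_alg \<rho> (tensor_map group_alg group_alg \<theta> \<theta> (comultH (x i j))) =
    (\<Sum>s=1..n. pm_scale (lookup (\<theta> (x s j)) \<rho>) (\<theta> (x i s)))"
proof -
  let ?m = "tensor_map group_alg group_alg \<theta> \<theta>"
  have Bs: "k_space (group_alg :: ('k, 'g \<Rightarrow>\<^sub>0 'k) module)"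
    using k_algebra_group_alg by (rule k_algebra.axioms)
  note tm = tensor_map_linear[OF \<theta> \<theta> H.k_space_axioms H.k_space_axioms Bs Bs]
  have l: "(\<lambda>X. coef group_alg \<rho> (?m X)) \<in> k_linear (tensor H H) group_alg"
    by (rule k_linear_compose[OF tm(1) coef_linear[OF Bs]])
  have "coef group_alg \<rho> (?m (comultH (x i j))) =
      (\<Oplus>\<^bsub>group_alg\<^esub>s\<in>{1..n}. coef group_alg \<rho> (?m (tensor_elt H H (x i s) (x s j))))"
    unfolding comult_gen[OF ij] using ij
    by (intro k_linear_finsum[OF l HH.k_space_tensor Bs] funcsetI HH.elt_closed univ_gen_closed)
  also have "\<dots> = (\<Sum>s=1..n. pm_scale (lookup (\<theta> (x s j)) \<rho>) (\<theta> (x i s)))"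
    using ij by (simp add: tm(2) univ_gen_closed coef_elt[OF Bs])
  finally show ?thesis .
qed

text \<open>Let A_\<sigma> be the matrix of \<sigma>-coefficients of the entries \<theta>(x_ij).
  Applying \<open>coef\<close> at \<open>\<rho>\<close> to the comultiplication condition gives the
  displayed sum, whose coefficient at \<sigma> reads A_\<sigma> A_\<rho> = A_\<rho> if \<sigma> =
  \<rho> and 0 otherwise; the counit condition says that the A_\<sigma> add up to the identity.
  Generators suffice because all maps compared are algebra homomorphisms on
  \<open>H\<close>.\<close>

lemma bialg_hom_iff:
  fixes \<theta> :: "'k pair_poly set \<Rightarrow> ('g::ab_group_add \<Rightarrow>\<^sub>0 'k)"
  shows "\<theta> \<in> bialg_hom Hb kG \<longleftrightarrow> \<theta> \<in> alg_hom H group_alg \<and>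
    (\<forall>i\<in>{1..n}. \<forall>j\<in>{1..n}.
      (\<forall>\<rho>. (\<Sum>s=1..n. pm_scale (lookup (\<theta> (x s j)) \<rho>) (\<theta> (x i s))) =
        single \<rho> (lookup (\<theta> (x i j)) \<rho>)) \<and>
      counit kG (\<theta> (x i j)) = (if i = j then 1 else 0))"
    (is "?L \<longleftrightarrow> ?A \<and> ?R")
proof -
  let ?m = "tensor_map group_alg group_alg \<theta> \<theta>"
  have Bs: "k_space (group_alg :: ('k, 'g \<Rightarrow>\<^sub>0 'k) module)"
    using k_algebra_group_alg by (rule k_algebra.axioms)
  have tmeq: "tensor_map kG kG = (tensor_map group_alg group_alg :: _ \<Rightarrow> _ \<Rightarrow>
      ('k pair_poly set \<times> 'k pair_poly set \<Rightarrow>\<^sub>0 'k) set \<Rightarrow> (('g \<Rightarrow>\<^sub>0 'k) \<times> ('g \<Rightarrow>\<^sub>0 'k) \<Rightarrow>\<^sub>0 'k) set)"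
    by (simp add: fun_eq_iff tensor_map_def tensor_kG[OF refl])
  have L: "?L \<longleftrightarrow> ?A \<and> (\<forall>h\<in>carrier H. ?m (comultH h) = comult kG (\<theta> h) \<and>
      counit kG (\<theta> h) = counitH h)"
    unfolding bialg_hom_def alg_hom_kG alg_hom_Hb tmeq by simp
  have "?R \<longleftrightarrow> (\<forall>h\<in>carrier H. ?m (comultH h) = comult kG (\<theta> h) \<and>
      counit kG (\<theta> h) = counitH h)" (is "_ \<longleftrightarrow> ?Q") if \<theta>: ?A
  proof
    assume q: ?Q
    show ?R
    proof (intro ballI conjI allI)
      fix i j :: nat and \<rho> :: 'g assume ij: "i \<in> {1..n}" "j \<in> {1..n}"
      show "(\<Sum>s=1..n. pm_scale (lookup (\<theta> (x s j)) \<rho>) (\<theta> (x i s))) =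
          single \<rho> (lookup (\<theta> (x i j)) \<rho>)"
        unfolding tensor_map_comult_gen[OF alg_hom_linear[OF \<theta>] ij, symmetric] coef_comult_kG[symmetric]
        using q univ_gen_closed[OF ij] by (simp only:)
      show "counit kG (\<theta> (x i j)) = (if i = j then 1 else 0)"
        using q univ_gen_closed[OF ij] counit_gen[OF ij] by (simp only:)
    qed
  next
    assume r: ?R
    interpret BB: k_tensor_alg "group_alg :: ('k, 'g \<Rightarrow>\<^sub>0 'k) module"
      "group_alg :: ('k, 'g \<Rightarrow>\<^sub>0 'k) module" by (rule k_tensor_alg_group_alg)
    have TM: "restrict (?m) (carrier (tensor H H)) \<in>
        alg_hom (tensor H H) (tensor group_alg group_alg)"
      by (intro tensor_map_alg_hom[OF \<theta> \<theta>] k_algebra_univ k_algebra_group_alg)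
    \<comment> \<open>The two sides of the comultiplication condition, restricted so as to lie in
      \<open>alg_hom\<close>; equality of these functions is then decided on the generators and
      returns the condition on the whole carrier.\<close>
    define f where "f = (\<lambda>h\<in>carrier H. restrict (?m) (carrier (tensor H H)) (comultH h))"
    define g where "g = (\<lambda>h\<in>carrier H. comult kG (\<theta> h))"
    have f: "f \<in> alg_hom H (tensor group_alg group_alg)" unfolding f_def
      by (rule alg_hom_compose[OF k_algebra_univ comult_alg_hom TM])
    have g: "g \<in> alg_hom H (tensor group_alg group_alg)" unfolding g_def
      by (rule alg_hom_compose[OF k_algebra_univ \<theta> comult_kG_alg_hom])
    have "f = g"
    proof (rule univ_hom_unique[OF BB.k_algebra_tensor f g])
      fix i j assume ij: "i \<in> {1..n}" "j \<in> {1..n}"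
      note gc = univ_gen_closed[OF ij]
      have fe: "f (x i j) = ?m (comultH (x i j))"
        using gc alg_hom_closed[OF comult_alg_hom gc] by (simp add: f_def)
      have ge: "g (x i j) = comult kG (\<theta> (x i j))" using gc by (simp add: g_def)
      show "f (x i j) = g (x i j)"
      proof (rule tensor_group_alg_eqI[OF Bs alg_hom_closed[OF f gc] alg_hom_closed[OF g gc]])
        fix \<rho> show "coef group_alg \<rho> (f (x i j)) = coef group_alg \<rho> (g (x i j))"
          unfolding fe ge tensor_map_comult_gen[OF alg_hom_linear[OF \<theta>] ij] coef_comult_kG using r ij by blast
      qed
    qed
    moreover have "(\<lambda>h\<in>carrier H. counit kG (\<theta> h)) = counitH"
      by (rule univ_hom_unique[OF k_algebra_field alg_hom_compose[OF k_algebra_univ \<theta> counit_kG_alg_hom] counit_alg_hom])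
        (use r in \<open>simp add: univ_gen_closed counit_gen del: kG_simps\<close>)
    ultimately show ?Q
      using alg_hom_closed[OF comult_alg_hom]
      by (auto simp: f_def g_def fun_eq_iff restrict_def simp del: kG_simps split: if_splits)
  qed
  then show ?thesis using L by blast
qed

end


section \<open>Coactions in coordinates\<close>

locale poisson_basis = poisson_algebra scale pmult bracket + univ_algebra n \<tau> \<mu>
  for scale :: "'k::field \<Rightarrow> 'p::ab_group_add \<Rightarrow> 'p"
    and pmult bracket :: "'p \<Rightarrow> 'p \<Rightarrow> 'p"
    and n :: nat and \<tau> \<mu> :: "nat \<Rightarrow> nat \<Rightarrow> nat \<Rightarrow> 'k" +
  fixes e :: "nat \<Rightarrow> 'p"
  assumes basis: "basis_family scale n e"
    and pmult_basis: "\<And>i j. i \<in> {1..n} \<Longrightarrow> j \<in> {1..n} \<Longrightarrow>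
      pmult (e i) (e j) = (\<Sum>s=1..n. scale (\<tau> i j s) (e s))"
    and bracket_basis: "\<And>i j. i \<in> {1..n} \<Longrightarrow> j \<in> {1..n} \<Longrightarrow>
      bracket (e i) (e j) = (\<Sum>s=1..n. scale (\<mu> i j s) (e s))"
begin

definition crd :: "'p \<Rightarrow> nat \<Rightarrow> 'k" where
  "crd v i = representation (e ` {1..n}) v (e i)"

lemma basis_facts: "inj_on e {1..n}" "independent (e ` {1..n})" "v \<in> span (e ` {1..n})"
  using basis by (simp_all add: basis_family_def)

lemma crd_expand: "(\<Sum>i=1..n. scale (crd v i) (e i)) = v"
  using sum_representation_eq[OF basis_facts(2,3), of "e ` {1..n}" v]
  by (simp add: sum.reindex[OF basis_facts(1)] crd_def)

lemma crd_add: "crd (v + w) i = crd v i + crd w i"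
  by (simp add: crd_def representation_add[OF basis_facts(2,3,3)])

lemma crd_scale: "crd (scale c v) i = c * crd v i"
  by (simp add: crd_def representation_scale[OF basis_facts(2,3)])

lemma crd_zero [simp]: "crd 0 i = 0"
  using crd_scale[of 0 0 i] by simp

lemma crd_sum: "crd (\<Sum>k\<in>K. f k) i = (\<Sum>k\<in>K. crd (f k) i)"
  by (induction K rule: infinite_finite_induct) (simp_all add: crd_add)

lemma crd_basis: "i \<in> {1..n} \<Longrightarrow> j \<in> {1..n} \<Longrightarrow> crd (e i) j = (if i = j then 1 else 0)"
  using inj_onD[OF basis_facts(1)]
  by (auto simp: crd_def representation_basis[OF basis_facts(2)])

lemma crd_comb: "a \<in> {1..n} \<Longrightarrow> crd (\<Sum>i=1..n. scale (c i) (e i)) a = c a"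
  by (simp add: crd_sum crd_scale crd_basis if_distrib[of "\<lambda>y. _ * y"] cong: if_cong)

lemma crd_eqI: "(\<And>a. a \<in> {1..n} \<Longrightarrow> crd v a = crd w a) \<Longrightarrow> v = w"
  by (subst (1 2) crd_expand[symmetric]) simp

text \<open>A common interface of product and bracket, so that every statement about
  multiplicativity is proved once.\<close>

definition bilinear_op :: "('p \<Rightarrow> 'p \<Rightarrow> 'p) \<Rightarrow> (nat \<Rightarrow> nat \<Rightarrow> nat \<Rightarrow> 'k) \<Rightarrow> bool" where
  "bilinear_op m \<nu> \<longleftrightarrow>
     (\<forall>v w z. m (v + w) z = m v z + m w z \<and> m z (v + w) = m z v + m z w) \<and>
     (\<forall>c v w. m (scale c v) w = scale c (m v w) \<and> m v (scale c w) = scale c (m v w)) \<and>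
     (\<forall>i\<in>{1..n}. \<forall>j\<in>{1..n}. m (e i) (e j) = (\<Sum>s=1..n. scale (\<nu> i j s) (e s)))"

lemma bilinear_op_pmult: "bilinear_op pmult \<tau>"
  unfolding bilinear_op_def using pmult_basis
  by (auto simp: pmult_add_left pmult_scale_left pmult_commute[of _ "_ + _"] pmult_commute[of _ "scale _ _"])
    (auto simp: pmult_commute)

lemma bilinear_op_bracket: "bilinear_op bracket \<mu>"
  unfolding bilinear_op_def using bracket_basis
  by (auto simp: bracket_add_left bracket_add_right bracket_scale_left bracket_scale_right)

context
  fixes m \<nu> assumes m: "bilinear_op m \<nu>"
begin

lemma op_add: "m (v + w) z = m v z + m w z" "m z (v + w) = m z v + m z w"
  and op_scale: "m (scale c v) w = scale c (m v w)" "m v (scale c w) = scale c (m v w)"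
  and op_basis: "i \<in> {1..n} \<Longrightarrow> j \<in> {1..n} \<Longrightarrow> m (e i) (e j) = (\<Sum>s=1..n. scale (\<nu> i j s) (e s))"
  using m by (auto simp: bilinear_op_def)

lemma op_zero: "m 0 z = 0" "m z 0 = 0"
  using op_scale(1)[of 0 0 z] op_scale(2)[of z 0 0] by simp_all

lemma op_sum: "m (\<Sum>k\<in>K. f k) z = (\<Sum>k\<in>K. m (f k) z)" "m z (\<Sum>k\<in>K. f k) = (\<Sum>k\<in>K. m z (f k))"
  by (induction K rule: infinite_finite_induct) (simp_all add: op_add op_zero)

lemma crd_op:
  assumes a: "a \<in> {1..n}"
  shows "crd (m v w) a = (\<Sum>i=1..n. \<Sum>j=1..n. crd v i * crd w j * \<nu> i j a)"
proof -
  have "m v w = m (\<Sum>i=1..n. scale (crd v i) (e i)) (\<Sum>j=1..n. scale (crd w j) (e j))"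
    by (simp add: crd_expand)
  also have "\<dots> = (\<Sum>i=1..n. \<Sum>j=1..n. scale (crd v i) (scale (crd w j) (m (e i) (e j))))"
    by (simp add: op_sum op_scale scale_sum_right) (subst sum.swap, simp add: mult.commute)
  finally have "crd (m v w) a = (\<Sum>i=1..n. \<Sum>j=1..n. crd v i * (crd w j * crd (m (e i) (e j)) a))"
    by (simp add: crd_sum crd_scale mult.assoc)
  also have "\<dots> = (\<Sum>i=1..n. \<Sum>j=1..n. crd v i * crd w j * \<nu> i j a)"
    using a by (intro sum.cong refl) (simp add: op_basis crd_comb mult.assoc)
  finally show ?thesis .
qed

end

text \<open>The \<open>e a\<close>-coordinate, an element of the algebra \<open>'r\<close>, of the
  image of \<open>v\<close> under e_i \<mapsto> \<Sum> e_a \<otimes> y_ai. The scalar action is a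
  parameter because both k itself and k[G] occur as the algebra.\<close>

definition coact :: "('k \<Rightarrow> 'r::comm_ring_1 \<Rightarrow> 'r) \<Rightarrow> (nat \<Rightarrow> nat \<Rightarrow> 'r) \<Rightarrow> 'p \<Rightarrow> nat \<Rightarrow> 'r" where
  "coact scl y v a = (\<Sum>i=1..n. scl (crd v i) (y a i))"

definition alg_scale :: "('k \<Rightarrow> 'r::comm_ring_1 \<Rightarrow> 'r) \<Rightarrow> bool" where
  "alg_scale scl \<longleftrightarrow> vector_space scl \<and> (\<forall>c u v. scl c u * v = scl c (u * v))"

lemma alg_scale_field: "alg_scale ((*) :: 'k \<Rightarrow> 'k \<Rightarrow> 'k)"
  by (auto simp: alg_scale_def vector_space_def algebra_simps)

lemma alg_scale_group: "alg_scale (pm_scale :: 'k \<Rightarrow> ('g::ab_group_add \<Rightarrow>\<^sub>0 'k) \<Rightarrow> _)"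
  by (auto simp: alg_scale_def pm.vector_space_axioms pm_scale_mult_left)

context
  fixes scl :: "'k \<Rightarrow> 'r::comm_ring_1 \<Rightarrow> 'r"
  assumes scl: "alg_scale scl"
begin

interpretation R: vector_space scl
  using scl by (simp add: alg_scale_def)

lemma scl_mult: "scl c u * scl d v = scl (c * d) (u * v)"
proof -
  have "scl c u * v = scl c (u * v)" for c u v using scl by (auto simp: alg_scale_def)
  then show ?thesis by (metis R.scale_scale mult.commute)
qed

lemma coact_add: "coact scl y (v + w) a = coact scl y v a + coact scl y w a"
  by (simp add: coact_def crd_add R.scale_left_distrib sum.distrib)

lemma coact_scale: "coact scl y (scale c v) a = scl c (coact scl y v a)"
  by (simp add: coact_def crd_scale R.scale_sum_right)

lemma coact_zero [simp]: "coact scl y 0 a = 0"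
  by (simp add: coact_def)

lemma coact_sum: "coact scl y (\<Sum>k\<in>K. f k) a = (\<Sum>k\<in>K. coact scl y (f k) a)"
  by (induction K rule: infinite_finite_induct) (simp_all add: coact_add)

lemma coact_basis: "i \<in> {1..n} \<Longrightarrow> coact scl y (e i) a = y a i"
  by (simp add: coact_def crd_basis if_distrib[of "\<lambda>c. scl c _"] cong: if_cong)

lemma coact_unique:
  assumes add: "\<And>v w. f (v + w) = f v + f w" and sc: "\<And>c v. f (scale c v) = scl c (f v)"
    and b: "\<And>i. i \<in> {1..n} \<Longrightarrow> f (e i) = y a i"
  shows "f v = coact scl y v a"
proof -
  have "f 0 = 0" using sc[of 0 0] by simp
  then have sum: "f (\<Sum>k\<in>K. g k) = (\<Sum>k\<in>K. f (g k))" for g :: "nat \<Rightarrow> 'p" and K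
    by (induction K rule: infinite_finite_induct) (simp_all add: add)
  have "f v = f (\<Sum>i=1..n. scale (crd v i) (e i))" by (simp add: crd_expand)
  also have "\<dots> = coact scl y v a" by (simp add: sum sc b coact_def)
  finally show ?thesis .
qed

text \<open>At basis vectors the right-hand condition is literally the left-hand one. Conversely the
  right-hand condition is bilinear in \<open>v\<close> and \<open>w\<close>, so expanding both in
  coordinates reduces it to basis vectors.\<close>

lemma coact_op_iff:
  assumes m: "bilinear_op m \<nu>"
  shows "(\<forall>a\<in>{1..n}. \<forall>i\<in>{1..n}. \<forall>j\<in>{1..n}.
      (\<Sum>u=1..n. scl (\<nu> i j u) (y a u)) = (\<Sum>s=1..n. \<Sum>t=1..n. scl (\<nu> s t a) (y s i * y t j))) \<longleftrightarrow>
    (\<forall>v w. \<forall>a\<in>{1..n}. coact scl y (m v w) a =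
      (\<Sum>s=1..n. \<Sum>t=1..n. scl (\<nu> s t a) (coact scl y v s * coact scl y w t)))"
    (is "?L \<longleftrightarrow> ?R")
proof
  assume r: ?R
  show ?L
  proof (intro ballI)
    fix a i j assume aij: "a \<in> {1..n}" "i \<in> {1..n}" "j \<in> {1..n}"
    have "(\<Sum>u=1..n. scl (\<nu> i j u) (y a u)) = coact scl y (m (e i) (e j)) a"
      using aij by (simp add: coact_def op_basis[OF m] crd_comb)
    also have "\<dots> = (\<Sum>s=1..n. \<Sum>t=1..n. scl (\<nu> s t a) (y s i * y t j))"
      using r aij by (simp add: coact_basis)
    finally show "(\<Sum>u=1..n. scl (\<nu> i j u) (y a u)) = (\<Sum>s=1..n. \<Sum>t=1..n. scl (\<nu> s t a) (y s i * y t j))" .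
  qed
next
  assume l: ?L
  show ?R
  proof (intro allI ballI)
    fix v w a assume a: "a \<in> {1..n}"
    let ?J = "{1..n} :: nat set"
    have "coact scl y (m v w) a = (\<Sum>u\<in>?J. \<Sum>i\<in>?J. \<Sum>j\<in>?J. scl (crd v i * crd w j) (scl (\<nu> i j u) (y a u)))"
      unfolding coact_def by (intro sum.cong refl) (simp add: crd_op[OF m] R.scale_sum_left)
    also have "\<dots> = (\<Sum>i\<in>?J. \<Sum>j\<in>?J. \<Sum>u\<in>?J. scl (crd v i * crd w j) (scl (\<nu> i j u) (y a u)))"
      by (subst sum.swap) (intro sum.cong refl sum.swap)
    also have "\<dots> = (\<Sum>i\<in>?J. \<Sum>j\<in>?J. scl (crd v i * crd w j) (\<Sum>s\<in>?J. \<Sum>t\<in>?J. scl (\<nu> s t a) (y s i * y t j)))"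
      using l a by (intro sum.cong refl) (simp add: R.scale_sum_right[symmetric] del: R.scale_scale)
    also have "\<dots> = (\<Sum>i\<in>?J. \<Sum>j\<in>?J. \<Sum>s\<in>?J. \<Sum>t\<in>?J. scl (crd v i * crd w j * \<nu> s t a) (y s i * y t j))"
      by (simp add: R.scale_sum_right)
    also have "\<dots> = (\<Sum>s\<in>?J. \<Sum>t\<in>?J. \<Sum>i\<in>?J. \<Sum>j\<in>?J. scl (crd v i * crd w j * \<nu> s t a) (y s i * y t j))"
    proof -
      \<comment> \<open>Moves the third index in front of the first two. It is used for
        \<open>s\<close>, and once more for \<open>t\<close> under the sum over
        \<open>s\<close>.\<close>
      have sw: "(\<Sum>i\<in>?J. \<Sum>j\<in>?J. \<Sum>s\<in>?J. h i j s) = (\<Sum>s\<in>?J. \<Sum>i\<in>?J. \<Sum>j\<in>?J. h i j s)"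
        for h :: "nat \<Rightarrow> nat \<Rightarrow> nat \<Rightarrow> 'r"
      proof -
        have "(\<Sum>i\<in>?J. \<Sum>j\<in>?J. \<Sum>s\<in>?J. h i j s) = (\<Sum>i\<in>?J. \<Sum>s\<in>?J. \<Sum>j\<in>?J. h i j s)"
          by (intro sum.cong refl sum.swap)
        also have "\<dots> = (\<Sum>s\<in>?J. \<Sum>i\<in>?J. \<Sum>j\<in>?J. h i j s)" by (rule sum.swap)
        finally show ?thesis .
      qed
      show ?thesis by (subst sw) (rule sum.cong[OF refl sw])
    qed
    also have "\<dots> = (\<Sum>s\<in>?J. \<Sum>t\<in>?J. scl (\<nu> s t a) (coact scl y v s * coact scl y w t))"
      by (intro sum.cong refl)
        (simp add: coact_def sum_product R.scale_sum_right scl_mult mult.commute)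
    finally show "coact scl y (m v w) a = (\<Sum>s\<in>?J. \<Sum>t\<in>?J. scl (\<nu> s t a) (coact scl y v s * coact scl y w t))" .
  qed
qed

end

abbreviation matrix_of :: "('k pair_poly set \<Rightarrow> 'r) \<Rightarrow> nat \<Rightarrow> nat \<Rightarrow> 'r" where
  "matrix_of f \<equiv> \<lambda>a i. f (x a i)"

abbreviation Theta :: "('k pair_poly set \<Rightarrow> ('g::ab_group_add \<Rightarrow>\<^sub>0 'k)) \<Rightarrow> 'p \<Rightarrow> nat \<Rightarrow> ('g \<Rightarrow>\<^sub>0 'k)" where
  "Theta \<theta> \<equiv> coact pm_scale (matrix_of \<theta>)"

lemma lookup_Theta: "lookup (Theta \<theta> v a) \<sigma> = (\<Sum>i=1..n. crd v i * lookup (\<theta> (x a i)) \<sigma>)"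
  by (simp add: coact_def lookup_sum)

lemma group_alg_satisfies_iff:
  assumes "bilinear_op m \<nu>"
  shows "satisfies group_alg n \<nu> y \<longleftrightarrow> (\<forall>v w. \<forall>a\<in>{1..n}. coact pm_scale y (m v w) a =
    (\<Sum>s=1..n. \<Sum>t=1..n. pm_scale (\<nu> s t a) (coact pm_scale y v s * coact pm_scale y w t)))"
  unfolding coact_op_iff[OF alg_scale_group assms, symmetric] satisfies_def by simp

lemma field_satisfies_iff:
  assumes "bilinear_op m \<nu>"
  shows "satisfies field_algebra n \<nu> y \<longleftrightarrow> (\<forall>v w. \<forall>a\<in>{1..n}. coact (*) y (m v w) a =
    (\<Sum>s=1..n. \<Sum>t=1..n. \<nu> s t a * (coact (*) y v s * coact (*) y w t)))"
  unfolding coact_op_iff[OF alg_scale_field assms, symmetric] satisfies_def by simp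

text \<open>The equation between tensors is tested by all coefficient maps. At \<rho> the left side
  gives the vector whose coordinates are the \<rho>-coefficients of \<open>Theta \<theta> v\<close>,
  the right side gives \<open>v\<close> for \<rho> = \<sigma> and 0 otherwise; comparing coordinates
  yields the formula.\<close>

lemma induced_grading_eq:
  fixes \<theta> :: "'k pair_poly set \<Rightarrow> ('g::ab_group_add \<Rightarrow>\<^sub>0 'k)"
  assumes \<theta>: "\<theta> \<in> k_linear H group_alg"
  shows "induced_grading scale n e \<tau> \<mu> \<theta> \<sigma> =
    {v. \<forall>a\<in>{1..n}. Theta \<theta> v a = single \<sigma> (crd v a)}"
proof -
  let ?V = "type_space scale"
  let ?K = "group_alg :: ('k, 'g \<Rightarrow>\<^sub>0 'k) module"
  let ?J = "{1..n} :: nat set"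
  have V: "k_space ?V" by (rule k_space_type[OF vector_space_axioms])
  interpret V: k_space ?V by (rule V)
  interpret VH: k_tensor ?V H by (intro k_tensor.intro V H.k_space_axioms)
  interpret VK: k_tensor ?V ?K by (rule k_tensor_group_alg[OF V])
  have K: "k_space ?K" using k_algebra_group_alg by (rule k_algebra.axioms)
  have id: "id \<in> k_linear ?V ?V" by (simp add: k_linear_def)
  note tm = tensor_map_linear[OF id \<theta> V H.k_space_axioms V K]
  have finsumV: "finsum ?V f L = sum f L" for f :: "nat \<Rightarrow> 'p" and L
    using V by (intro finsum_type) auto
  let ?m = "\<lambda>v. tensor_map ?V ?K id \<theta> (eta scale n e \<tau> \<mu> v)"
  let ?t = "\<lambda>v. tensor_elt ?V ?K v (group_elt \<sigma>)"
  let ?S = "\<lambda>v \<rho>. \<Sum>a\<in>?J. scale (lookup (Theta \<theta> v a) \<rho>) (e a)"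
  have l: "(\<lambda>X. coef ?V \<rho> (tensor_map ?V ?K id \<theta> X)) \<in> k_linear (tensor ?V H) ?V" for \<rho> :: 'g
    by (rule k_linear_compose[OF tm(1) coef_linear[OF V]])
  define inner where "inner i = (\<Oplus>\<^bsub>tensor ?V H\<^esub>s\<in>?J. tensor_elt ?V H (e s) (x s i))" for i
  have inner: "inner i \<in> carrier (tensor ?V H)" if "i \<in> ?J" for i
    unfolding inner_def using that by (intro VH.T.finsum_closed funcsetI VH.elt_closed univ_gen_closed) auto
  have eta: "eta scale n e \<tau> \<mu> v = (\<Oplus>\<^bsub>tensor ?V H\<^esub>i\<in>?J. crd v i \<odot>\<^bsub>tensor ?V H\<^esub> inner i)" for v
    by (simp add: eta_def Let_def crd_def inner_def)
  have eta_closed: "eta scale n e \<tau> \<mu> v \<in> carrier (tensor ?V H)" for v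
    unfolding eta by (intro VH.T.finsum_closed funcsetI VH.T.smult_closed inner)
  have ci: "coef ?V \<rho> (tensor_map ?V ?K id \<theta> (inner i)) =
      (\<Sum>s\<in>?J. scale (lookup (\<theta> (x s i)) \<rho>) (e s))" if i: "i \<in> ?J" for i and \<rho> :: 'g
  proof -
    have "coef ?V \<rho> (tensor_map ?V ?K id \<theta> (inner i)) =
        (\<Oplus>\<^bsub>?V\<^esub>s\<in>?J. coef ?V \<rho> (tensor_map ?V ?K id \<theta> (tensor_elt ?V H (e s) (x s i))))"
      unfolding inner_def using i
      by (intro k_linear_finsum[OF l VH.k_space_tensor V] funcsetI VH.elt_closed univ_gen_closed) auto
    then show ?thesis
      using i by (simp add: finsumV tm(2) univ_gen_closed coef_elt[OF V])
  qed
  have ce: "coef ?V \<rho> (?m v) =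
      ?S v \<rho>" for v and \<rho> :: 'g
  proof -
    have "coef ?V \<rho> (?m v) =
        (\<Oplus>\<^bsub>?V\<^esub>i\<in>?J. coef ?V \<rho> (tensor_map ?V ?K id \<theta> (crd v i \<odot>\<^bsub>tensor ?V H\<^esub> inner i)))"
      unfolding eta using inner
      by (intro k_linear_finsum[OF l VH.k_space_tensor V] funcsetI VH.T.smult_closed)
    also have "\<dots> = (\<Sum>i\<in>?J. scale (crd v i) (\<Sum>s\<in>?J. scale (lookup (\<theta> (x s i)) \<rho>) (e s)))"
      unfolding finsumV using k_linear_smult[OF l inner] by (intro sum.cong refl) (simp add: ci)
    also have "\<dots> = ?S v \<rho>"
      by (simp add: lookup_Theta scale_sum_right scale_sum_left) (rule sum.swap)
    finally show ?thesis .
  qed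
  have cx: "coef ?V \<rho> (?t v) = (if \<rho> = \<sigma> then v else 0)" for v \<rho>
    by (simp add: coef_elt[OF V] group_elt_def lookup_single when_def)
  have "?m v = ?t v \<longleftrightarrow>
      (\<forall>\<rho>. ?S v \<rho> = (if \<rho> = \<sigma> then v else 0))" for v
  proof
    assume "?m v = ?t v"
    then show "\<forall>\<rho>. ?S v \<rho> = (if \<rho> = \<sigma> then v else 0)"
      using ce[of _ v] cx[of _ v] by metis
  next
    assume *: "\<forall>\<rho>. ?S v \<rho> = (if \<rho> = \<sigma> then v else 0)"
    show "?m v = ?t v"
    proof (rule tensor_group_alg_eqI[OF V])
      show "?m v \<in> carrier (tensor ?V ?K)"
        by (rule k_linear_closed[OF tm(1) eta_closed])
      show "?t v \<in> carrier (tensor ?V ?K)" by (rule VK.elt_closed) auto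
      show "coef ?V \<rho> (?m v) = coef ?V \<rho> (?t v)" for \<rho>
        unfolding ce cx using * by blast
    qed
  qed
  also have "(\<forall>\<rho>. ?S v \<rho> = (if \<rho> = \<sigma> then v else 0)) \<longleftrightarrow>
      (\<forall>a\<in>?J. Theta \<theta> v a = single \<sigma> (crd v a))" for v
  proof -
    have "?S v \<rho> = (if \<rho> = \<sigma> then v else 0) \<longleftrightarrow>
        (\<forall>a\<in>?J. lookup (Theta \<theta> v a) \<rho> = lookup (single \<sigma> (crd v a)) \<rho>)" for \<rho>
    proof
      assume *: "?S v \<rho> = (if \<rho> = \<sigma> then v else 0)"
      show "\<forall>a\<in>?J. lookup (Theta \<theta> v a) \<rho> = lookup (single \<sigma> (crd v a)) \<rho>"
      proof
        fix a assume "a \<in> ?J"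
        then have "lookup (Theta \<theta> v a) \<rho> = crd (if \<rho> = \<sigma> then v else 0) a"
          unfolding *[symmetric] by (simp only: crd_comb)
        then show "lookup (Theta \<theta> v a) \<rho> = lookup (single \<sigma> (crd v a)) \<rho>"
          by (simp add: lookup_single when_def)
      qed
    next
      assume *: "\<forall>a\<in>?J. lookup (Theta \<theta> v a) \<rho> = lookup (single \<sigma> (crd v a)) \<rho>"
      show "?S v \<rho> = (if \<rho> = \<sigma> then v else 0)"
        by (rule crd_eqI) (use * in \<open>simp add: crd_comb lookup_single when_def\<close>)
    qed
    then show ?thesis unfolding poly_mapping_eq_iff fun_eq_iff by blast
  qed
  finally show ?thesis by (simp only: induced_grading_def)
qed

end


section \<open>Gradings and bialgebra homomorphisms\<close>

definition pmsum :: "('g \<Rightarrow>\<^sub>0 'p::comm_monoid_add) \<Rightarrow> 'p" where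
  "pmsum f = (\<Sum>\<sigma>\<in>keys f. lookup f \<sigma>)"

lemma pmsum_superset:
  "finite K \<Longrightarrow> keys f \<subseteq> K \<Longrightarrow> pmsum f = (\<Sum>\<sigma>\<in>K. lookup f \<sigma>)"
  unfolding pmsum_def by (intro sum.mono_neutral_left) (auto simp: in_keys_iff)

lemma pmsum_add: "pmsum (f + g) = pmsum f + pmsum g"
  using keys_add[of f g]
  by (subst (1 2 3) pmsum_superset[where K = "keys f \<union> keys g"])
    (auto simp: lookup_add sum.distrib)

lemma pmsum_single [simp]: "pmsum (single \<sigma> v) = v"
  by (subst pmsum_superset[where K = "{\<sigma>}"]) auto

lemma lookup_map_zero: "h 0 = 0 \<Longrightarrow> lookup (Poly_Mapping.map h f) \<sigma> = h (lookup f \<sigma>)"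
  by (simp add: Poly_Mapping.map.rep_eq when_def)

context poisson_basis
begin

abbreviation "Aut \<equiv> poisson_aut scale pmult bracket"
abbreviation "Gr \<equiv> gradings scale pmult bracket :: ('g::ab_group_add \<Rightarrow> 'p set) set"
abbreviation "grad \<equiv> induced_grading scale n e \<tau> \<mu>"

lemma gradings_iff:
  "D \<in> Gr \<longleftrightarrow> (\<forall>\<sigma>. subspace (D \<sigma>)) \<and>
     (\<forall>v. \<exists>!f. (\<forall>\<sigma>. lookup f \<sigma> \<in> D \<sigma>) \<and> v = pmsum f) \<and>
     (\<forall>\<sigma> \<rho>. \<forall>v\<in>D \<sigma>. \<forall>w\<in>D \<rho>. pmult v w \<in> D (\<sigma> + \<rho>)) \<and>
     (\<forall>\<sigma> \<rho>. \<forall>v\<in>D \<sigma>. \<forall>w\<in>D \<rho>. bracket v w \<in> D (\<sigma> + \<rho>))"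
  by (simp add: gradings_def pmsum_def)

lemma pmsum_map_scale: "pmsum (Poly_Mapping.map (scale c) f) = scale c (pmsum f)"
proof -
  have "keys (Poly_Mapping.map (scale c) f) \<subseteq> keys f"
    by (auto simp: in_keys_iff lookup_map_zero)
  then show ?thesis
    by (subst (1 2) pmsum_superset[where K = "keys f"])
      (auto simp: lookup_map_zero scale_sum_right)
qed

section \<open>From bialgebra homomorphisms to gradings\<close>

context
  fixes \<theta> :: "'k pair_poly set \<Rightarrow> ('g::ab_group_add \<Rightarrow>\<^sub>0 'k)"
  assumes \<theta>: "\<theta> \<in> bialg_hom Hb kG"
begin

lemma bialg_alg_hom: "\<theta> \<in> alg_hom H group_alg"
  using \<theta> by (simp add: bialg_hom_iff)

lemma bialg_comult:
  "a \<in> {1..n} \<Longrightarrow> i \<in> {1..n} \<Longrightarrow>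
    (\<Sum>s=1..n. pm_scale (lookup (\<theta> (x s i)) \<rho>) (\<theta> (x a s))) =
      single \<rho> (lookup (\<theta> (x a i)) \<rho>)"
  using \<theta> unfolding bialg_hom_iff by blast

lemma bialg_counit:
  "a \<in> {1..n} \<Longrightarrow> i \<in> {1..n} \<Longrightarrow> counit kG (\<theta> (x a i)) = (if a = i then 1 else 0)"
  using \<theta> unfolding bialg_hom_iff by blast

lemma grad_eq: "grad \<theta> \<sigma> = {v. \<forall>a\<in>{1..n}. Theta \<theta> v a = single \<sigma> (crd v a)}"
  by (rule induced_grading_eq[OF alg_hom_linear[OF bialg_alg_hom]])

lemma Theta_op:
  assumes "bilinear_op m \<nu>" "a \<in> {1..n}" "satisfies group_alg n \<nu> (matrix_of \<theta>)"
  shows "Theta \<theta> (m v w) a = (\<Sum>s=1..n. \<Sum>t=1..n. pm_scale (\<nu> s t a) (Theta \<theta> v s * Theta \<theta> w t))"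
  using assms group_alg_satisfies_iff by blast

text \<open>The coordinates of the two coactions are multiples of \<sigma> and \<rho>, and these
  multiply in k[G] to multiples of \<sigma> + \<rho>.\<close>

lemma grad_op:
  assumes m: "bilinear_op m \<nu>" and sat: "satisfies group_alg n \<nu> (matrix_of \<theta>)"
    and v: "v \<in> grad \<theta> \<sigma>" and w: "w \<in> grad \<theta> \<rho>"
  shows "m v w \<in> grad \<theta> (\<sigma> + \<rho>)"
  unfolding grad_eq mem_Collect_eq
proof
  fix a assume a: "a \<in> {1..n}"
  have "Theta \<theta> (m v w) a = (\<Sum>s=1..n. \<Sum>t=1..n. pm_scale (\<nu> s t a) (Theta \<theta> v s * Theta \<theta> w t))"
    by (rule Theta_op[OF m a sat])
  also have "\<dots> = (\<Sum>s=1..n. \<Sum>t=1..n. single (\<sigma> + \<rho>) (crd v s * crd w t * \<nu> s t a))"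
    using v w by (intro sum.cong refl) (simp add: grad_eq mult_single mult.commute[of "\<nu> _ _ _"])
  also have "\<dots> = single (\<sigma> + \<rho>) (crd (m v w) a)"
    unfolding crd_op[OF m a]
    by (rule poly_mapping_eqI) (simp add: lookup_sum lookup_single when_def)
  finally show "Theta \<theta> (m v w) a = single (\<sigma> + \<rho>) (crd (m v w) a)" .
qed

text \<open>With A_\<sigma> the matrix of \<sigma>-coefficients of
  \<open>matrix_of \<theta>\<close>, the entry at \<sigma> is A_\<sigma> v. Building the family from
  the coordinates of \<open>Theta \<theta> v\<close> makes finite support automatic.\<close>

definition component :: "'p \<Rightarrow> 'g \<Rightarrow>\<^sub>0 'p" where
  "component v = (\<Sum>a=1..n. Poly_Mapping.map (\<lambda>c. scale c (e a)) (Theta \<theta> v a))"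

lemma lookup_component:
  "lookup (component v) \<sigma> = (\<Sum>a=1..n. scale (lookup (Theta \<theta> v a) \<sigma>) (e a))"
  by (simp add: component_def lookup_sum lookup_map_zero)

text \<open>The vector A_\<sigma> v is homogeneous of degree \<sigma>: a second coaction multiplies
  the matrices, and the orthogonality in \<open>bialg_comult\<close> removes all other
  degrees.\<close>

lemma Theta_component:
  assumes b: "b \<in> {1..n}"
  shows "Theta \<theta> (lookup (component v) \<sigma>) b = single \<sigma> (lookup (Theta \<theta> v b) \<sigma>)"
proof -
  have "Theta \<theta> (lookup (component v) \<sigma>) b =
      (\<Sum>a=1..n. pm_scale (lookup (Theta \<theta> v a) \<sigma>) (\<theta> (x b a)))"
    by (simp add: lookup_component coact_sum[OF alg_scale_group] coact_scale[OF alg_scale_group]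
        coact_basis[OF alg_scale_group])
  also have "\<dots> = (\<Sum>i=1..n. pm_scale (crd v i) (\<Sum>a=1..n. pm_scale (lookup (\<theta> (x a i)) \<sigma>) (\<theta> (x b a))))"
    by (simp add: lookup_Theta pm.scale_sum_left pm.scale_sum_right) (rule sum.swap)
  also have "\<dots> = (\<Sum>i=1..n. pm_scale (crd v i) (single \<sigma> (lookup (\<theta> (x b i)) \<sigma>)))"
    using b by (intro sum.cong refl) (simp add: bialg_comult)
  also have "\<dots> = single \<sigma> (lookup (Theta \<theta> v b) \<sigma>)"
    unfolding lookup_Theta by (rule poly_mapping_eqI) (simp add: lookup_sum lookup_single when_def)
  finally show ?thesis .
qed

text \<open>The counit adds up the coefficients, so this is the identity \<Sum> A_\<sigma> = 1
  applied to \<open>v\<close>.\<close>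

lemma counit_Theta:
  assumes a: "a \<in> {1..n}"
  shows "counit kG (Theta \<theta> v a) = crd v a"
proof -
  have "counit kG (Theta \<theta> v a) = (\<Sum>i=1..n. crd v i * counit kG (\<theta> (x a i)))"
    by (simp add: coact_def counit_kG_sum counit_kG_linear del: kG_simps)
  also have "\<dots> = (\<Sum>i=1..n. crd v i * (if a = i then 1 else 0))"
    using a by (intro sum.cong refl) (simp add: bialg_counit del: kG_simps)
  also have "\<dots> = crd v a" using a by (simp add: if_distrib[of "\<lambda>y. _ * y"] cong: if_cong)
  finally show ?thesis .
qed

lemma pmsum_component: "pmsum (component v) = v"
proof -
  \<comment> \<open>One finite set of degrees that supports all coordinates at once, so that the
    sums over degrees and over the basis can be interchanged.\<close>
  define K where "K = (\<Union>a\<in>{1..n}. keys (Theta \<theta> v a))"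
  have K: "finite K" "a \<in> {1..n} \<Longrightarrow> keys (Theta \<theta> v a) \<subseteq> K" for a
    by (auto simp: K_def)
  have "keys (component v) \<subseteq> K"
  proof
    fix \<sigma> assume "\<sigma> \<in> keys (component v)"
    then have "(\<Sum>a=1..n. scale (lookup (Theta \<theta> v a) \<sigma>) (e a)) \<noteq> 0"
      by (simp add: in_keys_iff lookup_component)
    then obtain a where "a \<in> {1..n}" "scale (lookup (Theta \<theta> v a) \<sigma>) (e a) \<noteq> 0"
      using sum.not_neutral_contains_not_neutral by blast
    then show "\<sigma> \<in> K" by (auto simp: K_def in_keys_iff)
  qed
  then have "pmsum (component v) = (\<Sum>\<sigma>\<in>K. \<Sum>a=1..n. scale (lookup (Theta \<theta> v a) \<sigma>) (e a))"
    by (simp add: pmsum_superset[OF K(1)] lookup_component)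
  also have "\<dots> = (\<Sum>a=1..n. scale (\<Sum>\<sigma>\<in>K. lookup (Theta \<theta> v a) \<sigma>) (e a))"
    by (simp add: scale_sum_left) (rule sum.swap)
  also have "\<dots> = (\<Sum>a=1..n. scale (crd v a) (e a))"
    by (intro sum.cong refl) (simp only: counit_kG_superset[OF K, symmetric] counit_Theta)
  finally show ?thesis by (simp only: crd_expand)
qed

text \<open>The coaction sends a vector of degree \<sigma> to a multiple of \<sigma>, so the
  coefficient at \<rho> of the coaction on \<open>v\<close> sees only the summand of degree \<rho>
  and recovers it.\<close>

lemma component_unique:
  assumes f: "\<And>\<sigma>. lookup f \<sigma> \<in> grad \<theta> \<sigma>" and v: "v = pmsum f"
  shows "f = component v"
proof (rule poly_mapping_eqI, rule crd_eqI)
  fix \<rho> a assume a: "a \<in> {1..n}"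
  have "Theta \<theta> v a = (\<Sum>\<sigma>\<in>keys f. Theta \<theta> (lookup f \<sigma>) a)"
    by (simp add: v pmsum_def coact_sum[OF alg_scale_group])
  also have "\<dots> = (\<Sum>\<sigma>\<in>keys f. single \<sigma> (crd (lookup f \<sigma>) a))"
    using f a by (intro sum.cong refl) (simp add: grad_eq)
  finally have "lookup (Theta \<theta> v a) \<rho> = crd (lookup f \<rho>) a"
    by (auto simp: lookup_sum lookup_single when_def in_keys_iff)
  then show "crd (lookup f \<rho>) a = crd (lookup (component v) \<rho>) a"
    using a by (simp add: lookup_component crd_comb)
qed

lemma grad_in_gradings: "grad \<theta> \<in> Gr"
  unfolding gradings_iff
proof (intro conjI allI ballI)
  show "subspace (grad \<theta> \<sigma>)" for \<sigma>
    by (auto simp: subspace_def grad_eq coact_add[OF alg_scale_group] coact_scale[OF alg_scale_group]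
        coact_zero[OF alg_scale_group] crd_add crd_scale single_add)
  show "\<exists>!f. (\<forall>\<sigma>. lookup f \<sigma> \<in> grad \<theta> \<sigma>) \<and> v = pmsum f" for v
  proof (rule ex1I)
    show "(\<forall>\<sigma>. lookup (component v) \<sigma> \<in> grad \<theta> \<sigma>) \<and> v = pmsum (component v)"
      by (simp add: pmsum_component grad_eq Theta_component) (simp add: lookup_component crd_comb)
    show "f = component v" if "(\<forall>\<sigma>. lookup f \<sigma> \<in> grad \<theta> \<sigma>) \<and> v = pmsum f" for f
      using that component_unique by blast
  qed
  note sat = hom_satisfies[OF k_algebra_group_alg bialg_alg_hom]
  fix \<sigma> \<rho> v w assume "v \<in> grad \<theta> \<sigma>" "w \<in> grad \<theta> \<rho>"
  note vw = this
  show "pmult v w \<in> grad \<theta> (\<sigma> + \<rho>)" by (rule grad_op[OF bilinear_op_pmult sat(1) vw])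
  show "bracket v w \<in> grad \<theta> (\<sigma> + \<rho>)" by (rule grad_op[OF bilinear_op_bracket sat(2) vw])
qed

end

section \<open>From gradings to bialgebra homomorphisms\<close>

context
  fixes D :: "'g::ab_group_add \<Rightarrow> 'p set"
  assumes D: "D \<in> Gr"
begin

definition dec :: "'p \<Rightarrow> 'g \<Rightarrow>\<^sub>0 'p" where
  "dec v = (THE f. (\<forall>\<sigma>. lookup f \<sigma> \<in> D \<sigma>) \<and> v = pmsum f)"

lemma dec_ex1: "\<exists>!f. (\<forall>\<sigma>. lookup f \<sigma> \<in> D \<sigma>) \<and> v = pmsum f"
  using D unfolding gradings_iff by blast

lemma dec_in: "lookup (dec v) \<sigma> \<in> D \<sigma>" and pmsum_dec: "pmsum (dec v) = v"
  using theI'[OF dec_ex1[of v]] unfolding dec_def[symmetric] by auto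

lemma dec_eqI: "(\<And>\<sigma>. lookup f \<sigma> \<in> D \<sigma>) \<Longrightarrow> v = pmsum f \<Longrightarrow> dec v = f"
  using dec_ex1[of v] dec_in[of v] pmsum_dec[of v] by metis

lemma D_subspace: "subspace (D \<sigma>)"
  using D by (simp add: gradings_iff)

lemma dec_add: "dec (v + w) = dec v + dec w"
  by (rule dec_eqI) (simp_all add: lookup_add subspace_add[OF D_subspace] dec_in pmsum_add pmsum_dec)

lemma dec_scale: "dec (scale c v) = Poly_Mapping.map (scale c) (dec v)"
  by (rule dec_eqI) (simp_all add: lookup_map_zero subspace_scale[OF D_subspace] dec_in pmsum_map_scale pmsum_dec)

lemma dec_homogeneous: "v \<in> D \<sigma> \<Longrightarrow> dec v = single \<sigma> v"
  by (rule dec_eqI) (auto simp: lookup_single when_def subspace_0[OF D_subspace])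

text \<open>Zero is homogeneous, and every vector is a finite sum of its homogeneous components.
  Identities additive in \<open>v\<close> are therefore matters of homogeneous vectors only.\<close>

lemma graded_induct [case_names homogeneous add]:
  assumes "\<And>\<sigma> v. v \<in> D \<sigma> \<Longrightarrow> Q v" "\<And>v w. Q v \<Longrightarrow> Q w \<Longrightarrow> Q (v + w)"
  shows "Q v"
proof -
  have "Q 0" using assms(1)[of 0 0] subspace_0[OF D_subspace] by blast
  then have "Q (\<Sum>\<sigma>\<in>K. lookup (dec v) \<sigma>)" for K
    by (induction K rule: infinite_finite_induct) (simp_all add: assms(2) assms(1)[OF dec_in])
  then show ?thesis using pmsum_dec[of v] unfolding pmsum_def by metis
qed

text \<open>The coefficient at \<sigma> of the entry (a, i) is the \<open>a\<close>-coordinate of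
  the \<sigma>-component of \<open>e i\<close>: the \<sigma>-coefficients form the matrix of the
  projection onto \<open>D \<sigma>\<close>.\<close>

definition graded_matrix :: "nat \<Rightarrow> nat \<Rightarrow> 'g \<Rightarrow>\<^sub>0 'k" where
  "graded_matrix a i = Poly_Mapping.map (\<lambda>w. crd w a) (dec (e i))"

lemma coact_graded: "coact pm_scale graded_matrix v a = Poly_Mapping.map (\<lambda>w. crd w a) (dec v)"
proof (rule coact_unique[OF alg_scale_group, symmetric, of "\<lambda>v. Poly_Mapping.map (\<lambda>w. crd w a) (dec v)"])
  show "Poly_Mapping.map (\<lambda>w. crd w a) (dec (v + w)) =
      Poly_Mapping.map (\<lambda>w. crd w a) (dec v) + Poly_Mapping.map (\<lambda>w. crd w a) (dec w)" for v w
    by (rule poly_mapping_eqI) (simp add: dec_add lookup_map_zero lookup_add crd_add)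
  show "Poly_Mapping.map (\<lambda>w. crd w a) (dec (scale c v)) = pm_scale c (Poly_Mapping.map (\<lambda>w. crd w a) (dec v))" for c v
    by (rule poly_mapping_eqI) (simp add: dec_scale lookup_map_zero crd_scale)
qed (simp add: graded_matrix_def)

lemma coact_homogeneous: "v \<in> D \<sigma> \<Longrightarrow> coact pm_scale graded_matrix v a = single \<sigma> (crd v a)"
  unfolding coact_graded
  by (rule poly_mapping_eqI) (simp add: dec_homogeneous lookup_map_zero lookup_single when_def)

text \<open>For homogeneous arguments of degrees \<sigma> and \<rho> both sides are multiples of the
  group element of \<sigma> + \<rho>, with coefficient read from the structure constants; additivity
  in each argument does the rest.\<close>

lemma graded_satisfies:
  assumes m: "bilinear_op m \<nu>" and mD: "\<And>\<sigma> \<rho> v w. v \<in> D \<sigma> \<Longrightarrow> w \<in> D \<rho> \<Longrightarrow> m v w \<in> D (\<sigma> + \<rho>)"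
  shows "satisfies group_alg n \<nu> graded_matrix"
  unfolding group_alg_satisfies_iff[OF m]
proof (intro allI ballI)
  fix v w a assume a: "a \<in> {1..n}"
  let ?c = "coact pm_scale graded_matrix"
  note add = coact_add[OF alg_scale_group] op_add[OF m] distrib_left distrib_right
    pm.scale_right_distrib sum.distrib
  show "?c (m v w) a = (\<Sum>s=1..n. \<Sum>t=1..n. pm_scale (\<nu> s t a) (?c v s * ?c w t))"
  proof (induction v rule: graded_induct)
    case (homogeneous \<sigma> v)
    show ?case
    proof (induction w rule: graded_induct)
      case (homogeneous \<rho> w)
      have "?c (m v w) a = single (\<sigma> + \<rho>) (crd (m v w) a)"
        by (rule coact_homogeneous[OF mD[OF \<open>v \<in> D \<sigma>\<close> \<open>w \<in> D \<rho>\<close>]])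
      also have "\<dots> = (\<Sum>s=1..n. \<Sum>t=1..n. single (\<sigma> + \<rho>) (crd v s * crd w t * \<nu> s t a))"
        unfolding crd_op[OF m a]
        by (rule poly_mapping_eqI) (simp add: lookup_sum lookup_single when_def)
      also have "\<dots> = (\<Sum>s=1..n. \<Sum>t=1..n. pm_scale (\<nu> s t a) (?c v s * ?c w t))"
        by (simp add: coact_homogeneous[OF \<open>v \<in> D \<sigma>\<close>] coact_homogeneous[OF \<open>w \<in> D \<rho>\<close>] mult_single
            mult.commute[of "\<nu> _ _ _"])
      finally show ?case .
    qed (simp add: add)
  qed (simp add: add)
qed

lemma grad_surj: "\<exists>\<theta>\<in>bialg_hom Hb kG. grad \<theta> = D"
proof -
  have sat: "satisfies group_alg n \<tau> graded_matrix" "satisfies group_alg n \<mu> graded_matrix"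
    using D by (auto intro!: graded_satisfies bilinear_op_pmult bilinear_op_bracket simp: gradings_iff)
  obtain \<theta> where \<theta>: "\<theta> \<in> alg_hom H (group_alg :: ('k, 'g \<Rightarrow>\<^sub>0 'k) module)"
    and gen: "\<And>s i. s \<in> {1..n} \<Longrightarrow> i \<in> {1..n} \<Longrightarrow> \<theta> (x s i) = graded_matrix s i"
    by (rule univ_hom_exists[OF k_algebra_group_alg _ sat]) auto
  have Th: "Theta \<theta> v a = coact pm_scale graded_matrix v a" if "a \<in> {1..n}" for v a
    unfolding coact_def using that by (intro sum.cong refl) (simp add: gen)
  have comult: "(\<Sum>s=1..n. pm_scale (lookup (\<theta> (x s j)) \<rho>) (\<theta> (x i s))) =
      single \<rho> (lookup (\<theta> (x i j)) \<rho>)"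
    if ij: "i \<in> {1..n}" "j \<in> {1..n}" for i j \<rho>
  proof -
    \<comment> \<open>The \<rho>-coefficients of column \<open>j\<close> are the coordinates of the
      \<rho>-component of \<open>e j\<close>, so the sum is the coaction on a vector of degree
      \<rho>, which is a multiple of \<rho>.\<close>
    have "(\<Sum>s=1..n. pm_scale (lookup (\<theta> (x s j)) \<rho>) (\<theta> (x i s))) =
        coact pm_scale graded_matrix (lookup (dec (e j)) \<rho>) i"
      unfolding coact_def using ij
      by (intro sum.cong refl) (simp add: gen graded_matrix_def[of _ j] lookup_map_zero)
    also have "\<dots> = single \<rho> (lookup (\<theta> (x i j)) \<rho>)"
      using ij by (simp add: coact_homogeneous[OF dec_in] gen graded_matrix_def lookup_map_zero)
    finally show ?thesis .
  qed
  \<comment> \<open>Both sides are additive in \<open>v\<close>, and for homogeneous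
    \<open>v\<close> the counit of a single term is its coefficient.\<close>
  have "counit kG (coact pm_scale graded_matrix v a) = crd v a" for v a
    by (induction v rule: graded_induct)
      (simp_all add: coact_homogeneous coact_add[OF alg_scale_group] crd_add counit_kG_linear del: kG_simps)
  then have counit: "counit kG (\<theta> (x i j)) = (if i = j then 1 else 0)"
    if "i \<in> {1..n}" "j \<in> {1..n}" for i j
    using that coact_basis[OF alg_scale_group, of j graded_matrix i]
    by (metis gen crd_basis)
  have bi: "\<theta> \<in> bialg_hom Hb kG"
    unfolding bialg_hom_iff using \<theta> comult counit by blast
  have "grad \<theta> \<sigma> = D \<sigma>" for \<sigma>
  proof (rule Set.set_eqI)
    fix v
    have "v \<in> grad \<theta> \<sigma> \<longleftrightarrow> (\<forall>a\<in>{1..n}. coact pm_scale graded_matrix v a = single \<sigma> (crd v a))"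
      by (simp add: grad_eq[OF bi] Th)
    also have "\<dots> \<longleftrightarrow> v \<in> D \<sigma>"
    proof
      assume *: "\<forall>a\<in>{1..n}. coact pm_scale graded_matrix v a = single \<sigma> (crd v a)"
      \<comment> \<open>If the coaction on \<open>v\<close> is concentrated in degree \<sigma>, then
        \<open>v\<close> and its \<sigma>-component have the same coordinates.\<close>
      have "lookup (dec v) \<sigma> = v"
      proof (rule crd_eqI)
        fix a assume "a \<in> {1..n}"
        then have "Poly_Mapping.map (\<lambda>w. crd w a) (dec v) = single \<sigma> (crd v a)"
          using * by (simp add: coact_graded)
        then have "lookup (Poly_Mapping.map (\<lambda>w. crd w a) (dec v)) \<sigma> = crd v a" by simp
        then show "crd (lookup (dec v) \<sigma>) a = crd v a" by (simp add: lookup_map_zero)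
      qed
      then show "v \<in> D \<sigma>" using dec_in[of v \<sigma>] by simp
    qed (simp add: coact_homogeneous)
    finally show "v \<in> grad \<theta> \<sigma> \<longleftrightarrow> v \<in> D \<sigma>" .
  qed
  then show ?thesis using bi by blast
qed

end

end


section \<open>Automorphisms and conjugation\<close>

context poisson_basis
begin

text \<open>The endomorphism of P with matrix g(x_ai), that is, (Id \<otimes> g) \<circ> \<eta>
  after identifying P \<otimes> k with P.\<close>

definition wmap :: "('k pair_poly set \<Rightarrow> 'k) \<Rightarrow> 'p \<Rightarrow> 'p" where
  "wmap g v = (\<Sum>a=1..n. scale (coact (*) (matrix_of g) v a) (e a))"

lemma crd_wmap: "a \<in> {1..n} \<Longrightarrow> crd (wmap g v) a = coact (*) (matrix_of g) v a"
  by (simp add: wmap_def crd_comb)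

lemma wmap_add: "wmap g (v + w) = wmap g v + wmap g w"
  by (simp add: wmap_def coact_add[OF alg_scale_field] scale_left_distrib sum.distrib)

lemma wmap_scale: "wmap g (scale c v) = scale c (wmap g v)"
  by (simp add: wmap_def coact_scale[OF alg_scale_field] scale_sum_right)

lemma wmap_linear: "Vector_Spaces.linear scale scale (wmap g)"
  by (simp add: Vector_Spaces.linear_iff vector_space_axioms wmap_add wmap_scale)

lemma wmap_op:
  assumes m: "bilinear_op m \<nu>" and sat: "satisfies field_algebra n \<nu> (matrix_of g)"
  shows "wmap g (m v w) = m (wmap g v) (wmap g w)"
proof (rule crd_eqI)
  fix a assume a: "a \<in> {1..n}"
  have "crd (wmap g (m v w)) a = (\<Sum>s=1..n. \<Sum>t=1..n. \<nu> s t a * (crd (wmap g v) s * crd (wmap g w) t))"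
    using sat a unfolding field_satisfies_iff[OF m] by (simp add: crd_wmap)
  also have "\<dots> = crd (m (wmap g v) (wmap g w)) a"
    unfolding crd_op[OF m a] by (simp add: mult_ac)
  finally show "crd (wmap g (m v w)) a = crd (m (wmap g v) (wmap g w)) a" .
qed

lemma wmap_hom:
  assumes "g \<in> alg_hom H field_algebra"
  shows "wmap g (pmult v w) = pmult (wmap g v) (wmap g w)"
    and "wmap g (bracket v w) = bracket (wmap g v) (wmap g w)"
  using hom_satisfies[OF k_algebra_field assms]
  by (auto intro: wmap_op bilinear_op_pmult bilinear_op_bracket)

text \<open>As \<open>w\<close> preserves both operations, the coordinates of the vectors
  \<open>w (e i)\<close> solve the defining relations in k, and the universal property supplies
  \<open>g\<close>.\<close>

lemma wmap_surj:
  assumes lin: "Vector_Spaces.linear scale scale w"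
    and m: "\<And>u v. w (pmult u v) = pmult (w u) (w v)" and b: "\<And>u v. w (bracket u v) = bracket (w u) (w v)"
  obtains g where "g \<in> alg_hom H field_algebra" "wmap g = w"
proof -
  let ?c = "\<lambda>a i. crd (w (e i)) a"
  have c: "coact (*) ?c v a = crd (w v) a" for v a
    using lin by (intro coact_unique[OF alg_scale_field, symmetric, of "\<lambda>v. crd (w v) a"])
      (simp_all add: Vector_Spaces.linear_iff crd_add crd_scale)
  have "satisfies field_algebra n \<nu> ?c" if op: "bilinear_op m \<nu>" and mw: "\<And>u v. w (m u v) = m (w u) (w v)" for m \<nu>
    unfolding field_satisfies_iff[OF op] by (auto simp: c mw crd_op[OF op] mult_ac)
  then have sat: "satisfies field_algebra n \<tau> ?c" "satisfies field_algebra n \<mu> ?c"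
    using bilinear_op_pmult bilinear_op_bracket m b by blast+
  obtain g where g: "g \<in> alg_hom H (field_algebra :: ('k, 'k) module)"
    and gen: "\<And>s i. s \<in> {1..n} \<Longrightarrow> i \<in> {1..n} \<Longrightarrow> g (x s i) = ?c s i"
    by (rule univ_hom_exists[OF k_algebra_field _ sat]) auto
  have "wmap g v = w v" for v
  proof (rule crd_eqI)
    fix a assume a: "a \<in> {1..n}"
    then have "crd (wmap g v) a = coact (*) ?c v a"
      unfolding crd_wmap[OF a] coact_def by (intro sum.cong refl) (simp add: gen)
    then show "crd (wmap g v) a = crd (w v) a" by (simp add: c)
  qed
  then show ?thesis using g that by blast
qed

lemma wmap_inj:
  assumes g: "g \<in> alg_hom H field_algebra" and h: "h \<in> alg_hom H field_algebra" and eq: "wmap g = wmap h"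
  shows "g = h"
proof (rule univ_hom_unique[OF k_algebra_field g h])
  fix s i assume "s \<in> {1..n}" "i \<in> {1..n}"
  then show "g (x s i) = h (x s i)"
    using fun_cong[OF eq, of "e i", THEN arg_cong, of "\<lambda>v. crd v s"]
    by (simp add: crd_wmap coact_basis[OF alg_scale_field])
qed

text \<open>Both sides are the matrix product of the two matrices in this order, so convolution
  turns into composition without reversal.\<close>

lemma wmap_convolution:
  assumes g: "g \<in> alg_hom H field_algebra" and h: "h \<in> alg_hom H field_algebra"
  shows "wmap (convolution Hb field_algebra g h) v = wmap g (wmap h v)"
proof (rule crd_eqI)
  fix a assume a: "a \<in> {1..n}"
  have "crd (wmap (convolution Hb field_algebra g h) v) a =
      (\<Sum>i=1..n. crd v i * (\<Sum>s=1..n. g (x a s) * h (x s i)))"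
    unfolding crd_wmap[OF a] coact_def using a
    by (intro sum.cong refl) (simp add: convolution_gen[OF k_algebra_field alg_hom_linear[OF g] alg_hom_linear[OF h]])
  also have "\<dots> = (\<Sum>s=1..n. (\<Sum>i=1..n. crd v i * h (x s i)) * g (x a s))"
    by (simp add: sum_distrib_left sum_distrib_right mult_ac) (rule sum.swap)
  also have "\<dots> = crd (wmap g (wmap h v)) a"
    unfolding crd_wmap[OF a] coact_def[of _ _ "wmap h v"]
    by (intro sum.cong refl) (simp add: crd_wmap coact_def)
  finally show "crd (wmap (convolution Hb field_algebra g h) v) a = crd (wmap g (wmap h v)) a" .
qed

lemma wmap_counit: "wmap (counitH) v = v"
proof (rule crd_eqI)
  fix a assume a: "a \<in> {1..n}"
  have "crd (wmap (counitH) v) a = (\<Sum>i=1..n. crd v i * (if a = i then 1 else 0))"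
    unfolding crd_wmap[OF a] coact_def using a by (intro sum.cong refl) (simp add: counit_gen)
  also have "\<dots> = crd v a" using a by (simp add: if_distrib[of "\<lambda>y. _ * y"] cong: if_cong)
  finally show "crd (wmap (counitH) v) a = crd v a" .
qed

section \<open>Units of the group-like monoid and Poisson automorphisms\<close>

abbreviation "M \<equiv> group_like_monoid Hb"

lemma M_simps:
  "carrier M = alg_hom H field_algebra" "mult M = convolution Hb field_algebra" "one M = counitH"
  using alg_hom_ext[OF counit_alg_hom]
  by (simp_all add: group_like_monoid_def group_likes_eq extensional_restrict)

text \<open>The monoid laws are pulled back from composition of endomorphisms along the injective
  map \<open>wmap\<close>.\<close>

lemma monoid_M: "Group.monoid M"
proof (rule monoidI)
  note cl = convolution_alg_hom[OF k_algebra_field]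
  fix f g h assume "f \<in> carrier M" "g \<in> carrier M" "h \<in> carrier M"
  then show "f \<otimes>\<^bsub>M\<^esub> g \<otimes>\<^bsub>M\<^esub> h = f \<otimes>\<^bsub>M\<^esub> (g \<otimes>\<^bsub>M\<^esub> h)"
    unfolding M_simps by (intro wmap_inj cl ext) (simp_all add: wmap_convolution cl)
next
  fix f assume "f \<in> carrier M"
  then show "\<one>\<^bsub>M\<^esub> \<otimes>\<^bsub>M\<^esub> f = f" "f \<otimes>\<^bsub>M\<^esub> \<one>\<^bsub>M\<^esub> = f"
    unfolding M_simps
    by (rule_tac [!] wmap_inj)
      (simp_all add: fun_eq_iff wmap_convolution wmap_counit counit_alg_hom convolution_alg_hom[OF k_algebra_field])
qed (simp_all add: M_simps counit_alg_hom convolution_alg_hom[OF k_algebra_field])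

lemma Units_wmap:
  assumes g: "g \<in> Units M"
  shows "g \<in> alg_hom H field_algebra" "inv\<^bsub>M\<^esub> g \<in> alg_hom H field_algebra"
    and "convolution Hb field_algebra (inv\<^bsub>M\<^esub> g) g = counitH"
    and "wmap g (wmap (inv\<^bsub>M\<^esub> g) v) = v" "wmap (inv\<^bsub>M\<^esub> g) (wmap g v) = v"
    and "wmap g \<in> Aut"
proof -
  interpret M: Group.monoid M by (rule monoid_M)
  show cl: "g \<in> alg_hom H field_algebra" "inv\<^bsub>M\<^esub> g \<in> alg_hom H field_algebra"
    using M.Units_closed[OF g] M.Units_inv_closed[OF g] by (simp_all add: M_simps)
  show 1: "convolution Hb field_algebra (inv\<^bsub>M\<^esub> g) g = counitH"
    using M.Units_l_inv[OF g] by (simp add: M_simps)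
  have 2: "convolution Hb field_algebra g (inv\<^bsub>M\<^esub> g) = counitH"
    using M.Units_r_inv[OF g] by (simp add: M_simps)
  show 3: "wmap g (wmap (inv\<^bsub>M\<^esub> g) v) = v" and 4: "wmap (inv\<^bsub>M\<^esub> g) (wmap g v) = v" for v
    using wmap_convolution[OF cl, of v] wmap_convolution[OF cl(2,1), of v] by (simp_all add: 1 2 wmap_counit)
  have "bij (wmap g)" by (rule bijI') (metis 4, metis 3)
  then show "wmap g \<in> Aut"
    using wmap_linear wmap_hom[OF cl(1)] by (simp add: poisson_aut_def)
qed

text \<open>The inverse of a Poisson automorphism preserves both operations as well, so it also
  comes from an algebra map to k; injectivity of \<open>wmap\<close> turns mutually inverse
  endomorphisms into convolution inverses.\<close>

lemma aut_wmap:
  assumes w: "w \<in> Aut"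
  obtains g where "g \<in> Units M" "wmap g = w"
proof -
  interpret M: Group.monoid M by (rule monoid_M)
  have lin: "w (u + v) = w u + w v" "w (scale c v) = scale c (w v)" for c u v
    using w by (auto simp: poisson_aut_def Vector_Spaces.linear_iff)
  have bij: "bij w" and hom: "w (pmult u v) = pmult (w u) (w v)" "w (bracket u v) = bracket (w u) (w v)" for u v
    using w by (auto simp: poisson_aut_def)
  let ?w' = "inv_into UNIV w"
  have ww: "w (?w' v) = v" "?w' (w v) = v" for v
    using bij by (simp_all add: bij_is_surj surj_f_inv_f bij_is_inj)
  obtain g where g: "g \<in> alg_hom H field_algebra" "wmap g = w"
    by (rule wmap_surj[of w]) (use w in \<open>auto simp: poisson_aut_def\<close>)
  have "Vector_Spaces.linear scale scale ?w'"
    unfolding Vector_Spaces.linear_iff using vector_space_axioms by (metis lin ww)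
  moreover have "?w' (pmult u v) = pmult (?w' u) (?w' v)" "?w' (bracket u v) = bracket (?w' u) (?w' v)" for u v
    by (metis hom ww)+
  ultimately obtain h where h: "h \<in> alg_hom H field_algebra" "wmap h = ?w'"
    using wmap_surj[of ?w'] by blast
  have "convolution Hb field_algebra g h = counitH" "convolution Hb field_algebra h g = counitH"
    using g h by (simp_all add: wmap_inj[OF convolution_alg_hom[OF k_algebra_field] counit_alg_hom]
        fun_eq_iff[of "wmap _"] wmap_convolution wmap_counit ww)
  then have "g \<in> Units M"
    unfolding Units_def using g h by (auto simp: M_simps)
  then show ?thesis using g(2) that by blast
qed

section \<open>Conjugation and its effect on coactions and gradings\<close>

lemma unit_map_linear:
  assumes "g \<in> alg_hom H field_algebra"
  shows "unit_map kG \<circ> g \<in> k_linear H (kG :: ('k, 'g::ab_group_add \<Rightarrow>\<^sub>0 'k) bialgebra)"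
    and "restrict (unit_map kG \<circ> g) (carrier H) \<in> alg_hom H (kG :: ('k, 'g \<Rightarrow>\<^sub>0 'k) bialgebra)"
proof -
  note gl = alg_hom_linear[OF assms]
  have g: "g (u \<oplus>\<^bsub>H\<^esub> v) = g u + g v" "g (c \<odot>\<^bsub>H\<^esub> u) = c * g u" "g (u \<otimes>\<^bsub>H\<^esub> v) = g u * g v" "g \<one>\<^bsub>H\<^esub> = 1"
    if "u \<in> carrier H" "v \<in> carrier H" for u v c
    using k_linear_add[OF gl that] k_linear_smult[OF gl that(1), of c] alg_hom_mult[OF assms that] alg_hom_one[OF assms]
    by simp_all
  show lin: "unit_map kG \<circ> g \<in> k_linear H (kG :: ('k, 'g \<Rightarrow>\<^sub>0 'k) bialgebra)"
    by (intro k_linearI) (auto simp: unit_map_def g pm.scale_left_distrib)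
  show "restrict (unit_map kG \<circ> g) (carrier H) \<in> alg_hom H (kG :: ('k, 'g \<Rightarrow>\<^sub>0 'k) bialgebra)"
    using g(4)[OF H.one_closed H.one_closed]
    by (intro alg_hom_restrictI[OF H.k_space_axioms lin])
      (auto simp: unit_map_def g pm_scale_mult_left)
qed

definition conjugate_hom :: "('k pair_poly set \<Rightarrow> 'k) \<Rightarrow> ('k pair_poly set \<Rightarrow> 'g::ab_group_add \<Rightarrow>\<^sub>0 'k) \<Rightarrow>
    'k pair_poly set \<Rightarrow> 'g \<Rightarrow>\<^sub>0 'k" where
  "conjugate_hom g \<theta> = convolution Hb kG (convolution Hb kG (unit_map kG \<circ> g) \<theta>) (unit_map kG \<circ> inv\<^bsub>M\<^esub> g)"

text \<open>With \<Theta> the matrix of \<theta>, the conjugate has matrix g \<Theta> g^-1, so its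
  coaction on \<open>v\<close> is the matrix of \<open>g\<close> applied to the coaction of \<theta>
  on g^-1 v.\<close>

lemma
  fixes \<theta> :: "'k pair_poly set \<Rightarrow> ('g::ab_group_add \<Rightarrow>\<^sub>0 'k)"
  assumes g: "g \<in> Units M" and \<theta>: "\<theta> \<in> alg_hom H group_alg"
  shows conjugate_hom_alg_hom: "conjugate_hom g \<theta> \<in> alg_hom H group_alg"
    and Theta_conjugate_hom: "a \<in> {1..n} \<Longrightarrow> Theta (conjugate_hom g \<theta>) v a =
      (\<Sum>r=1..n. pm_scale (g (x a r)) (Theta \<theta> (wmap (inv\<^bsub>M\<^esub> g) v) r))"
proof -
  let ?B = "kG :: ('k, 'g \<Rightarrow>\<^sub>0 'k) bialgebra"
  let ?g' = "inv\<^bsub>M\<^esub> g"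
  let ?i = "\<lambda>g. unit_map ?B \<circ> g" and ?r = "\<lambda>f. restrict f (carrier H)"
  note B = k_algebra_kG
  note gc = Units_wmap(1,2)[OF g]
  have \<theta>': "\<theta> \<in> alg_hom H ?B" using \<theta> by (simp add: alg_hom_kG)
  note \<theta>l = alg_hom_linear[OF \<theta>']
  have 1: "convolution Hb ?B (?i g) \<theta> = convolution Hb ?B (?r (?i g)) \<theta>"
    by (rule convolution_cong[OF B unit_map_linear(1)[OF gc(1)] alg_hom_linear[OF unit_map_linear(2)[OF gc(1)]] \<theta>l \<theta>l])
      simp_all
  have c1: "convolution Hb ?B (?i g) \<theta> \<in> alg_hom H ?B"
    unfolding 1 by (rule convolution_alg_hom[OF B unit_map_linear(2)[OF gc(1)] \<theta>'])
  have 2: "conjugate_hom g \<theta> = convolution Hb ?B (convolution Hb ?B (?i g) \<theta>) (?r (?i ?g'))"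
    unfolding conjugate_hom_def
    by (rule convolution_cong[OF B alg_hom_linear[OF c1] alg_hom_linear[OF c1] unit_map_linear(1)[OF gc(2)]
      alg_hom_linear[OF unit_map_linear(2)[OF gc(2)]]]) simp_all
  show "conjugate_hom g \<theta> \<in> alg_hom H group_alg"
    unfolding 2 alg_hom_kG[symmetric] by (rule convolution_alg_hom[OF B c1 unit_map_linear(2)[OF gc(2)]])
  assume a: "a \<in> {1..n}"
  have gen1: "convolution Hb ?B (?i g) \<theta> (x i j) = (\<Sum>r=1..n. pm_scale (g (x i r)) (\<theta> (x r j)))"
    if "i \<in> {1..n}" "j \<in> {1..n}" for i j
    using that by (simp add: convolution_gen[OF B unit_map_linear(1)[OF gc(1)] \<theta>l] unit_map_def pm_scale_mult_left)
  have gen: "conjugate_hom g \<theta> (x i j) = (\<Sum>s=1..n. pm_scale (?g' (x s j)) (\<Sum>r=1..n. pm_scale (g (x i r)) (\<theta> (x r s))))"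
    if "i \<in> {1..n}" "j \<in> {1..n}" for i j
    unfolding conjugate_hom_def using that
    by (simp add: convolution_gen[OF B alg_hom_linear[OF c1] unit_map_linear(1)[OF gc(2)]] gen1
        unit_map_def pm_scale_mult_right)
  have "Theta (conjugate_hom g \<theta>) v a =
      (\<Sum>i=1..n. \<Sum>s=1..n. \<Sum>r=1..n. pm_scale (crd v i * ?g' (x s i) * g (x a r)) (\<theta> (x r s)))"
    unfolding coact_def using a by (intro sum.cong refl) (simp add: gen pm.scale_sum_right mult.assoc)
  also have "\<dots> = (\<Sum>s=1..n. \<Sum>i=1..n. \<Sum>r=1..n. pm_scale (crd v i * ?g' (x s i) * g (x a r)) (\<theta> (x r s)))"
    by (rule sum.swap)
  also have "\<dots> = (\<Sum>s=1..n. \<Sum>r=1..n. \<Sum>i=1..n. pm_scale (crd v i * ?g' (x s i) * g (x a r)) (\<theta> (x r s)))"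
    by (intro sum.cong refl sum.swap)
  also have "\<dots> = (\<Sum>s=1..n. \<Sum>r=1..n. pm_scale (g (x a r)) (pm_scale (crd (wmap ?g' v) s) (\<theta> (x r s))))"
    by (intro sum.cong refl) (simp add: crd_wmap coact_def pm.scale_sum_left pm.scale_sum_right mult_ac)
  also have "\<dots> = (\<Sum>r=1..n. pm_scale (g (x a r)) (Theta \<theta> (wmap ?g' v) r))"
    by (subst sum.swap) (simp add: coact_def pm.scale_sum_right)
  finally show "Theta (conjugate_hom g \<theta>) v a = (\<Sum>r=1..n. pm_scale (g (x a r)) (Theta \<theta> (wmap ?g' v) r))" .
qed

text \<open>A matrix over k acts on the coordinates and leaves the degree untouched.\<close>

lemma scaled_single_sum:
  assumes a: "a \<in> {1..n}"
  shows "(\<Sum>r=1..n. pm_scale (g (x a r)) (single \<sigma> (crd v r))) = single \<sigma> (crd (wmap g v) a)"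
  unfolding crd_wmap[OF a] coact_def
  by (rule poly_mapping_eqI) (simp add: lookup_sum lookup_single when_def mult.commute)

text \<open>The converse is what makes the map on classes injective: a homogeneous vector for
  \<open>\<theta>2\<close> is the image under \<open>wmap g\<close> of one for
  \<open>\<theta>1\<close>, on it the coactions of \<open>\<theta>2\<close> and of the conjugate
  agree, and homogeneous vectors generate P additively. Agreement of the coactions on the basis is
  equality on the generators.\<close>

lemma conjugate_hom_iff_grad:
  fixes \<theta>1 \<theta>2 :: "'k pair_poly set \<Rightarrow> ('g::ab_group_add \<Rightarrow>\<^sub>0 'k)"
  assumes 1: "\<theta>1 \<in> bialg_hom Hb kG" and 2: "\<theta>2 \<in> bialg_hom Hb kG" and g: "g \<in> Units M"
  shows "\<theta>2 = conjugate_hom g \<theta>1 \<longleftrightarrow> (\<forall>\<sigma>. wmap g ` grad \<theta>1 \<sigma> = grad \<theta>2 \<sigma>)"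
proof
  let ?g' = "inv\<^bsub>M\<^esub> g"
  note gw = Units_wmap[OF g]
  note c = Theta_conjugate_hom[OF g bialg_alg_hom[OF 1]]
  {
    assume eq: "\<theta>2 = conjugate_hom g \<theta>1"
    show "\<forall>\<sigma>. wmap g ` grad \<theta>1 \<sigma> = grad \<theta>2 \<sigma>"
    proof (intro allI equalityI subsetI)
      fix \<sigma> u assume "u \<in> wmap g ` grad \<theta>1 \<sigma>"
      then obtain v where u: "u = wmap g v" and v: "\<forall>a\<in>{1..n}. Theta \<theta>1 v a = single \<sigma> (crd v a)"
        by (auto simp: grad_eq[OF 1])
      show "u \<in> grad \<theta>2 \<sigma>"
        unfolding grad_eq[OF 2] mem_Collect_eq
      proof
        fix a assume a: "a \<in> {1..n}"
        have "Theta \<theta>2 u a = (\<Sum>r=1..n. pm_scale (g (x a r)) (Theta \<theta>1 v r))"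
          by (simp add: eq u c[OF a] gw)
        also have "\<dots> = (\<Sum>r=1..n. pm_scale (g (x a r)) (single \<sigma> (crd v r)))"
          using v by (intro sum.cong refl) simp
        finally show "Theta \<theta>2 u a = single \<sigma> (crd u a)"
          by (simp only: scaled_single_sum[OF a] u)
      qed
    next
      fix \<sigma> u assume u: "u \<in> grad \<theta>2 \<sigma>"
      let ?v = "wmap ?g' u"
      \<comment> \<open>The coaction of \<open>\<theta>1\<close> on \<open>?v\<close> is known only
        after multiplication by the matrix of \<open>g\<close>. Below, both sides are multiplied by
        the matrix of \<open>?g'\<close>, and the convolution of \<open>?g'\<close> with
        \<open>g\<close>, the counit, leaves the coaction alone.\<close>
      have *: "(\<Sum>r=1..n. pm_scale (g (x a r)) (Theta \<theta>1 ?v r)) = single \<sigma> (crd u a)"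
        if a: "a \<in> {1..n}" for a
      proof -
        have "Theta \<theta>2 u a = single \<sigma> (crd u a)" using u a by (simp add: grad_eq[OF 2])
        then show ?thesis unfolding eq c[OF a] .
      qed
      have "?v \<in> grad \<theta>1 \<sigma>"
        unfolding grad_eq[OF 1] mem_Collect_eq
      proof
        fix b assume b: "b \<in> {1..n}"
        have "single \<sigma> (crd ?v b) = (\<Sum>a=1..n. pm_scale (?g' (x b a)) (single \<sigma> (crd u a)))"
          by (rule scaled_single_sum[OF b, symmetric])
        also have "\<dots> = (\<Sum>a=1..n. \<Sum>r=1..n. pm_scale (?g' (x b a) * g (x a r)) (Theta \<theta>1 ?v r))"
          by (intro sum.cong refl) (simp add: *[symmetric] pm.scale_sum_right)
        also have "\<dots> = (\<Sum>r=1..n. pm_scale (\<Sum>a=1..n. ?g' (x b a) * g (x a r)) (Theta \<theta>1 ?v r))"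
          by (simp add: pm.scale_sum_left) (rule sum.swap)
        also have "\<dots> = (\<Sum>r=1..n. pm_scale (if b = r then 1 else 0) (Theta \<theta>1 ?v r))"
        proof (rule sum.cong[OF refl])
          fix r assume r: "r \<in> {1..n}"
          have "(\<Sum>a=1..n. ?g' (x b a) * g (x a r)) = convolution Hb field_algebra ?g' g (x b r)"
            by (simp add: convolution_gen[OF k_algebra_field alg_hom_linear[OF gw(2)] alg_hom_linear[OF gw(1)] b r])
          then show "pm_scale (\<Sum>a=1..n. ?g' (x b a) * g (x a r)) (Theta \<theta>1 ?v r) =
            pm_scale (if b = r then 1 else 0) (Theta \<theta>1 ?v r)"
            by (simp add: gw(3) counit_gen[OF b r])
        qed
        also have "\<dots> = Theta \<theta>1 ?v b"
          using b by (simp add: if_distrib[of "\<lambda>c. pm_scale c _"] cong: if_cong)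
        finally show "Theta \<theta>1 ?v b = single \<sigma> (crd ?v b)" by simp
      qed
      then show "u \<in> wmap g ` grad \<theta>1 \<sigma>" using gw(4)[of u] by (metis image_eqI)
    qed
  next
    assume eq: "\<forall>\<sigma>. wmap g ` grad \<theta>1 \<sigma> = grad \<theta>2 \<sigma>"
    have *: "Theta \<theta>2 v a = Theta (conjugate_hom g \<theta>1) v a" if a: "a \<in> {1..n}" for v a
    proof (induction v rule: graded_induct[OF grad_in_gradings[OF 2]])
      case (1 \<sigma> u)
      then obtain v where v: "v \<in> grad \<theta>1 \<sigma>" "u = wmap g v" using eq by blast
      have "Theta (conjugate_hom g \<theta>1) u a = (\<Sum>r=1..n. pm_scale (g (x a r)) (Theta \<theta>1 v r))"
        by (simp add: c[OF a] v(2) gw)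
      also have "\<dots> = (\<Sum>r=1..n. pm_scale (g (x a r)) (single \<sigma> (crd v r)))"
        using v(1) by (intro sum.cong refl) (simp add: grad_eq[OF assms(1)])
      also have "\<dots> = single \<sigma> (crd u a)"
        by (simp only: scaled_single_sum[OF a] v(2))
      also have "\<dots> = Theta \<theta>2 u a"
        using 1 a by (simp add: grad_eq[OF 2])
      finally show ?case by simp
    next
      case (2 v w)
      then show ?case by (simp add: coact_add[OF alg_scale_group])
    qed
    show "\<theta>2 = conjugate_hom g \<theta>1"
    proof (rule univ_hom_unique[OF k_algebra_group_alg bialg_alg_hom[OF 2] conjugate_hom_alg_hom[OF g bialg_alg_hom[OF 1]]])
      fix s i assume "s \<in> {1..n}" "i \<in> {1..n}"
      then show "\<theta>2 (x s i) = conjugate_hom g \<theta>1 (x s i)"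
        using *[of s "e i"] by (simp add: coact_basis[OF alg_scale_group])
    qed
  }
qed

abbreviation "giso \<equiv> grading_iso scale pmult bracket :: (('g::ab_group_add \<Rightarrow> 'p set) \<times> ('g \<Rightarrow> 'p set)) set"

text \<open>Under \<open>wmap\<close> the units \<open>g\<close> run through exactly the
  automorphisms \<open>w\<close>, so the two existential statements coincide.\<close>

lemma conjugate_iff:
  "(\<theta>1, \<theta>2) \<in> conjugate Hb kG \<longleftrightarrow>
    \<theta>1 \<in> bialg_hom Hb kG \<and> \<theta>2 \<in> bialg_hom Hb kG \<and> (grad \<theta>1, grad \<theta>2) \<in> giso"
proof -
  have "(\<exists>g\<in>Units M. \<theta>2 = conjugate_hom g \<theta>1) \<longleftrightarrow> (grad \<theta>1, grad \<theta>2) \<in> giso"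
    if 1: "\<theta>1 \<in> bialg_hom Hb kG" and 2: "\<theta>2 \<in> bialg_hom Hb kG"
  proof -
    have "(\<exists>g\<in>Units M. \<theta>2 = conjugate_hom g \<theta>1) \<longleftrightarrow> (\<exists>g\<in>Units M. \<forall>\<sigma>. wmap g ` grad \<theta>1 \<sigma> = grad \<theta>2 \<sigma>)"
      using conjugate_hom_iff_grad[OF 1 2] by blast
    also have "\<dots> \<longleftrightarrow> (\<exists>w\<in>Aut. \<forall>\<sigma>. w ` grad \<theta>1 \<sigma> = grad \<theta>2 \<sigma>)"
      by (metis Units_wmap(6) aut_wmap)
    finally show ?thesis
      using grad_in_gradings[OF 1] grad_in_gradings[OF 2] by (simp add: grading_iso_def)
  qed
  then show ?thesis by (auto simp: conjugate_def conjugate_hom_def)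
qed

text \<open>For closure under inverses, \<open>w\<close> is written as \<open>wmap g\<close> with a
  unit \<open>g\<close>; the inverse unit then represents the inverse map.\<close>

lemma aut_group:
  "id \<in> Aut"
  "w \<in> Aut \<Longrightarrow> w' \<in> Aut \<Longrightarrow> w' \<circ> w \<in> Aut"
  "w \<in> Aut \<Longrightarrow> inv_into UNIV w \<in> Aut"
proof -
  show "id \<in> Aut"
    by (simp add: poisson_aut_def Vector_Spaces.linear_iff vector_space_axioms)
  show "w' \<circ> w \<in> Aut"
    if "w \<in> Aut" "w' \<in> Aut"
    using that by (simp add: poisson_aut_def Vector_Spaces.linear_iff bij_comp)
  assume w: "w \<in> Aut"
  then have "bij w" by (simp add: poisson_aut_def)
  then have ww: "w (inv_into UNIV w v) = v" "inv_into UNIV w (w v) = v" for v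
    by (simp_all add: bij_is_surj surj_f_inv_f bij_is_inj)
  obtain g where g: "g \<in> Units M" "wmap g = w" using w by (rule aut_wmap)
  interpret M: Group.monoid M by (rule monoid_M)
  have "wmap (inv\<^bsub>M\<^esub> g) = inv_into UNIV w"
    using Units_wmap(5)[OF g(1)] g(2) ww by (metis ext)
  then show "inv_into UNIV w \<in> Aut"
    using Units_wmap(6)[OF M.Units_inv_Units[OF g(1)]] by simp
qed

lemma equiv_iso:
  "equiv (Gr :: ('g::ab_group_add \<Rightarrow> 'p set) set) (giso :: (('g \<Rightarrow> 'p set) \<times> ('g \<Rightarrow> 'p set)) set)"
proof (rule equivI)
  show "(giso :: (('g \<Rightarrow> 'p set) \<times> ('g \<Rightarrow> 'p set)) set) \<subseteq> Gr \<times> Gr" by (auto simp: grading_iso_def)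
  show "refl_on (Gr :: ('g \<Rightarrow> 'p set) set) giso"
    using aut_group(1) by (auto simp: refl_on_def grading_iso_def intro!: bexI[of _ id])
  show "sym (giso :: (('g \<Rightarrow> 'p set) \<times> ('g \<Rightarrow> 'p set)) set)"
  proof (rule symI)
    fix D D' :: "'g \<Rightarrow> 'p set" assume DD: "(D, D') \<in> giso"
    then obtain w where w: "w \<in> Aut" "\<And>\<sigma>. w ` D \<sigma> = D' \<sigma>"
      by (auto simp: grading_iso_def)
    then have "inj w" by (simp add: poisson_aut_def bij_is_inj)
    then have "inv_into UNIV w ` D' \<sigma> = D \<sigma>" for \<sigma> by (simp add: w(2)[symmetric] image_comp)
    then show "(D', D) \<in> giso" using DD aut_group(3)[OF w(1)] by (auto simp: grading_iso_def)
  qed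
  show "trans (giso :: (('g \<Rightarrow> 'p set) \<times> ('g \<Rightarrow> 'p set)) set)"
  proof (rule transI)
    fix D D' D'' :: "'g \<Rightarrow> 'p set" assume DD: "(D, D') \<in> giso" "(D', D'') \<in> giso"
    then obtain w w' where w: "w \<in> Aut" "\<And>\<sigma>. w ` D \<sigma> = D' \<sigma>"
      "w' \<in> Aut" "\<And>\<sigma>. w' ` D' \<sigma> = D'' \<sigma>"
      by (auto simp: grading_iso_def)
    then have "(w' \<circ> w) ` D \<sigma> = D'' \<sigma>" for \<sigma> by (simp only: image_comp[symmetric])
    then have "\<exists>w\<in>Aut. \<forall>\<sigma>. w ` D \<sigma> = D'' \<sigma>"
      using aut_group(2)[OF w(1,3)] by blast
    then show "(D, D'') \<in> giso" using DD by (simp add: grading_iso_def)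
  qed
qed

end

text \<open>The induced map on classes is well defined and injective because \<open>R\<close> is the
  full pullback of \<open>S\<close> along \<open>F\<close>, and surjective because \<open>F\<close>
  is. On a class of \<open>R\<close> all members of the union are the same class of
  \<open>S\<close>.\<close>

lemma quotient_bij_of_relation_pullback:
  assumes S: "equiv B S" and F: "\<And>a. a \<in> A \<Longrightarrow> F a \<in> B"
    and R: "\<And>a a'. (a, a') \<in> R \<longleftrightarrow> a \<in> A \<and> a' \<in> A \<and> (F a, F a') \<in> S"
    and surj: "\<And>b. b \<in> B \<Longrightarrow> \<exists>a\<in>A. F a = b"
  shows "equiv A R" and "(\<lambda>a. S `` {F a}) respects R"
    and "bij_betw (\<lambda>X. \<Union>a\<in>X. S `` {F a}) (A // R) (B // S)"
proof -
  have refl: "(b, b) \<in> S" if "b \<in> B" for b using S that by (auto simp: equiv_def refl_on_def)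
  have sym: "(b, b') \<in> S \<Longrightarrow> (b', b) \<in> S" for b b' using S by (auto simp: equiv_def dest: symD)
  have trans: "(b, b') \<in> S \<Longrightarrow> (b', b'') \<in> S \<Longrightarrow> (b, b'') \<in> S" for b b' b''
    using S by (auto simp: equiv_def dest: transD)
  show eqR: "equiv A R"
  proof (rule equivI)
    show "R \<subseteq> A \<times> A" using R by auto
    show "refl_on A R" using R F refl by (auto simp: refl_on_def)
    show "sym R" using R sym by (auto intro!: symI)
    show "trans R" by (rule transI) (use R trans in blast)
  qed
  show resp: "(\<lambda>a. S `` {F a}) respects R"
    by (intro congruentI equiv_class_eq[OF S]) (simp add: R)
  have val: "(\<Union>a\<in>R `` {a0}. S `` {F a}) = S `` {F a0}" if "a0 \<in> A" for a0
    by (rule UN_equiv_class[OF eqR resp that])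
  show "bij_betw (\<lambda>X. \<Union>a\<in>X. S `` {F a}) (A // R) (B // S)"
  proof (rule bij_betw_imageI)
    show "inj_on (\<lambda>X. \<Union>a\<in>X. S `` {F a}) (A // R)"
    proof (rule inj_onI)
      fix X Y assume "X \<in> A // R" "Y \<in> A // R" and eq: "(\<Union>a\<in>X. S `` {F a}) = (\<Union>a\<in>Y. S `` {F a})"
      then obtain a a' where a: "a \<in> A" "X = R `` {a}" "a' \<in> A" "Y = R `` {a'}" by (auto elim!: quotientE)
      then have "S `` {F a} = S `` {F a'}" using eq val by simp
      then have "(F a, F a') \<in> S" using F a by (intro eq_equiv_class[OF _ S]) auto
      then show "X = Y" using a R equiv_class_eq[OF eqR] by blast
    qed
    show "(\<lambda>X. \<Union>a\<in>X. S `` {F a}) ` (A // R) = B // S"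
    proof
      show "(\<lambda>X. \<Union>a\<in>X. S `` {F a}) ` (A // R) \<subseteq> B // S"
        using F by (auto elim!: quotientE simp: val intro!: quotientI)
      show "B // S \<subseteq> (\<lambda>X. \<Union>a\<in>X. S `` {F a}) ` (A // R)"
      proof
        fix Y assume "Y \<in> B // S"
        then obtain b where "b \<in> B" "Y = S `` {b}" by (auto elim!: quotientE)
        then obtain a where "a \<in> A" "Y = S `` {F a}" using surj by blast
        then show "Y \<in> (\<lambda>X. \<Union>a\<in>X. S `` {F a}) ` (A // R)"
          using val quotientI[of a A R] by (metis image_eqI)
      qed
    qed
  qed
qed

theorem theorem3p9:
  fixes scale :: "'k::field \<Rightarrow> 'p::ab_group_add \<Rightarrow> 'p"
    and pmult bracket :: "'p \<Rightarrow> 'p \<Rightarrow> 'p"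
    and n :: nat and e :: "nat \<Rightarrow> 'p"
    and \<tau> \<mu> :: "nat \<Rightarrow> nat \<Rightarrow> nat \<Rightarrow> 'k"
  assumes "poisson_algebra scale pmult bracket"
    and "basis_family scale n e"
    and "\<And>i j. i \<in> {1..n} \<Longrightarrow> j \<in> {1..n} \<Longrightarrow>
           pmult (e i) (e j) = (\<Sum>s=1..n. scale (\<tau> i j s) (e s))"
    and "\<And>i j. i \<in> {1..n} \<Longrightarrow> j \<in> {1..n} \<Longrightarrow>
           bracket (e i) (e j) = (\<Sum>s=1..n. scale (\<mu> i j s) (e s))"
  shows "let kG = (group_bialgebra :: ('k, 'g::ab_group_add \<Rightarrow>\<^sub>0 'k) bialgebra);
             H = univ_bialgebra n \<tau> \<mu>;
             Gr = gradings scale pmult bracket;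
             iso = grading_iso scale pmult bracket;
             cls = (\<lambda>\<theta>. iso `` {induced_grading scale n e \<tau> \<mu> \<theta>})
         in equiv (bialg_hom H kG) (conjugate H kG) \<and> equiv Gr iso \<and>
            (\<forall>\<theta>\<in>bialg_hom H kG. induced_grading scale n e \<tau> \<mu> \<theta> \<in> Gr) \<and>
            cls respects conjugate H kG \<and>
            bij_betw (\<lambda>X. \<Union>\<theta>\<in>X. cls \<theta>) (bialg_hom H kG // conjugate H kG) (Gr // iso)"
proof -
  interpret poisson_algebra scale pmult bracket by fact
  interpret poisson_basis scale pmult bracket n \<tau> \<mu> e
    by unfold_locales (use assms in auto)
  \<comment> \<open>Here \<open>F\<close> is \<open>grad\<close> and \<open>S\<close> is
    \<open>giso\<close>: gradings arise by \<open>grad_in_gradings\<close>, conjugacy is the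
    pullback by \<open>conjugate_iff\<close>, and every grading is attained by
    \<open>grad_surj\<close>.\<close>
  note q = quotient_bij_of_relation_pullback[OF equiv_iso grad_in_gradings conjugate_iff grad_surj]
  show ?thesis
    unfolding Let_def using q equiv_iso grad_in_gradings by blast
qed

end
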